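(* For $x>0$ let $$\mathcal{S}(x)=\sum_{\substack{m\in\mathbb{Z}_{\ge 0},\ n\in\mathbb{Z}\\ m^2+n^2<x}} r_2(m),\qquad \mathcal{E}(x)=\mathcal{S}(x)-\frac{\pi^{2}}{2}x .$$ Then $$\limsup_{x\to\infty}\frac{\mathcal{E}(x)}{x^{1/2}}=+\infty \qquad\text{and}\qquad \liminf_{x\to\infty}\frac{\mathcal{E}(x)}{x^{1/2}}=-\infty .$$
   Context: $r_2(m)=|\{(a,b)\in\mathbb{Z}^2: a^2+b^2=m\}|$ for integers $m\ge 0$ (so $r_2(0)=1$). The quantity $\mathcal{S}(x)$ equals the number of points $(a,b,w)\in\mathbb{Z}^3$ with $(a^2+b^2)^2+w^2<x$, i.e. the number of integer points of the first Heisenberg group $\mathbb{R}^3$ in the open ball of radius $t=x^{1/4}$ for the Cygan–Korányi norm $\mathcal{N}_{4,1}(z,w)=(|z|^4+w^2)^{1/4}$, $z=a+ib$; one has $\mathcal{S}(x)\sim\frac{\pi^2}{2}x$. *)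

theory Defs
  imports "HOL-Analysis.Analysis"
begin

definition r2 :: "nat \<Rightarrow> nat" where
  "r2 m = card {(a :: int, b :: int). a\<^sup>2 + b\<^sup>2 = int m}"

definition S_index :: "real \<Rightarrow> (nat \<times> int) set" where
  "S_index x = {(m, n). (real m)\<^sup>2 + (real_of_int n)\<^sup>2 < x}"

definition heis_count :: "real \<Rightarrow> nat" where
  "heis_count x = (\<Sum>(m, n) \<in> S_index x. r2 m)"

definition heis_error :: "real \<Rightarrow> real" where
  "heis_error x = real (heis_count x) - pi\<^sup>2 / 2 * x"

text \<open>\<^const>\<open>card\<close> and \<^const>\<open>sum\<close> return 0 on infinite sets; the following two lemmas
  show that this convention plays no role here.\<close>

lemma abs_le_of_int_square_le:
  fixes a :: int
  assumes "a\<^sup>2 \<le> k"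
  shows "a \<in> {-k..k}"
proof -
  have "\<bar>a\<bar> \<le> a\<^sup>2"
    using self_le_power[of "\<bar>a\<bar>" 2] by (cases "a = 0") auto
  then show ?thesis using assms by auto
qed

lemma finite_r2_set: "finite {(a :: int, b :: int). a\<^sup>2 + b\<^sup>2 = int m}"
proof (rule finite_subset)
  show "{(a :: int, b :: int). a\<^sup>2 + b\<^sup>2 = int m} \<subseteq> {- int m..int m} \<times> {- int m..int m}"
  proof (rule subrelI)
    fix a b :: int
    assume "(a, b) \<in> {(a :: int, b :: int). a\<^sup>2 + b\<^sup>2 = int m}"
    then have h: "a\<^sup>2 + b\<^sup>2 = int m" by simp
    have "a\<^sup>2 \<le> int m" "b\<^sup>2 \<le> int m"
      using h zero_le_power2[of a] zero_le_power2[of b] by linarith+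
    then have "a \<in> {- int m..int m}" "b \<in> {- int m..int m}"
      using abs_le_of_int_square_le by blast+
    then show "(a, b) \<in> {- int m..int m} \<times> {- int m..int m}" by simp
  qed
qed simp

lemma finite_S_index: "finite (S_index x)"
proof (rule finite_subset)
  define k where "k = \<lceil>x\<rceil>"
  show "S_index x \<subseteq> {..nat k} \<times> {-k..k}"
  proof (rule subrelI)
    fix m :: nat and n :: int
    assume "(m, n) \<in> S_index x"
    then have h: "(real m)\<^sup>2 + (real_of_int n)\<^sup>2 < x"
      by (simp add: S_index_def)
    have "real_of_int ((int m)\<^sup>2) \<le> real_of_int k" "real_of_int (n\<^sup>2) \<le> real_of_int k"
      using h zero_le_power2[of "real m"] zero_le_power2[of "real_of_int n"]
        le_of_int_ceiling[of x]
      unfolding k_def of_int_power of_int_of_nat_eq by linarith+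
    then have "(int m)\<^sup>2 \<le> k" "n\<^sup>2 \<le> k"
      by (simp_all only: of_int_le_iff)
    then have "int m \<in> {-k..k}" "n \<in> {-k..k}"
      using abs_le_of_int_square_le by blast+
    then show "(m, n) \<in> {..nat k} \<times> {-k..k}" by auto
  qed
qed simp

end

theory Submission
  imports Defs "HOL-Probability.Probability" "HOL-Complex_Analysis.Complex_Analysis"
    "HOL-Computational_Algebra.Squarefree" "HOL-Real_Asymp.Real_Asymp"
begin

text \<open>
  Write \<open>x = t\<^sup>4\<close>. Up to \<open>O(t\<^sup>2)\<close> the count is the sum of \<open>2 sqrt (t\<^sup>4 - |z|\<^sup>4)\<close> over the lattice
  points \<open>z\<close> with \<open>|z| < t\<close>, and, again up to \<open>O(t\<^sup>2)\<close>, the error of that sum is \<open>sqrt 2 * t\<close> times the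
  error \<open>E t\<close> of the sum of the chords \<open>2 sqrt (t\<^sup>2 - |z|\<^sup>2)\<close> of a ball in space. It therefore
  suffices that \<open>E t / t\<close> is unbounded in both directions.

  By theta inversion the Laplace transform of \<open>2 * t * E t\<close> is the sum of
  \<open>64 * pi * s / (s\<^sup>2 + 4 * pi\<^sup>2 * |\<xi>|\<^sup>2) ^ 3\<close> over the nonzero lattice points \<open>\<xi>\<close>, so \<open>E t / t\<close>
  behaves in mean like \<open>- (1 / pi)\<close> times the sum of \<open>cos (2 * pi * |\<xi>| * t) / |\<xi>|\<^sup>2\<close>.
      The frequencies are
  integer multiples of the rationally independent numbers \<open>sqrt q\<close> with \<open>q\<close> squarefree. A one-sided
  bound for \<open>E t / t\<close> is tested against a product of Fejer kernels in the \<open>sqrt q * t\<close>, centred at \<open>0\<close>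
  or at \<open>1/2\<close>; it bounds the sum of \<open>1 / |\<xi>|\<^sup>2\<close> over \<open>\<xi>\<close> with odd \<open>|\<xi>|\<^sup>2\<close>, which diverges.
\<close>

subsection \<open>Linear independence of square roots\<close>

text \<open>Chords can replace the true summands because
  \<open>2 sqrt (t^2 - |z|^2) * sqrt (t^2 + |z|^2)\<close> has the same square root singularity at
  \<open>|z| = t\<close> as \<open>sqrt 2 * t\<close> times a chord; the difference vanishes there
  to order 3/2, smooth enough for elementary summation. Against
  \<open>2 * t * exp (- t^2 / w^2)\<close> a chord integrates to a Gaussian in z, and
  \<open>exp (- s * t)\<close> is a mixture of Gaussians in t, so the dual sum is exact and all its
  terms are positive. Each frequency is a triple pole on the imaginary axis, of the same order as
  the pole at 0 of the transform of \<open>t^2\<close>. Multiplying by \<open>\<sigma>^3\<close>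
  thus compares the Bohr coefficients of the error with the constant of the assumed bound. The
  difficulty lies in the signs. Centre 0 gives every cosine the value 1. Centre 1/2 gives (-1)^k for
  \<open>|\<xi>| = k * sqrt q\<close>, q squarefree, so points with even k count against the claim.
  Such a point is twice a lattice point of at least four times its weight, hence the odd points
  prevail.\<close>

fun sqrt_field :: "nat list \<Rightarrow> real set" where
  "sqrt_field [] = \<rat>"
| "sqrt_field (p # ps) = {a + b * sqrt (real p) | a b. a \<in> sqrt_field ps \<and> b \<in> sqrt_field ps}"

lemma sqrt_field_ConsI:
  "a \<in> sqrt_field ps \<Longrightarrow> b \<in> sqrt_field ps \<Longrightarrow> x = a + b * sqrt (real p) \<Longrightarrow> x \<in> sqrt_field (p # ps)"
  by auto

lemma sqrt_field_Rats: "x \<in> \<rat> \<Longrightarrow> x \<in> sqrt_field ps"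
proof (induction ps arbitrary: x)
  case (Cons p ps)
  then show ?case by (intro sqrt_field_ConsI[of x ps 0]) auto
qed auto

lemma sqrt_field_add: "x \<in> sqrt_field ps \<Longrightarrow> y \<in> sqrt_field ps \<Longrightarrow> x + y \<in> sqrt_field ps"
proof (induction ps arbitrary: x y)
  case (Cons p ps)
  then obtain a b c d where *: "x = a + b * sqrt p" "y = c + d * sqrt p"
    "a \<in> sqrt_field ps" "b \<in> sqrt_field ps" "c \<in> sqrt_field ps" "d \<in> sqrt_field ps" by auto
  then have "x + y = (a + c) + (b + d) * sqrt p" by (simp add: algebra_simps)
  moreover have "a + c \<in> sqrt_field ps" "b + d \<in> sqrt_field ps" using * Cons.IH by auto
  ultimately show ?case by (intro sqrt_field_ConsI)
qed auto

lemma sqrt_field_mult: "x \<in> sqrt_field ps \<Longrightarrow> y \<in> sqrt_field ps \<Longrightarrow> x * y \<in> sqrt_field ps"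
proof (induction ps arbitrary: x y)
  case (Cons p ps)
  then obtain a b c d where *: "x = a + b * sqrt p" "y = c + d * sqrt p"
    "a \<in> sqrt_field ps" "b \<in> sqrt_field ps" "c \<in> sqrt_field ps" "d \<in> sqrt_field ps" by auto
  have "x * y = (a * c + b * d * (sqrt p * sqrt p)) + (a * d + b * c) * sqrt p"
    unfolding * by (simp add: algebra_simps)
  then have "x * y = (a * c + b * d * real p) + (a * d + b * c) * sqrt p" by simp
  moreover have "a * c + b * d * real p \<in> sqrt_field ps" "a * d + b * c \<in> sqrt_field ps"
    using * Cons.IH sqrt_field_add sqrt_field_Rats by simp_all
  ultimately show ?case by (intro sqrt_field_ConsI)
qed auto

lemma sqrt_field_minus: "x \<in> sqrt_field ps \<Longrightarrow> - x \<in> sqrt_field ps"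
  using sqrt_field_mult[of "-1" ps x] sqrt_field_Rats[of "-1" ps] by simp

lemma sqrt_field_diff: "x \<in> sqrt_field ps \<Longrightarrow> y \<in> sqrt_field ps \<Longrightarrow> x - y \<in> sqrt_field ps"
  using sqrt_field_add[of x ps "-y"] sqrt_field_minus[of y ps] by simp

lemma sqrt_field_sum: "(\<And>i. i \<in> A \<Longrightarrow> f i \<in> sqrt_field ps) \<Longrightarrow> sum f A \<in> sqrt_field ps"
  by (induction A rule: infinite_finite_induct) (auto intro: sqrt_field_add sqrt_field_Rats)

lemma sqrt_field_Cons_I: "x \<in> sqrt_field ps \<Longrightarrow> x \<in> sqrt_field (p # ps)"
  using sqrt_field_Rats[of 0 ps] by (intro sqrt_field_ConsI[of x ps 0]) auto

lemma sqrt_in_sqrt_field: "p \<in> set ps \<Longrightarrow> sqrt (real p) \<in> sqrt_field ps"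
proof (induction ps)
  case (Cons r ps)
  show ?case
  proof (cases "p = r")
    case True
    then show ?thesis using sqrt_field_Rats[of 0 ps] sqrt_field_Rats[of 1 ps]
      by (intro sqrt_field_ConsI[of 0 ps 1]) auto
  next
    case False
    with Cons show ?thesis by (simp add: sqrt_field_Cons_I del: sqrt_field.simps)
  qed
qed auto

lemma sqrt_squarefree_irrational:
  assumes "squarefree d" "d > 1"
  shows "sqrt (real d) \<notin> \<rat>"
proof
  assume "sqrt (real d) \<in> \<rat>"
  then obtain m n :: nat where n: "n \<noteq> 0" and "\<bar>sqrt (real d)\<bar> = real m / real n" and "coprime m n"
    by (rule Rats_abs_nat_div_natE)
  then have "sqrt (real d) * real n = real m" by simp
  then have "(sqrt (real d))\<^sup>2 * (real n)\<^sup>2 = (real m)\<^sup>2" by (metis power_mult_distrib)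
  then have "real (d * n\<^sup>2) = real (m\<^sup>2)" by simp
  then have eq: "d * n\<^sup>2 = m\<^sup>2" using of_nat_eq_iff by blast
  then have "n\<^sup>2 dvd m\<^sup>2" by (metis dvd_triv_right)
  then have "n dvd m" by simp
  with \<open>coprime m n\<close> have "n = 1" using \<open>n dvd m\<close> coprime_common_divisor[of m n n] by simp
  with eq have "m\<^sup>2 dvd d" by simp
  then have "m dvd 1" using assms squarefreeD by blast
  then show False using eq \<open>n = 1\<close> assms by simp
qed

text \<open>The two claims feed each other along the tower of quadratic extensions: a nonzero
  element of the larger field has nonzero norm because \<open>sqrt p\<close> is new, and excluding a
  root \<open>sqrt d\<close> requires division. The second claim ranges over all squarefree d prime
  to the list, since the induction step passes from d to \<open>d * p\<close>.\<close>

lemma sqrt_field_inverse_and_sqrt_notin: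
  assumes "distinct ps" "\<And>p. p \<in> set ps \<Longrightarrow> prime p"
  shows "(\<forall>x. x \<in> sqrt_field ps \<longrightarrow> inverse x \<in> sqrt_field ps) \<and>
         (\<forall>d. squarefree d \<longrightarrow> d > 1 \<longrightarrow> (\<forall>p\<in>set ps. \<not> p dvd d) \<longrightarrow> sqrt (real d) \<notin> sqrt_field ps)"
  using assms
proof (induction ps)
  case Nil
  then show ?case using sqrt_squarefree_irrational by (auto simp: Rats_inverse)
next
  case (Cons p ps)
  then have inv: "\<And>x. x \<in> sqrt_field ps \<Longrightarrow> inverse x \<in> sqrt_field ps"
    and nin: "\<And>d. squarefree d \<Longrightarrow> d > 1 \<Longrightarrow> (\<forall>p\<in>set ps. \<not> p dvd d) \<Longrightarrow> sqrt (real d) \<notin> sqrt_field ps"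
    by auto
  have p: "prime p" and pps: "p \<notin> set ps" and prs: "\<And>r. r \<in> set ps \<Longrightarrow> prime r" using Cons by auto
  have ndvd: "\<not> r dvd p" if "r \<in> set ps" for r
    using p prs[OF that] pps that primes_dvd_imp_eq by blast
  have sp: "sqrt (real p) \<notin> sqrt_field ps"
    by (rule nin) (use p ndvd prime_gt_1_nat[OF p] in \<open>auto simp: squarefree_prime\<close>)
  have div: "x / y \<in> sqrt_field ps" if "x \<in> sqrt_field ps" "y \<in> sqrt_field ps" for x y
    using sqrt_field_mult[OF that(1) inv[OF that(2)]] by (simp add: divide_inverse)
  show ?case
  proof (intro conjI allI impI)
    fix x assume "x \<in> sqrt_field (p # ps)"
    then obtain a b where x: "x = a + b * sqrt p" and ab: "a \<in> sqrt_field ps" "b \<in> sqrt_field ps"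
      by auto
    show "inverse x \<in> sqrt_field (p # ps)"
    proof (cases "b = 0")
      case True
      then show ?thesis using inv ab x sqrt_field_Cons_I by (simp del: sqrt_field.simps)
    next
      case False
      \<comment> \<open>The norm of x over the smaller field. Both conjugate factors are nonzero
        because \<open>sqrt p\<close> is not a quotient of elements of that field.\<close>
      define N where "N = a * a - b * b * real p"
      have "N = (a + b * sqrt p) * (a - b * sqrt p)" unfolding N_def by (simp add: algebra_simps)
      moreover have "a + b * sqrt p \<noteq> 0"
      proof
        assume "a + b * sqrt p = 0"
        then have "sqrt p = (- a) / b" using False by (simp add: field_simps)
        then show False using sp div ab sqrt_field_minus by metis
      qed
      moreover have "a - b * sqrt p \<noteq> 0"
      proof
        assume "a - b * sqrt p = 0"
        then have "sqrt p = a / b" using False by (simp add: field_simps)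
        then show False using sp div ab by metis
      qed
      ultimately have "inverse x = (a - b * sqrt p) / N" unfolding x
        by (simp add: inverse_eq_divide)
      then have eq: "inverse x = a / N + (- b / N) * sqrt p" by (simp add: diff_divide_distrib)
      have "N \<in> sqrt_field ps" unfolding N_def
        using ab sqrt_field_Rats[of "real p" ps] by (intro sqrt_field_diff sqrt_field_mult) auto
      then have "a / N \<in> sqrt_field ps" "- b / N \<in> sqrt_field ps"
        using ab div sqrt_field_minus by blast+
      then show ?thesis using eq by (intro sqrt_field_ConsI)
    qed
  next
    fix d assume d: "squarefree d" "d > 1" "\<forall>r\<in>set (p # ps). \<not> r dvd d"
    show "sqrt (real d) \<notin> sqrt_field (p # ps)"
    proof
      assume "sqrt (real d) \<in> sqrt_field (p # ps)"
      then obtain a b where x: "sqrt d = a + b * sqrt p" and ab: "a \<in> sqrt_field ps" "b \<in> sqrt_field ps"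
        by auto
      have nd: "sqrt (real d) \<notin> sqrt_field ps" using nin d by simp
      have b0: "b \<noteq> 0" using x nd ab by auto
      \<comment> \<open>Otherwise \<open>sqrt d = b * sqrt p\<close> would put
        \<open>sqrt (d * p)\<close> into the smaller field.\<close>
      have "a \<noteq> 0"
      proof
        assume "a = 0"
        then have "sqrt d * sqrt p = b * (sqrt p * sqrt p)" using x by simp
        then have "sqrt (real (d * p)) = b * real p" by (simp add: real_sqrt_mult)
        moreover have "sqrt (real (d * p)) \<notin> sqrt_field ps"
        proof (rule nin)
          have "coprime d p" using d p
            by (metis coprime_commute list.set_intros(1) prime_imp_coprime_nat)
          then show "squarefree (d * p)" using d p
            by (simp add: squarefree_mult_coprime squarefree_prime)
          show "d * p > 1" using d p by (metis less_1_mult prime_gt_1_nat)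
          show "\<forall>r\<in>set ps. \<not> r dvd d * p" using d(3) ndvd prs by (auto simp: prime_dvd_mult_iff)
        qed
        ultimately show False using ab sqrt_field_mult sqrt_field_Rats[of "real p" ps] by simp
      qed
      \<comment> \<open>With a and b nonzero, squaring \<open>sqrt d = a + b * sqrt p\<close>
        expresses \<open>sqrt p\<close> itself in the smaller field.\<close>
      have "real d = (a + b * sqrt p) * (a + b * sqrt p)" using x[symmetric] by simp
      also have "\<dots> = a * a + b * b * (sqrt p * sqrt p) + 2 * a * b * sqrt p"
        by (simp add: algebra_simps)
      finally have "real d = a * a + b * b * real p + 2 * a * b * sqrt p" by simp
      then have "sqrt p = (real d - a * a - b * b * real p) / (2 * a * b)"
        using \<open>a \<noteq> 0\<close> b0 by (simp add: field_simps)
      moreover have "real d - a * a - b * b * real p \<in> sqrt_field ps" "2 * a * b \<in> sqrt_field ps"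
        using ab sqrt_field_Rats[of "real p" ps] sqrt_field_Rats[of
            "real d" ps] sqrt_field_Rats[of 2 ps]
        by (auto intro!: sqrt_field_diff sqrt_field_mult)
      ultimately show False using sp div by metis
    qed
  qed
qed

lemma sqrt_in_sqrt_field_squarefree:
  assumes "squarefree d" "\<And>p. prime p \<Longrightarrow> p dvd d \<Longrightarrow> p \<in> set ps"
  shows "sqrt (real d) \<in> sqrt_field ps"
  using assms
proof (induction d rule: less_induct)
  case (less d)
  show ?case
  proof (cases "d = 1")
    case False
    then obtain p where p: "prime p" "p dvd d" using prime_factor_nat by blast
    then obtain e where e: "d = p * e" by blast
    have "d > 0" using less.prems by (cases d) auto
    then have "e < d" using e prime_gt_1_nat[OF p(1)] by simp
    moreover have "squarefree e" using less.prems e squarefree_mono by (metis dvd_triv_right)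
    ultimately have "sqrt (real e) \<in> sqrt_field ps" using less e by (meson dvd_mult)
    moreover have "sqrt (real p) \<in> sqrt_field ps" using sqrt_in_sqrt_field p less.prems by blast
    ultimately show ?thesis using sqrt_field_mult by (simp add: e real_sqrt_mult)
  qed (auto simp: sqrt_field_Rats)
qed

text \<open>Sorting Q by divisibility by p gives \<open>A + B * sqrt p = 0\<close> with A and B in
  the field of the remaining primes. As \<open>sqrt p\<close> is outside that field, A and B both
  vanish, and the induction hypothesis applies to each. Squarefreeness ensures that
  \<open>q div p\<close> is free of p.\<close>

lemma sqrt_squarefree_independent_list:
  assumes "distinct ps" "\<And>p. p \<in> set ps \<Longrightarrow> prime p"
    and "finite Q" "\<And>q. q \<in> Q \<Longrightarrow> squarefree q"
    and "\<And>q p. q \<in> Q \<Longrightarrow> prime p \<Longrightarrow> p dvd q \<Longrightarrow> p \<in> set ps"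
    and "\<And>q. q \<in> Q \<Longrightarrow> c q \<in> \<rat>" and "(\<Sum>q\<in>Q. c q * sqrt (real q)) = 0" and "q \<in> Q"
  shows "c q = 0"
  using assms
proof (induction ps arbitrary: Q c q)
  case Nil
  have "r = 1" if "r \<in> Q" for r using Nil that prime_factor_nat by (metis empty_iff empty_set)
  then have "q = 1" "Q \<subseteq> {1}" using Nil.prems(8) by auto
  then have "Q = {1}" using Nil.prems(8) by auto
  then show ?case using Nil.prems(7) \<open>q = 1\<close> by simp
next
  case (Cons p ps)
  have p: "prime p" and pps: "p \<notin> set ps" using Cons.prems by auto
  define Q1 where "Q1 = {q \<in> Q. \<not> p dvd q}"
  define Q2 where "Q2 = (\<lambda>q. q div p) ` {q \<in> Q. p dvd q}"
  have Q: "Q = Q1 \<union> (\<lambda>r. p * r) ` Q2" "Q1 \<inter> (\<lambda>r. p * r) ` Q2 = {}"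
    by (auto simp: Q1_def Q2_def image_iff)
  have fin: "finite Q1" "finite Q2" using Cons.prems by (auto simp: Q1_def Q2_def)
  have inj: "inj_on (\<lambda>r. p * r) Q2" using p by (auto simp: inj_on_def)
  define A where "A = (\<Sum>q\<in>Q1. c q * sqrt (real q))"
  define B where "B = (\<Sum>r\<in>Q2. c (p * r) * sqrt (real r))"
  have "0 = A + (\<Sum>r\<in>Q2. c (p * r) * sqrt (real (p * r)))"
    using Cons.prems(7) fin Q inj unfolding A_def by (simp add: Q(1) sum.union_disjoint sum.reindex)
  also have "(\<Sum>r\<in>Q2. c (p * r) * sqrt (real (p * r))) = B * sqrt p"
    by (simp add: B_def sum_distrib_right sum_distrib_left real_sqrt_mult mult_ac)
  finally have AB: "A + B * sqrt p = 0" by simp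
  have Q1p: "squarefree q" "prime r \<Longrightarrow> r dvd q \<Longrightarrow> r \<in> set ps" "c q \<in> \<rat>" if "q \<in> Q1" for q r
    using that Cons.prems(4-6)[of q] Q unfolding Q1_def by auto
  have Q2p: "squarefree q" "prime r \<Longrightarrow> r dvd q \<Longrightarrow> r \<in> set ps" "c (p * q) \<in> \<rat>" if "q \<in> Q2" for q r
  proof -
    have pq: "p * q \<in> Q" using that Q by blast
    then have sf: "squarefree (p * q)" and "c (p * q) \<in> \<rat>" using Cons.prems by auto
    then show "c (p * q) \<in> \<rat>" by simp
    show "squarefree q" using sf squarefree_mono by (metis dvd_triv_right)
    assume r: "prime r" "r dvd q"
    have "r \<in> set (p # ps)" using Cons.prems(5)[OF pq r(1)] r by simp
    moreover have "r \<noteq> p"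
    proof
      assume "r = p"
      then have "p\<^sup>2 dvd p * q" using r by (simp add: power2_eq_square)
      then have "p dvd 1" using sf squarefreeD by blast
      then show False using p by simp
    qed
    ultimately show "r \<in> set ps" by simp
  qed
  have Ain: "A \<in> sqrt_field ps" unfolding A_def
    by (intro sqrt_field_sum sqrt_field_mult sqrt_field_Rats sqrt_in_sqrt_field_squarefree)
        (use Q1p in auto)
  have Bin: "B \<in> sqrt_field ps" unfolding B_def
    by (intro sqrt_field_sum sqrt_field_mult sqrt_field_Rats sqrt_in_sqrt_field_squarefree)
        (use Q2p in auto)
  have fld: "(\<forall>x. x \<in> sqrt_field ps \<longrightarrow> inverse x \<in> sqrt_field ps) \<and>
         (\<forall>d. squarefree d \<longrightarrow> d > 1 \<longrightarrow> (\<forall>p\<in>set ps. \<not> p dvd d) \<longrightarrow> sqrt (real d) \<notin> sqrt_field ps)"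
    by (rule sqrt_field_inverse_and_sqrt_notin) (use Cons.prems in auto)
  have sp: "sqrt p \<notin> sqrt_field ps"
  proof -
    have "\<forall>r\<in>set ps. \<not> r dvd p" using Cons.prems p pps primes_dvd_imp_eq by (metis list.set_intros(2))
    then show ?thesis using fld squarefree_prime[OF p] prime_gt_1_nat[OF p] by blast
  qed
  have "B = 0"
  proof (rule ccontr)
    assume "B \<noteq> 0"
    then have "sqrt p = - A * inverse B" using AB by (simp add: field_simps)
    then show False using sp fld Ain Bin sqrt_field_mult sqrt_field_minus by metis
  qed
  then have "A = 0" using AB by simp
  have d: "distinct ps" "\<And>p. p \<in> set ps \<Longrightarrow> prime p" using Cons.prems by auto
  from \<open>q \<in> Q\<close> consider "q \<in> Q1" | r where "r \<in> Q2" "q = p * r" using Q by auto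
  then show ?case
  proof cases
    case 1
    show ?thesis
      by (rule Cons.IH[OF d fin(1) Q1p \<open>A = 0\<close>[unfolded A_def] 1])
  next
    case 2
    have "c (p * r) = 0"
      by (rule Cons.IH[OF d fin(2) Q2p \<open>B = 0\<close>[unfolded B_def] 2(1)])
    then show ?thesis using 2 by simp
  qed
qed

lemma sqrt_squarefree_independent:
  fixes c :: "nat \<Rightarrow> int"
  assumes "finite Q" "\<And>q. q \<in> Q \<Longrightarrow> squarefree q"
    and "(\<Sum>q\<in>Q. of_int (c q) * sqrt (real q)) = 0" and "q \<in> Q"
  shows "c q = 0"
proof -
  define P where "P = {p. prime p \<and> (\<exists>q\<in>Q. p dvd q)}"
  have "p \<le> q" if "q \<in> Q" "p dvd q" for p q
    using assms(2)[OF that(1)] that(2) dvd_imp_le by (cases "q = 0") auto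
  then have "P \<subseteq> (\<Union>q\<in>Q. {..q})" unfolding P_def by blast
  then have "finite P" using assms(1) finite_subset by blast
  then obtain ps where ps: "set ps = P" "distinct ps" using finite_distinct_list by blast
  have "real_of_int (c q) = 0"
    by (rule sqrt_squarefree_independent_list[of ps Q "\<lambda>q. of_int (c q)"])
       (use assms ps in \<open>auto simp: P_def\<close>)
  then show ?thesis by simp
qed

subsection \<open>The Fejer kernel and Poisson summation\<close>

text \<open>Going from N to N + 1 adds the Dirichlet sum over \<open>|j| \<le> N\<close>. Expanding
  \<open>|E + cis (N * \<theta>)|^2\<close> adds the same terms: the two cross terms are the sums
  over negative and positive j, the new square is j = 0.\<close>

lemma fejer_identity:
  "(\<Sum>j\<in>{-int N<..<int N}. of_real (real N - \<bar>of_int j\<bar>) * cis (of_int j * \<theta>)) =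
     of_real ((cmod (\<Sum>j<N. cis (real j * \<theta>)))\<^sup>2)"
proof (induction N)
  case (Suc N)
  let ?c = "\<lambda>j::int. cis (of_int j * \<theta>)"
  define E where "E = (\<Sum>j<N. cis (real j * \<theta>))"
  have set: "{-int (Suc N)<..<int (Suc N)} = {-int N..int N}" by auto
  have "(\<Sum>j\<in>{-int N..int N}. of_real (real N - \<bar>of_int j\<bar>) * ?c j) =
        (\<Sum>j\<in>{-int N<..<int N}. of_real (real N - \<bar>of_int j\<bar>) * ?c j)"
  proof (rule sum.mono_neutral_right)
    show "\<forall>i\<in>{- int N..int N} - {- int N<..<int N}. of_real (real N - \<bar>of_int i\<bar>) * ?c i = 0"
    proof
      fix i assume "i \<in> {- int N..int N} - {- int N<..<int N}"
      then have "i = int N \<or> i = - int N" by auto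
      then show "of_real (real N - \<bar>of_int i\<bar>) * ?c i = 0" by auto
    qed
  qed auto
  then have 1: "(\<Sum>j\<in>{-int (Suc N)<..<int (Suc N)}. of_real (real (Suc N) - \<bar>of_int j\<bar>) * ?c j) =
     of_real ((cmod E)\<^sup>2) + (\<Sum>j\<in>{-int N..int N}. ?c j)"
  proof -
    assume *: "(\<Sum>j\<in>{-int N..int N}. of_real (real N - \<bar>of_int j\<bar>) * ?c j) =
        (\<Sum>j\<in>{-int N<..<int N}. of_real (real N - \<bar>of_int j\<bar>) * ?c j)"
    have "(\<Sum>j\<in>{-int N..int N}. of_real (real (Suc N) - \<bar>of_int j\<bar>) * ?c j) =
          (\<Sum>j\<in>{-int N..int N}. of_real (real N - \<bar>of_int j\<bar>) * ?c j + ?c j)"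
      by (intro sum.cong refl) (simp add: algebra_simps)
    then show ?thesis using * Suc.IH unfolding set E_def by (simp only: sum.distrib)
  qed
  have split: "{-int N..int N} = {-int N..-1} \<union> ({0} \<union> {1..int N})" by auto
  have 2: "(\<Sum>j\<in>{-int N..int N}. ?c j) = (\<Sum>j\<in>{-int N..-1}. ?c j) + (1 + (\<Sum>j\<in>{1..int N}. ?c j))"
    unfolding split by (subst sum.union_disjoint, simp, simp, force, subst sum.union_disjoint) auto
  have 3: "(\<Sum>j\<in>{-int N..-1}. ?c j) = E * cnj (cis (real N * \<theta>))"
    unfolding E_def sum_distrib_right
    by (rule sum.reindex_bij_witness[of _ "\<lambda>j. int j - int N" "\<lambda>i. nat (i + int N)"])
       (auto simp: cis_cnj cis_mult algebra_simps)
  have 4: "(\<Sum>j\<in>{1..int N}. ?c j) = cis (real N * \<theta>) * cnj E"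
    unfolding E_def sum_distrib_left cnj_sum
    by (rule sum.reindex_bij_witness[of _ "\<lambda>j. int N - int j" "\<lambda>i. nat (int N - i)"])
       (auto simp: cis_cnj cis_mult algebra_simps)
  have "of_real ((cmod (E + cis (real N * \<theta>)))\<^sup>2) = (E + cis (real N * \<theta>)) * cnj (E + cis (real N * \<theta>))"
    by (rule complex_norm_square)
  also have "\<dots> = E * cnj E + cis (real N * \<theta>) * cnj (cis (real N * \<theta>)) + E * cnj (cis (real N * \<theta>))
      + cis (real N * \<theta>) * cnj E"
    by (simp add: algebra_simps)
  also have "cis (real N * \<theta>) * cnj (cis (real N * \<theta>)) = 1" by (simp add: cis_cnj cis_mult)
  also have "E * cnj E = of_real ((cmod E)\<^sup>2)" by (rule complex_norm_square[symmetric])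
  finally show ?case unfolding 1 2 3 4 by (simp add: E_def)
qed auto

text \<open>The constant coefficient is normalised to 1. The cosine form suits integration;
  nonnegativity becomes visible in \<open>fejer_eq\<close>.\<close>

definition fejer :: "nat \<Rightarrow> real \<Rightarrow> real" where
  "fejer N \<theta> = (\<Sum>j\<in>{-int N<..<int N}. (1 - \<bar>of_int j\<bar> / real N) * cos (of_int j * \<theta>))"

lemma fejer_complex:
  "(\<Sum>j\<in>{-int N<..<int N}. of_real (1 - \<bar>of_int j\<bar> / real N) * cis (of_int j * \<theta>)) = 
     of_real (fejer N \<theta>)" (is ?A)
  and fejer_eq: "fejer N \<theta> = (cmod (\<Sum>j<N. cis (real j * \<theta>)))\<^sup>2 / real N" (is ?B)
proof -
  let ?S = "(\<Sum>j\<in>{-int N<..<int N}. of_real (1 - \<bar>of_int j\<bar> / real N) * cis (of_int j * \<theta>))"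
  have "?S = (\<Sum>j\<in>{-int N<..<int N}. of_real (real N - \<bar>of_int j\<bar>) * cis (of_int j * \<theta>)) / of_nat N"
    by (cases "N = 0")
        (auto simp: sum_divide_distrib field_simps simp flip: sum_distrib_left intro!: sum.cong)
  also have "\<dots> = of_real ((cmod (\<Sum>j<N. cis (real j * \<theta>)))\<^sup>2 / real N)"
    unfolding fejer_identity by simp
  finally have *: "?S = of_real ((cmod (\<Sum>j<N. cis (real j * \<theta>)))\<^sup>2 / real N)" .
  have "fejer N \<theta> = Re ?S" by (simp add: fejer_def)
  then show ?B unfolding * Re_complex_of_real .
  then show ?A using * by simp
qed

lemma fejer_nonneg: "fejer N \<theta> \<ge> 0"
  by (simp add: fejer_eq)

text \<open>Geometric series: \<open>|1 - z|\<close> times the modulus of the sum is at most 2, and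
  \<open>|1 - z| = 2 * |sin (\<theta> / 2)|\<close>. The product form stays meaningful at the zeros
  of the sine.\<close>

lemma fejer_sin_bound: "fejer N \<theta> * (sin (\<theta> / 2))\<^sup>2 \<le> 1 / real N"
proof (cases "N = 0")
  case False
  define z where "z = cis \<theta>"
  have "(1 - z) * (\<Sum>j<N. cis (real j * \<theta>)) = 1 - z ^ N"
    using one_diff_power_eq[of z N] by (simp add: z_def Complex.DeMoivre)
  then have "cmod (1 - z) * cmod (\<Sum>j<N. cis (real j * \<theta>)) = cmod (1 - z ^ N)"
    by (metis norm_mult)
  also have "\<dots> \<le> 2" using norm_triangle_ineq4[of 1 "z ^ N"] by (simp add: z_def norm_power)
  finally have "(cmod (1 - z) * cmod (\<Sum>j<N. cis (real j * \<theta>)))\<^sup>2 \<le> 2\<^sup>2"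
    by (intro power_mono) auto
  then have "(cmod (1 - z))\<^sup>2 * (cmod (\<Sum>j<N. cis (real j * \<theta>)))\<^sup>2 \<le> 4" by (simp add: power_mult_distrib)
  moreover have "(cmod (1 - z))\<^sup>2 = 4 * (sin (\<theta> / 2))\<^sup>2"
  proof -
    have "(cmod (1 - z))\<^sup>2 = (1 - cos \<theta>)\<^sup>2 + (sin \<theta>)\<^sup>2" by (simp add: z_def cmod_power2)
    also have "\<dots> = 2 - 2 * cos \<theta>" by (simp add: power2_diff algebra_simps)
    also have "cos \<theta> = 1 - 2 * (sin (\<theta> / 2))\<^sup>2" using cos_double_sin[of "\<theta> / 2"] by simp
    finally show ?thesis by simp
  qed
  ultimately show ?thesis using False by (simp add: fejer_eq field_simps)
qed (simp add: fejer_def)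

lemma two_abs_le_sin_pi:
  assumes "\<bar>x\<bar> \<le> 1 / 2"
  shows "2 * \<bar>x\<bar> \<le> \<bar>sin (pi * x)\<bar>"
proof -
  have pos: "2 * y \<le> sin (pi * y)" if "0 \<le> y" "y \<le> 1 / 2" for y :: real
  proof -
    have "concave_on {0..pi} sin"
    proof (rule f''_le0_imp_concave)
      show "DERIV sin x :> cos x" for x :: real by (rule DERIV_sin)
      show "DERIV cos x :> - sin x" for x :: real by (rule DERIV_cos)
    qed (auto simp: sin_ge_zero)
    from concave_onD[OF this, of "2 * y" 0 "pi / 2"] that show ?thesis by (simp add: mult_ac)
  qed
  show ?thesis
  proof (cases "x \<ge> 0")
    case True
    then show ?thesis using pos[of x] assms by linarith
  next
    case False
    then show ?thesis using pos[of "-x"] assms by (simp add: abs_if)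
  qed
qed

text \<open>Jordan's inequality turns the sine bound into decay in x itself, the form of
  concentration used in \<open>fejer_tendsto\<close>.\<close>

lemma fejer_square_bound:
  assumes "\<bar>x\<bar> \<le> 1 / 2"
  shows "4 * x\<^sup>2 * fejer N (2 * pi * x) \<le> 1 / real N"
proof -
  have "4 * x\<^sup>2 = (2 * \<bar>x\<bar>)\<^sup>2" by (simp add: power_mult_distrib)
  also have "\<dots> \<le> \<bar>sin (pi * x)\<bar>\<^sup>2" using two_abs_le_sin_pi[OF assms] by (intro power_mono) auto
  finally have "4 * x\<^sup>2 * fejer N (2 * pi * x) \<le> (sin (pi * x))\<^sup>2 * fejer N (2 * pi * x)"
    using fejer_nonneg by (intro mult_right_mono) auto
  also have "\<dots> \<le> 1 / real N" using fejer_sin_bound[of N "2 * pi * x"] by (simp add: mult_ac)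
  finally show ?thesis .
qed

lemma fejer_periodic: "fejer N (2 * pi * (x + of_int n)) = fejer N (2 * pi * x)"
  unfolding fejer_def
proof (intro sum.cong refl)
  fix j
  have "cos (of_int j * (2 * pi * (x + of_int n)))
      = cos (of_int j * (2 * pi * x) + 2 * pi * of_int (j * n))"
    by (simp add: algebra_simps)
  also have "\<dots> = cos (of_int j * (2 * pi * x))"
    by (simp add: cos_add del: of_int_mult)
  finally show "(1 - \<bar>of_int j\<bar> / real N) * cos (of_int j * (2 * pi * (x + of_int n))) =
    (1 - \<bar>of_int j\<bar> / real N) * cos (of_int j * (2 * pi * x))" by simp
qed

lemma fejer_continuous [continuous_intros]:
  fixes f :: "'a :: t2_space \<Rightarrow> real"
  shows "continuous_on A f \<Longrightarrow> continuous_on A (\<lambda>x. fejer N (f x))"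
  unfolding fejer_def by (auto intro!: continuous_intros)

lemma fejer_measurable [measurable]: "fejer N \<in> borel_measurable borel"
  by (intro borel_measurable_continuous_onI continuous_intros)

lemma fejer_integral:
  assumes "N > 0"
  shows "((\<lambda>x. fejer N (2 * pi * x)) has_integral 1) {-1/2..1/2}"
proof -
  have cos_int: "((\<lambda>x. cos (of_int j * (2 * pi * x)))
      has_integral (if j = 0 then 1 else 0)) {-1/2..1/2}" for j :: int
  proof (cases "j = 0")
    case True
    then show ?thesis using has_integral_const_real[of "1::real" "-1/2" "1/2"] by simp
  next
    case False
    have "((\<lambda>x. cos (of_int j * (2 * pi * x))) has_integral
       (sin (of_int j * (2 * pi * (1/2))) / (of_int j * 2 * pi) - sin (of_int j * (2 * pi * (-1/2))) /
           (of_int j * 2 * pi))) {-1/2..1/2}"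
      using False
      by (intro fundamental_theorem_of_calculus)
         (auto intro!: derivative_eq_intros simp flip: has_real_derivative_iff_has_vector_derivative)
    moreover have "sin (of_int j * pi) = 0" by (metis mult.commute sin_npi_int)
    ultimately show ?thesis using False by simp
  qed
  have "((\<lambda>x. fejer N (2 * pi * x)) has_integral
      (\<Sum>j\<in>{-int N<..<int N}. (1 - \<bar>of_int j\<bar> / real N) * (if j = 0 then 1 else 0))) {-1/2..1/2}"
    unfolding fejer_def by (intro has_integral_sum has_integral_mult_right cos_int) auto
  moreover have "(\<Sum>j\<in>{-int N<..<int N}. (1 - \<bar>of_int j\<bar> / real N) * (if j = 0 then 1 else 0))
      = (1::real)"
    using assms by (simp add: sum.delta' if_distrib cong: if_cong)
  ultimately show ?thesis by metis
qed

lemma fejer_tendsto: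
  fixes g :: "real \<Rightarrow> real"
  assumes g: "continuous_on UNIV g" and B: "\<And>x. \<bar>g x\<bar> \<le> B"
  shows "(\<lambda>N. integral {-1/2..1/2} (\<lambda>x. g x * fejer N (2 * pi * x))) \<longlonglongrightarrow> g 0"
proof (rule LIMSEQ_I)
  fix e :: real assume e: "e > 0"
  from g have "isCont g 0" by (simp add: continuous_on_eq_continuous_at)
  then obtain d where d: "d > 0" and dd: "\<And>x. \<bar>x\<bar> < d \<Longrightarrow> \<bar>g x - g 0\<bar> < e / 2"
    using e unfolding continuous_at_eps_delta dist_real_def by (metis diff_zero half_gt_zero)
  have B0: "B \<ge> 0" using B[of 0] by linarith
  \<comment> \<open>With this C the quadratic \<open>C * x^2\<close> reaches \<open>2 * B\<close>
    once \<open>|x| \<ge> d\<close>, so the oscillation of g has the single majorant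
    \<open>e / 2 + C * x^2\<close>. Its quadratic part costs at most \<open>C / 4 / N\<close> by
    \<open>fejer_square_bound\<close>.\<close>
  define C where "C = 2 * B / d\<^sup>2"
  have C0: "C \<ge> 0" using B0 by (simp add: C_def)
  have bd: "\<bar>g x - g 0\<bar> \<le> e / 2 + C * x\<^sup>2" for x
  proof (cases "\<bar>x\<bar> < d")
    case True
    then show ?thesis using dd[OF True] C0 by (smt (verit) mult_nonneg_nonneg zero_le_power2)
  next
    case False
    then have "d\<^sup>2 \<le> x\<^sup>2" using d
      by (metis abs_of_pos linorder_not_less power2_abs power_mono less_imp_le)
    then have "2 * B \<le> C * x\<^sup>2" unfolding C_def using d B0
      by (metis (no_types, opaque_lifting) divide_self_if less_irrefl mult.right_neutral mult_left_mono
          power_not_zero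
          times_divide_eq_left times_divide_eq_right divide_right_mono zero_le_power2
              mult_nonneg_nonneg zero_le_numeral)
    then show ?thesis using B[of x] B[of 0] e by linarith
  qed
  obtain N0 where N0: "N0 > 0" "C / 4 / real N0 < e / 2"
  proof -
    obtain n :: nat where "C / 4 / (e / 2) < real n" using reals_Archimedean2 by blast
    then have "C / 4 < (e / 2) * real (Suc n)" using e by (simp add: field_simps)
    then have "C / 4 / real (Suc n) < e / 2" by (simp add: field_simps)
    then show ?thesis using that[of "Suc n"] by blast
  qed
  show "\<exists>no. \<forall>N\<ge>no. norm (integral {-1/2..1/2} (\<lambda>x. g x * fejer N (2 * pi * x)) - g 0) < e"
  proof (intro exI allI impI)
    fix N assume N: "N \<ge> N0"
    let ?I = "{-1/2..1/2} :: real set"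
    have Npos: "N > 0" using N N0 by simp
    note F1 = fejer_integral[OF Npos]
    have int1: "(\<lambda>x. g x * fejer N (2 * pi * x)) integrable_on ?I"
      by (intro integrable_continuous_real continuous_intros continuous_on_subset[OF g]) auto
    have "((\<lambda>x. g x * fejer N (2 * pi * x) - g 0 * fejer N (2 * pi * x)) has_integral
        (integral ?I (\<lambda>x. g x * fejer N (2 * pi * x)) - g 0 * 1)) ?I"
      by (intro has_integral_diff has_integral_mult_right F1 integrable_integral int1)
    moreover have "((\<lambda>x. e / 2 * fejer N (2 * pi * x) + C / 4 / real N)
        has_integral (e / 2 * 1 + C / 4 / real N)) ?I"
      using has_integral_const_real[of "C / 4 / real N" "-1/2" "1/2"]
      by (intro has_integral_add has_integral_mult_right F1) simp_all
    moreover have "\<bar>g x * fejer N (2 * pi * x) - g 0 * fejer N (2 * pi * x)\<bar>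
        \<le> e / 2 * fejer N (2 * pi * x) + C / 4 / real N"
      if x: "x \<in> ?I" for x
    proof -
      have "\<bar>g x * fejer N (2 * pi * x) - g 0 * fejer N (2 * pi * x)\<bar>
          = \<bar>g x - g 0\<bar> * fejer N (2 * pi * x)"
        by (simp add: fejer_nonneg abs_mult flip: left_diff_distrib)
      also have "\<dots> \<le> (e / 2 + C * x\<^sup>2) * fejer N (2 * pi * x)"
        using bd fejer_nonneg by (intro mult_right_mono)
      also have "\<dots> = e / 2 * fejer N (2 * pi * x) + C / 4 * (4 * x\<^sup>2 * fejer N (2 * pi * x))"
        by (simp add: algebra_simps)
      also have "C / 4 * (4 * x\<^sup>2 * fejer N (2 * pi * x)) \<le> C / 4 * (1 / real N)"
        using x C0 by (intro mult_left_mono fejer_square_bound) auto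
      finally show ?thesis by simp
    qed
    ultimately have "norm (integral ?I (\<lambda>x. g x * fejer N (2 * pi * x)) - g 0 * 1)
        \<le> e / 2 * 1 + C / 4 / real N"
      using integral_norm_bound_integral[of _ ?I]
        by (metis (no_types, lifting) has_integral_iff real_norm_def)
    also have "C / 4 / real N \<le> C / 4 / real N0" using N N0 C0 by (intro divide_left_mono) auto
    finally show "norm (integral ?I (\<lambda>x. g x * fejer N (2 * pi * x)) - g 0) < e" using N0 by simp
  qed
qed

section \<open>Poisson summation for nonnegative functions\<close>

lemma nn_integral_unit_pieces:
  fixes f :: "real \<Rightarrow> ennreal"
  assumes [measurable]: "f \<in> borel_measurable borel"
  shows "(\<integral>\<^sup>+x. f x \<partial>lborel) =
     (\<integral>\<^sup>+n. (\<integral>\<^sup>+x. f (x + of_int n) * indicator {-1/2..<1/2} x \<partial>lborel) \<partial>count_space UNIV)"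
proof -
  have *: "(\<integral>\<^sup>+n. f x * indicator {-1/2..<1/2} (x - real_of_int n) \<partial>count_space UNIV) = f x" for x
  proof -
    have eq: "indicator {-1/2..<1/2} (x - real_of_int n) = (indicator {\<lfloor>x + 1/2\<rfloor>} n :: ennreal)" for n
    proof -
      have "x - real_of_int n \<in> {-1/2..<1/2} \<longleftrightarrow> n = \<lfloor>x + 1/2\<rfloor>"
        by (subst eq_commute, subst floor_eq_iff) (auto simp: field_simps)
      then show ?thesis by (auto simp: indicator_def)
    qed
    show ?thesis unfolding eq by (simp add: nn_integral_cmult)
  qed
  have "(\<integral>\<^sup>+x. f x \<partial>lborel) =
     (\<integral>\<^sup>+x. (\<integral>\<^sup>+n. f x * indicator {-1/2..<1/2} (x - real_of_int n) \<partial>count_space UNIV) \<partial>lborel)"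
    unfolding * ..
  also have "\<dots>
      = (\<integral>\<^sup>+n. (\<integral>\<^sup>+x. f x * indicator {-1/2..<1/2} (x - real_of_int n) \<partial>lborel) \<partial>count_space UNIV)"
    by (rule nn_integral_count_space_nn_integral) auto
  also have "\<dots> = (\<integral>\<^sup>+n. (\<integral>\<^sup>+x. f (x + of_int n) * indicator {-1/2..<1/2} x \<partial>lborel) \<partial>count_space UNIV)"
  proof (rule nn_integral_cong)
    fix n :: int
    show "(\<integral>\<^sup>+x. f x * indicator {-1/2..<1/2} (x - real_of_int n) \<partial>lborel) =
       (\<integral>\<^sup>+x. f (x + of_int n) * indicator {-1/2..<1/2} x \<partial>lborel)"
      by (subst nn_integral_real_affine[where c = 1 and t = "of_int n"]) (auto simp: add.commute)
  qed
  finally show ?thesis .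
qed

text \<open>The integral of g against the Fejer kernel over the line is evaluated twice. Termwise it
  is a Cesaro mean of the transforms, increasing in N because \<open>a k \<ge> 0\<close>. Cut into
  unit cells, it concentrates at the integers by periodicity of the kernel, with w as dominating
  series. Integrals over counting measure let monotone and dominated convergence act directly on the
  series.\<close>

lemma poisson_summation_nonneg:
  fixes g h :: "real \<Rightarrow> real" and w :: "int \<Rightarrow> real"
  assumes cont: "continuous_on UNIV g" and nonneg: "\<And>x. g x \<ge> 0" and bnd: "\<And>x. g x \<le> B"
    and dom: "\<And>n x. \<bar>x\<bar> \<le> 1/2 \<Longrightarrow> g (x + of_int n) \<le> w n"
    and w: "(\<integral>\<^sup>+n. ennreal (w n) \<partial>count_space UNIV) < \<infinity>"
    and ft: "\<And>k::int. has_bochner_integral lborel (\<lambda>x. g x * cos (of_int k * (2 * pi * x))) (a k)"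
    and a: "\<And>k. a k \<ge> 0"
  shows "(\<integral>\<^sup>+n. ennreal (g (of_int n)) \<partial>count_space UNIV) = (\<integral>\<^sup>+k. ennreal (a k) \<partial>count_space UNIV)"
proof -
  have gm [measurable]: "g \<in> borel_measurable borel"
    using cont borel_measurable_continuous_onI by blast
  define A where "A N = (\<integral>\<^sup>+x. ennreal (g x * fejer N (2 * pi * x)) \<partial>lborel)" for N
  have nn: "g x * fejer N y \<ge> 0" for x N y using nonneg fejer_nonneg by simp
  \<comment> \<open>\<open>max 0\<close> extends the finite Fejer sum to all integers with weights
    that are monotone in N.\<close>
  have A1: "A N = (\<integral>\<^sup>+k. ennreal (max 0 (1 - \<bar>of_int k\<bar> / real N) * a k) \<partial>count_space UNIV)"
      if N: "N > 0" for N
  proof -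
    let ?S = "{-int N<..<int N}"
    have "has_bochner_integral lborel (\<lambda>x. \<Sum>j\<in>?S. (1 - \<bar>of_int j\<bar> / real N)
        * (g x * cos (of_int j * (2 * pi * x))))
            (\<Sum>j\<in>?S. (1 - \<bar>of_int j\<bar> / real N) * a j)"
      by (intro has_bochner_integral_sum has_bochner_integral_mult_right ft)
    moreover have "(\<lambda>x. \<Sum>j\<in>?S. (1 - \<bar>of_int j\<bar> / real N) * (g x * cos (of_int j * (2 * pi * x)))) = 
       (\<lambda>x. g x * fejer N (2 * pi * x))"
      by (simp add: fejer_def sum_distrib_left mult_ac)
    ultimately have "has_bochner_integral lborel (\<lambda>x. g x * fejer N (2 * pi * x)) (\<Sum>j\<in>?S.
        (1 - \<bar>of_int j\<bar> / real N) * a j)"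
      by simp
    then have "A N = ennreal (\<Sum>j\<in>?S. (1 - \<bar>of_int j\<bar> / real N) * a j)"
      unfolding A_def using nn by (intro nn_integral_eq_integral[THEN trans])
        (auto simp: has_bochner_integral_iff)
    also have "\<dots> = ennreal (\<Sum>j\<in>?S. max 0 (1 - \<bar>of_int j\<bar> / real N) * a j)"
      using N by (intro arg_cong[of _ _ ennreal] sum.cong) (auto simp: field_simps)
    also have "\<dots> = (\<Sum>j\<in>?S. ennreal (max 0 (1 - \<bar>of_int j\<bar> / real N) * a j))"
      using a by (intro sum_ennreal[symmetric]) auto
    also have "\<dots> = (\<integral>\<^sup>+k. ennreal (max 0 (1 - \<bar>of_int k\<bar> / real N) * a k) \<partial>count_space UNIV)"
    proof (rule nn_integral_count_space'[symmetric])
      fix k :: int assume "k \<notin> ?S"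
      then have "\<bar>k\<bar> \<ge> int N" by auto
      then have "real N \<le> \<bar>of_int k\<bar>" by linarith
      then have "max 0 (1 - \<bar>of_int k\<bar> / real N) = 0" using N by (auto simp: max_def field_simps)
      then show "ennreal (max 0 (1 - \<bar>of_int k\<bar> / real N) * a k) = 0" by simp
    qed auto
    finally show ?thesis .
  qed
  have "(\<lambda>N. \<integral>\<^sup>+k. ennreal (max 0 (1 - \<bar>of_int k\<bar> / real (Suc N)) * a k) \<partial>count_space UNIV)
     \<longlonglongrightarrow> (\<integral>\<^sup>+k. ennreal (a k) \<partial>count_space UNIV)"
  proof (rule nn_integral_LIMSEQ)
    show "incseq (\<lambda>N k. ennreal (max 0 (1 - \<bar>real_of_int k\<bar> / real (Suc N)) * a k))"
      using a by
          (intro incseq_SucI le_funI ennreal_leI mult_right_mono max.mono diff_left_mono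
          divide_left_mono) auto
    fix k
    have "(\<lambda>N. 1 - \<bar>real_of_int k\<bar> / real (Suc N)) \<longlonglongrightarrow> 1 - 0"
      by (intro tendsto_intros LIMSEQ_Suc[OF lim_const_over_n])
    then have "(\<lambda>N. max 0 (1 - \<bar>real_of_int k\<bar> / real (Suc N)) * a k) \<longlonglongrightarrow> max 0 (1 - 0) * a k"
      by (rule tendsto_mult[OF tendsto_max[OF tendsto_const] tendsto_const])
    then show "(\<lambda>N. ennreal (max 0 (1 - \<bar>real_of_int k\<bar> / real (Suc N)) * a k)) \<longlonglongrightarrow> ennreal (a k)"
      by (intro tendsto_ennrealI) simp
  qed auto
  then have lim1: "(\<lambda>N. A (Suc N)) \<longlonglongrightarrow> (\<integral>\<^sup>+k. ennreal (a k) \<partial>count_space UNIV)"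
    by (simp add: A1)
  define I where "I N n = integral {-1/2..1/2} (\<lambda>x. g (x + of_int n) * fejer N (2 * pi * x))" for N
      and n :: int
  have contn: "continuous_on S (\<lambda>x. g (x + of_int n) * fejer N (2 * pi * x))" for S N and n :: int
    by (intro continuous_intros continuous_on_compose2[OF cont]) auto
  have I: "((\<lambda>x. g (x + of_int n) * fejer N (2 * pi * x)) has_integral I N n) {-1/2..1/2}" for N n
    unfolding I_def by (intro integrable_integral integrable_continuous_real contn)
  have piece: "(\<integral>\<^sup>+x. ennreal (g (x + of_int n) * fejer N (2 * pi * (x + of_int n)))
      * indicator {-1/2..<1/2} x \<partial>lborel)
      = ennreal (I N n)" for N and n :: int
  proof -
    have "(\<integral>\<^sup>+x. ennreal (g (x + of_int n) * fejer N (2 * pi * (x + of_int n)))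
        * indicator {-1/2..<1/2} x \<partial>lborel)
        = (\<integral>\<^sup>+x. ennreal (g (x + of_int n) * fejer N (2 * pi * x)) * indicator {-1/2..<1/2} x \<partial>lborel)"
      unfolding fejer_periodic ..
    also have "\<dots>
        = (\<integral>\<^sup>+x. ennreal (g (x + of_int n) * fejer N (2 * pi * x)) * indicator {-1/2..1/2} x \<partial>lborel)"
    proof (rule nn_integral_cong_AE)
      show "AE x in lborel. ennreal (g (x + real_of_int n) * fejer N (2 * pi * x))
          * indicator {- 1 / 2..<1 / 2} x =
               ennreal (g (x + real_of_int n) * fejer N (2 * pi * x)) * indicator {- 1 / 2..1 / 2} x"
        using AE_lborel_singleton[of "1/2::real"] by eventually_elim (auto simp: indicator_def)
    qed
    also have "\<dots> = ennreal (I N n)"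
      by (rule nn_integral_has_integral_lebesgue'[OF nn I])
    finally show ?thesis .
  qed
  have A2: "A N = (\<integral>\<^sup>+n. ennreal (I N n) \<partial>count_space UNIV)" for N
    unfolding A_def by (subst nn_integral_unit_pieces) (simp_all only: piece, measurable)
  have "(\<lambda>N. \<integral>\<^sup>+n. ennreal (I (Suc N) n) \<partial>count_space UNIV) \<longlonglongrightarrow> (\<integral>\<^sup>+n.
      ennreal (g (of_int n)) \<partial>count_space UNIV)"
  proof (rule nn_integral_dominated_convergence[where w = "\<lambda>n. ennreal (w n)"])
    show "AE n in count_space UNIV. ennreal (I (Suc N) n) \<le> ennreal (w n)" for N
    proof (intro AE_I2 ennreal_leI)
      fix n :: int
      have "I (Suc N) n \<le> w n * 1"
      proof (rule has_integral_le[OF I])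
        show "((\<lambda>x. w n * fejer (Suc N) (2 * pi * x)) has_integral w n * 1) {-1/2..1/2}"
          by (intro has_integral_mult_right fejer_integral) auto
        fix x :: real assume "x \<in> {-1/2..1/2}"
        then have "\<bar>x\<bar> \<le> 1/2" by auto
        then show "g (x + of_int n) * fejer (Suc N) (2 * pi * x) \<le> w n * fejer (Suc N) (2 * pi * x)"
          using dom fejer_nonneg by (intro mult_right_mono) auto
      qed
      then show "I (Suc N) n \<le> w n" by simp
    qed
    show "AE n in count_space UNIV. (\<lambda>N. ennreal (I (Suc N) n)) \<longlonglongrightarrow> ennreal (g (of_int n))"
    proof (intro AE_I2 tendsto_ennrealI)
      fix n :: int
      have "(\<lambda>N. I N n) \<longlonglongrightarrow> g (0 + of_int n)" unfolding I_def
        by (rule fejer_tendsto[where B = B])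
           (use bnd nonneg in \<open>auto intro!: continuous_intros continuous_on_compose2[OF cont]\<close>)
      from LIMSEQ_Suc[OF this] show "(\<lambda>N. I (Suc N) n) \<longlonglongrightarrow> g (of_int n)" by simp
    qed
  qed (use w in auto)
  then have "(\<lambda>N. A (Suc N)) \<longlonglongrightarrow> (\<integral>\<^sup>+n. ennreal (g (of_int n)) \<partial>count_space UNIV)"
    by (simp add: A2)
  with lim1 show ?thesis using LIMSEQ_unique by blast
qed

section \<open>Gaussian sums and theta inversion in one variable\<close>

lemma nn_integral_int_exp_finite:
  assumes "c > 0"
  shows "(\<integral>\<^sup>+n. ennreal (exp (- c * (of_int n)\<^sup>2)) \<partial>count_space (UNIV :: int set)) < \<infinity>"
proof -
  define f where "f n = ennreal (exp (- c * real n))" for n :: nat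
  have fin: "(\<integral>\<^sup>+n. f n \<partial>count_space UNIV) < \<infinity>"
  proof -
    have eq: "exp (- c * real n) = exp (- c) ^ n" for n using exp_of_nat_mult[of n "- c"]
      by (simp add: mult.commute)
    have "summable (\<lambda>n. exp (- c * real n))" unfolding eq using assms by (intro summable_geometric) auto
    then show ?thesis unfolding f_def nn_integral_count_space_nat
      by (subst suminf_ennreal2) auto
  qed
  have "(\<integral>\<^sup>+n. ennreal (exp (- c * (of_int n)\<^sup>2)) \<partial>count_space (UNIV :: int set))
     \<le> (\<integral>\<^sup>+n. (\<integral>\<^sup>+k. f k * (indicator {int k} n + indicator {- int k} n) \<partial>count_space UNIV)
         \<partial>count_space UNIV)"
  proof (rule nn_integral_mono)
    fix n :: int
    \<comment> \<open>Since \<open>n^2 \<ge> |n|\<close>, the integer n is charged to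
      \<open>k = |n|\<close>; each k is charged only by k and -k, and a geometric series
      remains.\<close>
    define k where "k = nat \<bar>n\<bar>"
    have "real k \<le> (of_int n)\<^sup>2"
    proof -
      have "real k \<le> (real k)\<^sup>2" by (cases "k = 0") (auto simp: power2_eq_square)
      also have "\<dots> = (of_int n)\<^sup>2" by (simp add: k_def)
      finally show ?thesis .
    qed
    then have "ennreal (exp (- c * (of_int n)\<^sup>2)) \<le> f k"
      unfolding f_def using assms by (intro ennreal_leI) simp
    also have "f k \<le> f k * (indicator {int k} n + indicator {- int k} n)"
      by (cases "n \<ge> 0") (auto simp: k_def distrib_left add_increasing2)
    also have "\<dots>
        = (\<integral>\<^sup>+j. (f k * (indicator {int k} n + indicator {- int k} n)) * indicator {k} j \<partial>count_space
        UNIV)"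
      by (simp add: nn_integral_cmult)
    also have "\<dots> \<le> (\<integral>\<^sup>+k. f k * (indicator {int k} n + indicator {- int k} n) \<partial>count_space UNIV)"
      by (rule nn_integral_mono) (auto simp: indicator_def)
    finally show "ennreal (exp (- c * (of_int n)\<^sup>2)) \<le> \<dots>" .
  qed
  also have "\<dots>
      = (\<integral>\<^sup>+k. (\<integral>\<^sup>+n. f k * (indicator {int k} n + indicator {- int k} n) \<partial>count_space UNIV)
      \<partial>count_space UNIV)"
    by (rule nn_integral_count_space_nn_integral) auto
  also have "\<dots> = (\<integral>\<^sup>+k. f k * 2 \<partial>count_space UNIV)"
    by (simp add: nn_integral_cmult nn_integral_add)
  also have "\<dots> < \<infinity>" using fin by (simp add: nn_integral_multc ennreal_mult_less_top)
  finally show ?thesis .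
qed

text \<open>A rescaled characteristic function of the standard normal law: its real part is the
  cosine transform, and \<open>c = sqrt 2 / w\<close> turns \<open>(c * x)^2 / 2\<close> into
  \<open>x^2 / w^2\<close>.\<close>

lemma gaussian_cos_transform:
  assumes w: "w > 0"
  shows "has_bochner_integral lborel (\<lambda>x. exp (- x\<^sup>2 / w\<^sup>2) * cos (t * x)) (sqrt pi * w
      * exp (- t\<^sup>2 * w\<^sup>2 / 4))"
proof -
  have "char std_normal_distribution u = of_real (exp (- (u\<^sup>2) / 2))" for u
    using char_std_normal_distribution by metis
  then have 1: "(LINT x|std_normal_distribution. iexp (u * x)) = of_real (exp (- (u\<^sup>2) / 2))" for u
    by (simp add: char_def)
  have int: "integrable std_normal_distribution (\<lambda>x. iexp (u * x))" for u
  proof -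
    interpret prob_space std_normal_distribution by (rule prob_space_normal_density) simp
    show ?thesis by (rule integrable_const_bound[where B = 1]) auto
  qed
  have "has_bochner_integral std_normal_distribution (\<lambda>x. Re (iexp (u * x)))
      (Re (of_real (exp (- (u\<^sup>2) / 2))))" for u
    using 1 int by (intro has_bochner_integral_Re) (simp add: has_bochner_integral_iff)
  then have "has_bochner_integral std_normal_distribution (\<lambda>x. cos (u * x)) (exp (- (u\<^sup>2) / 2))" for u
    by (simp add: Re_exp)
  then have 2: "has_bochner_integral lborel (\<lambda>x. std_normal_density x *\<^sub>R cos (u * x))
      (exp (- (u\<^sup>2) / 2))" for u
    by (simp add: has_bochner_integral_iff integrable_density integral_density)
  define c where "c = sqrt 2 / w"
  have c: "c > 0" "c\<^sup>2 = 2 / w\<^sup>2" using w by (simp_all add: c_def power_divide)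
  have "has_bochner_integral lborel (\<lambda>x. std_normal_density (0 + c * x) *\<^sub>R cos (t / c * (0 + c * x)))
      (exp (- ((t / c)\<^sup>2) / 2) /\<^sub>R \<bar>c\<bar>)"
    using 2[of "t / c"] c
      by (subst lborel_has_bochner_integral_real_affine_iff[of c _ _ 0, symmetric]) auto
  then have
      "has_bochner_integral lborel (\<lambda>x. sqrt (2 * pi)
      * (std_normal_density (0 + c * x) *\<^sub>R cos (t / c * (0 + c * x))))
     (sqrt (2 * pi) * (exp (- ((t / c)\<^sup>2) / 2) /\<^sub>R \<bar>c\<bar>))"
    by (intro has_bochner_integral_mult_right)
  moreover have "sqrt (2 * pi) * (std_normal_density (0 + c * x) *\<^sub>R cos (t / c * (0 + c * x)))
      = exp (- x\<^sup>2 / w\<^sup>2) * cos (t * x)" for x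
    using c w by (simp add: std_normal_density_def power_mult_distrib)
  moreover have "sqrt (2 * pi) * (exp (- ((t / c)\<^sup>2) / 2) /\<^sub>R \<bar>c\<bar>)
      = sqrt pi * w * exp (- t\<^sup>2 * w\<^sup>2 / 4)"
    using c w by (simp add: power_divide c_def real_sqrt_mult field_simps)
  ultimately show ?thesis by simp
qed

lemma theta_functional_equation:
  assumes w: "w > 0"
  shows "(\<integral>\<^sup>+n. ennreal (exp (- (of_int n)\<^sup>2 / w\<^sup>2)) \<partial>count_space (UNIV :: int set)) =
         (\<integral>\<^sup>+k. ennreal (sqrt pi * w * exp (- pi\<^sup>2 * w\<^sup>2 * (of_int k)\<^sup>2)) \<partial>count_space
             (UNIV :: int set))"
proof (rule poisson_summation_nonneg[where B = 1 and g = "\<lambda>x. exp (- x\<^sup>2 / w\<^sup>2)" and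
       w = "\<lambda>n. exp (1 / (4 * w\<^sup>2)) * exp (- (1 / (2 * w\<^sup>2)) * (of_int n)\<^sup>2)"])
  show "continuous_on UNIV (\<lambda>x. exp (- x\<^sup>2 / w\<^sup>2))" using w by (auto intro!: continuous_intros)
  show "exp (- (x + of_int n)\<^sup>2 / w\<^sup>2) \<le> exp (1 / (4 * w\<^sup>2)) * exp (- (1 / (2 * w\<^sup>2)) * (of_int n)\<^sup>2)"
    if "\<bar>x\<bar> \<le> 1 / 2" for x and n :: int
  proof -
    have "x\<^sup>2 \<le> (1/2)\<^sup>2" using that by (metis abs_ge_zero power2_abs power_mono)
    \<comment> \<open>Half of this square together with \<open>x^2 \<le> 1/4\<close> gives
      \<open>(x + n)^2 \<ge> n^2 / 2 - 1/4\<close>, so every cell is dominated by a wider Gaussian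
      in n.\<close>
    moreover have "0 \<le> (2 * x + of_int n)\<^sup>2" by simp
    ultimately have "(of_int n)\<^sup>2 / 2 - 1/4 \<le> (x + of_int n)\<^sup>2"
      by (simp add: power2_eq_square algebra_simps)
    then have "- (x + of_int n)\<^sup>2 / w\<^sup>2 \<le> (1/4 - (of_int n)\<^sup>2 / 2) / w\<^sup>2"
      using w by (intro divide_right_mono) auto
    also have "\<dots> = 1 / (4 * w\<^sup>2) + (- (1 / (2 * w\<^sup>2)) * (of_int n)\<^sup>2)"
      using w by (simp add: field_simps)
    finally show ?thesis by (simp flip: exp_add)
  qed
  have "(\<integral>\<^sup>+n. ennreal (exp (- (1 / (2 * w\<^sup>2)) * (of_int n)\<^sup>2)) \<partial>count_space (UNIV :: int set)) < \<infinity>"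
    by (rule nn_integral_int_exp_finite) (use w in auto)
  then show
      "(\<integral>\<^sup>+n. ennreal (exp (1 / (4 * w\<^sup>2)) * exp (- (1 / (2 * w\<^sup>2)) * (of_int n)\<^sup>2)) \<partial>count_space
      (UNIV :: int set)) < \<infinity>"
    by (simp add: ennreal_mult nn_integral_cmult ennreal_mult_less_top)
  show "has_bochner_integral lborel (\<lambda>x. exp (- x\<^sup>2 / w\<^sup>2) * cos (of_int k * (2 * pi * x)))
     (sqrt pi * w * exp (- pi\<^sup>2 * w\<^sup>2 * (of_int k)\<^sup>2))" for k :: int
    using gaussian_cos_transform[OF w, of "of_int k * 2 * pi"] by (simp add: power_mult_distrib mult_ac)
qed (use w in auto)

subsection \<open>The two-dimensional theta function\<close>

definition nsq :: "int \<times> int \<Rightarrow> real" where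
  "nsq z = (of_int (fst z))\<^sup>2 + (of_int (snd z))\<^sup>2"

lemma nsq_nonneg [simp]: "nsq z \<ge> 0"
  by (simp add: nsq_def)

lemma theta_functional_equation_2d:
  assumes w: "w > 0"
  shows "(\<integral>\<^sup>+z. ennreal (exp (- nsq z / w\<^sup>2)) \<partial>count_space UNIV) =
         (\<integral>\<^sup>+\<xi>. ennreal (pi * w\<^sup>2 * exp (- pi\<^sup>2 * w\<^sup>2 * nsq \<xi>)) \<partial>count_space UNIV)"
proof -
  have sep: "(\<integral>\<^sup>+z. ennreal (f (fst z)) * ennreal (f (snd z)) \<partial>count_space UNIV) =
     (\<integral>\<^sup>+n. ennreal (f n) \<partial>count_space UNIV) * (\<integral>\<^sup>+n. ennreal (f n) \<partial>count_space UNIV)"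
    for f :: "int \<Rightarrow> real"
    by (subst nn_integral_fst_count_space[symmetric]) (simp add: nn_integral_cmult nn_integral_multc)
  have "(\<integral>\<^sup>+z. ennreal (exp (- nsq z / w\<^sup>2)) \<partial>count_space UNIV) =
      (\<integral>\<^sup>+z. ennreal (exp (- (of_int (fst z))\<^sup>2 / w\<^sup>2)) * ennreal
          (exp (- (of_int (snd z))\<^sup>2 / w\<^sup>2)) \<partial>count_space UNIV)"
    by (intro nn_integral_cong)
        (simp add: nsq_def add_divide_distrib diff_divide_distrib flip: ennreal_mult exp_add)
  also have "\<dots> = (\<integral>\<^sup>+z. ennreal (sqrt pi * w * exp (- pi\<^sup>2 * w\<^sup>2 * (of_int (fst z))\<^sup>2)) *
       ennreal (sqrt pi * w * exp (- pi\<^sup>2 * w\<^sup>2 * (of_int (snd z))\<^sup>2)) \<partial>count_space UNIV)"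
    unfolding sep[of "\<lambda>n. exp (- (of_int n)\<^sup>2 / w\<^sup>2)"]
      sep[of "\<lambda>n. sqrt pi * w * exp (- pi\<^sup>2 * w\<^sup>2 * (of_int n)\<^sup>2)"] theta_functional_equation[OF w] ..
  also have "\<dots> = (\<integral>\<^sup>+\<xi>. ennreal (pi * w\<^sup>2 * exp (- pi\<^sup>2 * w\<^sup>2 * nsq \<xi>)) \<partial>count_space UNIV)"
  proof (intro nn_integral_cong)
    fix z :: "int \<times> int"
    have "exp (- pi\<^sup>2 * w\<^sup>2 * nsq z)
        = exp (- pi\<^sup>2 * w\<^sup>2 * (of_int (fst z))\<^sup>2) * exp (- pi\<^sup>2 * w\<^sup>2 * (of_int (snd z))\<^sup>2)"
      by (simp add: nsq_def algebra_simps flip: exp_add)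
    moreover have "pi = sqrt pi * sqrt pi" by simp
    ultimately have "sqrt pi * w * exp (- pi\<^sup>2 * w\<^sup>2 * (of_int (fst z))\<^sup>2)
        * (sqrt pi * w * exp (- pi\<^sup>2 * w\<^sup>2 * (of_int (snd z))\<^sup>2))
       = pi * w\<^sup>2 * exp (- pi\<^sup>2 * w\<^sup>2 * nsq z)" by (simp add: power2_eq_square)
    then show "ennreal (sqrt pi * w * exp (- pi\<^sup>2 * w\<^sup>2 * (of_int (fst z))\<^sup>2)) *
       ennreal (sqrt pi * w * exp (- pi\<^sup>2 * w\<^sup>2 * (of_int (snd z))\<^sup>2)) = ennreal
           (pi * w\<^sup>2 * exp (- pi\<^sup>2 * w\<^sup>2 * nsq z))"
      using w by (simp flip: ennreal_mult)
  qed
  finally show ?thesis .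
qed

subsection \<open>Gaussian subordination of the exponential\<close>

text \<open>In terms of the error function this is \<open>sqrt pi / 2 * (1 + erf x)\<close>. The
  antiderivative in \<open>exp_subordination\<close> is built from it.\<close>

definition gauss_cdf :: "real \<Rightarrow> real" where
  "gauss_cdf x = (\<integral>y. indicator {..x} y *\<^sub>R exp (- y\<^sup>2) \<partial>lborel)"

lemma has_bochner_integral_gauss:
  "w > 0 \<Longrightarrow> has_bochner_integral lborel (\<lambda>y::real. exp (- y\<^sup>2 / w\<^sup>2)) (sqrt pi * w)"
  using gaussian_cos_transform[of w 0] by simp

lemma integrable_gauss: "integrable lborel (\<lambda>y::real. exp (- y\<^sup>2))"
  using has_bochner_integral_gauss[of 1] by (simp add: has_bochner_integral_iff)

lemma gauss_cdf_at_top: "(gauss_cdf \<longlongrightarrow> sqrt pi) at_top"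
proof -
  have "(\<integral>y. exp (- (y::real)\<^sup>2) \<partial>lborel) = sqrt pi"
    using has_bochner_integral_gauss[of 1] by (simp add: has_bochner_integral_iff)
  then show ?thesis
    using tendsto_integral_at_top[OF _ integrable_gauss] unfolding gauss_cdf_def[abs_def] by simp
qed

lemma gauss_cdf_reflect: "gauss_cdf x = sqrt pi - gauss_cdf (- x)"
proof -
  have "gauss_cdf (- x) = (\<integral>y. indicator {..-x} (0 + (-1) * y) *\<^sub>R exp (- (0 + (-1) * y)\<^sup>2) \<partial>lborel)"
    unfolding gauss_cdf_def by (subst lborel_integral_real_affine[where c = "-1" and t = 0]) auto
  also have "\<dots> = (\<integral>y. indicator {x..} y *\<^sub>R exp (- y\<^sup>2) \<partial>lborel)"
    by (intro Bochner_Integration.integral_cong refl) (auto simp: indicator_def)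
  also have "gauss_cdf x + \<dots>
      = (\<integral>y. indicator {..x} y *\<^sub>R exp (- y\<^sup>2) + indicator {x..} y *\<^sub>R exp (- y\<^sup>2) \<partial>lborel)"
    unfolding gauss_cdf_def
    by (intro Bochner_Integration.integral_add[symmetric] integrable_mult_indicator integrable_gauss)
        auto
  also have "\<dots> = (\<integral>y. exp (- (y::real)\<^sup>2) \<partial>lborel)"
  proof (rule integral_cong_AE)
    show "AE y in lborel. indicator {..x} y *\<^sub>R exp (- y\<^sup>2) + indicator {x..} y *\<^sub>R exp (- y\<^sup>2)
        = exp (- y\<^sup>2)"
      using AE_lborel_singleton[of x] by eventually_elim (auto simp: indicator_def)
  qed auto
  also have "\<dots> = sqrt pi"
    using has_bochner_integral_gauss[of 1] by (simp add: has_bochner_integral_iff)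
  finally show ?thesis by simp
qed

lemma gauss_cdf_at_bot: "(gauss_cdf \<longlongrightarrow> 0) at_bot"
proof -
  have "((\<lambda>x. sqrt pi - gauss_cdf (- x)) \<longlongrightarrow> sqrt pi - sqrt pi) at_bot"
    by (intro tendsto_intros filterlim_compose[OF gauss_cdf_at_top filterlim_uminus_at_top_at_bot])
  moreover have "(\<lambda>x. sqrt pi - gauss_cdf (- x)) = gauss_cdf"
    by (rule ext) (rule gauss_cdf_reflect[symmetric])
  ultimately show ?thesis by simp
qed

lemma gauss_cdf_deriv [derivative_intros]:
  assumes "(f has_real_derivative f') (at x)"
  shows "((\<lambda>x. gauss_cdf (f x)) has_real_derivative exp (- (f x)\<^sup>2) * f') (at x)"
proof -
  have "(gauss_cdf has_real_derivative exp (- u\<^sup>2)) (at u)" for u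
  proof -
    define a where "a = u - 1"
    define b where "b = u + 1"
    have eq: "gauss_cdf x = gauss_cdf a + integral {a..x} (\<lambda>y. exp (- y\<^sup>2))" if "x \<in> {a<..<b}" for x
    proof -
      have "(\<integral>y. indicator {a..x} y *\<^sub>R exp (- y\<^sup>2) \<partial>lborel) = integral {a..x} (\<lambda>y. exp (- y\<^sup>2))"
        using set_borel_integral_eq_integral(2)[of "{a..x}" "\<lambda>y. exp (- y\<^sup>2)"]
          integrable_mult_indicator[OF _ integrable_gauss, of "{a..x}"]
        by (simp add: set_lebesgue_integral_def set_integrable_def)
      moreover have "gauss_cdf x
          = (\<integral>y. indicator {..a} y *\<^sub>R exp (- y\<^sup>2) + indicator {a..x} y *\<^sub>R exp (- y\<^sup>2) \<partial>lborel)"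
        unfolding gauss_cdf_def
      proof (rule integral_cong_AE)
        show "AE y in lborel. indicator {..x} y *\<^sub>R exp (- y\<^sup>2) = indicator {..a} y *\<^sub>R exp (- y\<^sup>2)
            + indicator {a..x} y *\<^sub>R exp (- y\<^sup>2)"
          using AE_lborel_singleton[of a] by eventually_elim (use that in \<open>auto simp: indicator_def\<close>)
      qed auto
      ultimately show ?thesis unfolding gauss_cdf_def
        using integrable_mult_indicator[OF _ integrable_gauss, of
            "{..a}"] integrable_mult_indicator[OF _ integrable_gauss, of "{a..x}"]
        by (subst (asm) Bochner_Integration.integral_add) auto
    qed
    have "((\<lambda>x. integral {a..x} (\<lambda>y. exp (- y\<^sup>2)))
        has_real_derivative exp (- u\<^sup>2)) (at u within {a..b})"
      by (rule integral_has_real_derivative) (auto intro!: continuous_intros simp: a_def b_def)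
    then have "((\<lambda>x. integral {a..x} (\<lambda>y. exp (- y\<^sup>2))) has_real_derivative exp (- u\<^sup>2)) (at u)"
      by (subst (asm) at_within_interior) (auto simp: a_def b_def)
    then have "((\<lambda>x. gauss_cdf a + integral {a..x} (\<lambda>y. exp (- y\<^sup>2)))
        has_real_derivative 0 + exp (- u\<^sup>2)) (at u)"
      by (intro derivative_intros)
    then have "((\<lambda>x. gauss_cdf a + integral {a..x} (\<lambda>y. exp (- y\<^sup>2)))
        has_real_derivative exp (- u\<^sup>2)) (at u)" by simp
    then show ?thesis
      by (rule has_field_derivative_transform_within_open[of _ _ _ "{a<..<b}"])
          (use eq in \<open>auto simp: a_def b_def\<close>)
  qed
  from DERIV_chain2[OF this assms] show ?thesis .
qed

text \<open>Writes \<open>exp (- s * t)\<close> as a mixture of Gaussians in t, so that Gaussian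
  identities pass to Laplace transforms. Completing \<open>s^2 * w^2 / 4 + t^2 / w^2\<close> to the
  square of \<open>s * w / 2 + t / w\<close> or of \<open>s * w / 2 - t / w\<close> costs only a
  constant, which makes the integral explicit.\<close>

lemma exp_subordination:
  assumes s: "s > 0" and t: "t > 0"
  shows "(\<integral>\<^sup>+w. ennreal (s / sqrt pi * exp (- s\<^sup>2 * w\<^sup>2 / 4) * exp (- t\<^sup>2 / w\<^sup>2))
      * indicator {0<..} w \<partial>lborel) = ennreal (exp (- s * t))"
proof -
  define a where "a = s / 2"
  have a: "a > 0" using s by (simp add: a_def)
  define f where "f w = s / sqrt pi * exp (- s\<^sup>2 * w\<^sup>2 / 4) * exp (- t\<^sup>2 / w\<^sup>2)" for w
  \<comment> \<open>The inner derivatives are \<open>a - t / w^2\<close> and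
    \<open>a + t / w^2\<close>, and the exponential factors give both terms the same Gaussian, so
    \<open>2 * a = s\<close> remains. At 0 the second argument tends to minus infinity and the first
    to infinity; at infinity both tend to infinity. The limits differ by
    \<open>exp (- s * t)\<close>.\<close>
  define F where "F w
      = (exp (s * t) * gauss_cdf (a * w + t / w) + exp (- s * t) * gauss_cdf (a * w - t / w)) / sqrt
      pi" for w
  have dF: "(F has_real_derivative f w) (at w)" if w: "w > 0" for w
  proof -
    define x where "x = t / w"
    have wd: "w * x = t" using w by (simp add: x_def)
    have "(a * w + x)\<^sup>2 = s\<^sup>2 * w\<^sup>2 / 4 + s * (w * x) + x\<^sup>2"
      by (simp add: a_def power2_eq_square algebra_simps)
    then have "s * t + - (a * w + t / w)\<^sup>2 = - s\<^sup>2 * w\<^sup>2 / 4 + - (t / w)\<^sup>2"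
      unfolding wd unfolding x_def by simp
    then have e1: "exp (s * t) * exp (- (a * w + t / w)\<^sup>2) = exp (- s\<^sup>2 * w\<^sup>2 / 4) * exp (- t\<^sup>2 / w\<^sup>2)"
      unfolding exp_add[symmetric] by (simp add: power_divide)
    have "(a * w - x)\<^sup>2 = s\<^sup>2 * w\<^sup>2 / 4 - s * (w * x) + x\<^sup>2"
      by (simp add: a_def power2_eq_square algebra_simps)
    then have "- s * t + - (a * w - t / w)\<^sup>2 = - s\<^sup>2 * w\<^sup>2 / 4 + - (t / w)\<^sup>2"
      unfolding wd unfolding x_def by simp
    then have e2: "exp (- s * t) * exp (- (a * w - t / w)\<^sup>2)
        = exp (- s\<^sup>2 * w\<^sup>2 / 4) * exp (- t\<^sup>2 / w\<^sup>2)"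
      unfolding exp_add[symmetric] by (simp add: power_divide)
    have "(F has_real_derivative (exp (s * t) * (exp (- (a * w + t / w)\<^sup>2) * (a - t / w\<^sup>2)) +
         exp (- s * t) * (exp (- (a * w - t / w)\<^sup>2) * (a + t / w\<^sup>2))) / sqrt pi) (at w)"
    proof -
      have "((\<lambda>w. a * w + t / w) has_real_derivative a - t / w\<^sup>2) (at w)"
        "((\<lambda>w. a * w - t / w) has_real_derivative a + t / w\<^sup>2) (at w)"
        using w by (auto intro!: derivative_eq_intros simp: power2_eq_square)
      then show ?thesis unfolding F_def by (intro DERIV_cdivide DERIV_add DERIV_cmult gauss_cdf_deriv)
    qed
    also have "(exp (s * t) * (exp (- (a * w + t / w)\<^sup>2) * (a - t / w\<^sup>2)) +
         exp (- s * t) * (exp (- (a * w - t / w)\<^sup>2) * (a + t / w\<^sup>2))) / sqrt pi = 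
         (exp (- s\<^sup>2 * w\<^sup>2 / 4) * exp (- t\<^sup>2 / w\<^sup>2) * (a - t / w\<^sup>2) + exp (- s\<^sup>2 * w\<^sup>2 / 4) * exp
             (- t\<^sup>2 / w\<^sup>2) * (a + t / w\<^sup>2)) / sqrt pi"
      by (simp only: mult.assoc[symmetric] e1 e2)
    also have "\<dots> = f w" by (simp add: f_def a_def algebra_simps)
    finally show ?thesis .
  qed
  have lim0: "(F \<longlongrightarrow> (exp (s * t) * sqrt pi + exp (- s * t) * 0) / sqrt pi) (at_right 0)"
  proof -
    have "filterlim (\<lambda>w. a * w + t / w) at_top (at_right 0)" using a t by real_asymp
    moreover have "filterlim (\<lambda>w. a * w - t / w) at_bot (at_right 0)" using a t by real_asymp
    ultimately show ?thesis unfolding F_def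
      by (intro tendsto_intros filterlim_compose[OF gauss_cdf_at_top]
          filterlim_compose[OF gauss_cdf_at_bot]) auto
  qed
  have limi: "(F \<longlongrightarrow> (exp (s * t) * sqrt pi + exp (- s * t) * sqrt pi) / sqrt pi) at_top"
  proof -
    have "filterlim (\<lambda>w. a * w + t / w) at_top at_top" using a t by real_asymp
    moreover have "filterlim (\<lambda>w. a * w - t / w) at_top at_top" using a t by real_asymp
    ultimately show ?thesis unfolding F_def
      by (intro tendsto_intros filterlim_compose[OF gauss_cdf_at_top]) auto
  qed
  have f0: "f w \<ge> 0" for w using s by (simp add: f_def)
  have "((F \<circ> real_of_ereal) \<longlongrightarrow> (exp (s * t) * sqrt pi + exp (- s * t) * 0) / sqrt pi) (at_right 0)"
    using lim0 unfolding zero_ereal_def by (simp add: ereal_tendsto_simps)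
  moreover have "((F \<circ> real_of_ereal) \<longlongrightarrow> (exp (s * t) * sqrt pi + exp (- s * t) * sqrt pi) / sqrt pi)
      (at_left \<infinity>)"
    using limi by (simp add: ereal_tendsto_simps)
  moreover have "isCont f x" if "0 < ereal x" for x unfolding f_def using that
    by (intro continuous_intros) auto
  ultimately have FTC: "set_integrable lborel (einterval 0 \<infinity>) f"
    "(LBINT w=0..\<infinity>. f w) = (exp (s * t) * sqrt pi + exp (- s * t) * sqrt pi) / sqrt pi
        - (exp (s * t) * sqrt pi + exp (- s * t) * 0) / sqrt pi"
    using interval_integral_FTC_nonneg[of 0 \<infinity> F f] dF f0 by auto
  have "(\<integral>\<^sup>+w. ennreal (f w) * indicator {0<..} w \<partial>lborel)
      = (\<integral>\<^sup>+w. ennreal (indicator (einterval 0 \<infinity>) w *\<^sub>R f w) \<partial>lborel)"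
    by (intro nn_integral_cong) (auto simp: indicator_def einterval_def)
  also have "\<dots> = ennreal (\<integral>w. indicator (einterval 0 \<infinity>) w *\<^sub>R f w \<partial>lborel)"
    using FTC(1) f0 by (intro nn_integral_eq_integral) (auto simp: set_integrable_def)
  also have "(\<integral>w. indicator (einterval 0 \<infinity>) w *\<^sub>R f w \<partial>lborel) = exp (- s * t)"
    using FTC(2)
      by (simp add: interval_lebesgue_integral_def set_lebesgue_integral_def add_divide_distrib)
  finally show ?thesis by (simp only: f_def)
qed

subsection \<open>The Laplace transform of the sum of chords\<close>

text \<open>The length of the vertical segment above z inside the ball of radius t. As
  \<open>sqrt\<close> is odd on the reals, \<open>max 0\<close> is what makes the value 0 outside
  the ball.\<close>

definition chord :: "int \<times> int \<Rightarrow> real \<Rightarrow> real" where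
  "chord z t = 2 * sqrt (max 0 (t\<^sup>2 - nsq z))"

lemma chord_nonneg [simp]: "chord z t \<ge> 0"
  by (simp add: chord_def)

lemma chord_continuous [continuous_intros]: "continuous_on A (chord z)"
  unfolding chord_def by (intro continuous_intros)

lemma chord_measurable [measurable]: "chord z \<in> borel_measurable borel"
  by (intro borel_measurable_continuous_onI continuous_intros)

lemma chord_eq_nn_integral:
  "ennreal (chord z t) = (\<integral>\<^sup>+v. indicator {v. v\<^sup>2 + nsq z \<le> t\<^sup>2} v \<partial>lborel)"
proof (cases "nsq z \<le> t\<^sup>2")
  case True
  define r where "r = sqrt (t\<^sup>2 - nsq z)"
  have "v\<^sup>2 + nsq z \<le> t\<^sup>2 \<longleftrightarrow> v \<in> {-r..r}" for v
  proof -
    have "v\<^sup>2 + nsq z \<le> t\<^sup>2 \<longleftrightarrow> v\<^sup>2 \<le> t\<^sup>2 - nsq z" by auto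
    also have "\<dots> \<longleftrightarrow> \<bar>v\<bar> \<le> r" unfolding r_def using real_sqrt_le_iff[of "v\<^sup>2"] by simp
    finally show ?thesis by auto
  qed
  then have "{v. v\<^sup>2 + nsq z \<le> t\<^sup>2} = {-r..r}" by blast
  moreover have "r \<ge> 0" using True by (simp add: r_def)
  ultimately show ?thesis using True by (simp add: chord_def r_def)
next
  case False
  have "\<not> v\<^sup>2 + nsq z \<le> t\<^sup>2" for v using False zero_le_power2[of v] by linarith
  then have "{v. v\<^sup>2 + nsq z \<le> t\<^sup>2} = {}" by blast
  then show ?thesis using False by (simp add: chord_def)
qed

text \<open>With the chord written as an integral over v and the order exchanged, the factor
  \<open>2 * t\<close> makes the integral over \<open>t \<ge> sqrt (v^2 + nsq z)\<close> exact and
  leaves a product of Gaussians in v and z. This is the reason for the weight \<open>2 * t\<close>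
  in all transforms below.\<close>

lemma chord_gauss_transform:
  assumes w: "w > 0"
  shows "(\<integral>\<^sup>+t. ennreal (chord z t) * (ennreal (2 * t * exp (- t\<^sup>2 / w\<^sup>2)) * indicator {0..} t)
      \<partial>lborel) =
     ennreal (sqrt pi * w ^ 3 * exp (- nsq z / w\<^sup>2))"
proof -
  have "(\<integral>\<^sup>+t. ennreal (chord z t) * (ennreal (2 * t * exp (- t\<^sup>2 / w\<^sup>2)) * indicator {0..} t) \<partial>lborel)
      =
     (\<integral>\<^sup>+t. (\<integral>\<^sup>+v. indicator {v. v\<^sup>2 + nsq z \<le> t\<^sup>2} v *
         (ennreal (2 * t * exp (- t\<^sup>2 / w\<^sup>2)) * indicator {0..} t) \<partial>lborel) \<partial>lborel)"
    unfolding chord_eq_nn_integral by (subst nn_integral_multc) auto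
  also have "\<dots>
      = (\<integral>\<^sup>+v. (\<integral>\<^sup>+t. indicator {v. v\<^sup>2 + nsq z \<le> t\<^sup>2} v *
      (ennreal (2 * t * exp (- t\<^sup>2 / w\<^sup>2)) * indicator {0..} t) \<partial>lborel) \<partial>lborel)"
    by (rule lborel_pair.Fubini') measurable
  also have "\<dots> = (\<integral>\<^sup>+v. ennreal (w\<^sup>2 * exp (- nsq z / w\<^sup>2) * exp (- v\<^sup>2 / w\<^sup>2)) \<partial>lborel)"
  proof (rule nn_integral_cong)
    fix v :: real
    define r where "r = sqrt (v\<^sup>2 + nsq z)"
    have r: "r \<ge> 0" "r\<^sup>2 = v\<^sup>2 + nsq z" by (simp_all add: r_def)
    have iff: "v\<^sup>2 + nsq z \<le> t\<^sup>2 \<longleftrightarrow> r \<le> t" if "t \<ge> 0" for t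
      using power_mono_iff[OF r(1) that, of 2] r(2) by simp
    have "(\<integral>\<^sup>+t. indicator {v. v\<^sup>2 + nsq z
        \<le> t\<^sup>2} v * (ennreal (2 * t * exp (- t\<^sup>2 / w\<^sup>2)) * indicator {0..} t) \<partial>lborel) =
       (\<integral>\<^sup>+t. ennreal (2 * t * exp (- t\<^sup>2 / w\<^sup>2)) * indicator {r..} t \<partial>lborel)"
      using iff r by (intro nn_integral_cong) (auto simp: indicator_def)
    also have "\<dots> = ennreal (0 - (- w\<^sup>2 * exp (- r\<^sup>2 / w\<^sup>2)))"
    proof (rule nn_integral_FTC_atLeast)
      show "((\<lambda>t. - w\<^sup>2 * exp (- t\<^sup>2 / w\<^sup>2)) has_real_derivative 2 * x * exp (- x\<^sup>2 / w\<^sup>2)) (at x)"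
          for x
      proof -
        have "((\<lambda>t. - w\<^sup>2 * exp (- t\<^sup>2 / w\<^sup>2))
            has_real_derivative - w\<^sup>2 * (exp (- x\<^sup>2 / w\<^sup>2) * (- (2 * x) / w\<^sup>2))) (at x)"
        proof -
          have "((\<lambda>t. - t\<^sup>2 / w\<^sup>2) has_real_derivative - (2 * x) / w\<^sup>2) (at x)"
            by (intro DERIV_cdivide) (auto intro!: derivative_eq_intros)
          then show ?thesis by (intro DERIV_cmult DERIV_chain2[OF DERIV_exp])
        qed
        then show ?thesis using w by (simp add: mult_ac)
      qed
      show "((\<lambda>t. - w\<^sup>2 * exp (- t\<^sup>2 / w\<^sup>2)) \<longlongrightarrow> 0) at_top"
      proof -
        define c where "c = 1 / w\<^sup>2"
        have "c > 0" using w by (simp add: c_def)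
        then have "((\<lambda>t. exp (- (c * t\<^sup>2))) \<longlongrightarrow> 0) at_top" by real_asymp
        from tendsto_mult_right_zero[OF this, of "- w\<^sup>2"] show ?thesis by (simp add: c_def)
      qed
    qed (use r in auto)
    also have "0 - (- w\<^sup>2 * exp (- r\<^sup>2 / w\<^sup>2)) = w\<^sup>2 * exp (- nsq z / w\<^sup>2) * exp (- v\<^sup>2 / w\<^sup>2)"
    proof -
      have "- r\<^sup>2 / w\<^sup>2 = - nsq z / w\<^sup>2 + - v\<^sup>2 / w\<^sup>2"
        unfolding r(2) by (simp add: add_divide_distrib diff_divide_distrib)
      then show ?thesis by (simp only: exp_add)
    qed
    finally show
        "(\<integral>\<^sup>+t. indicator {v. v\<^sup>2 + nsq z
        \<le> t\<^sup>2} v * (ennreal (2 * t * exp (- t\<^sup>2 / w\<^sup>2)) * indicator {0..} t) \<partial>lborel)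
      = ennreal (w\<^sup>2 * exp (- nsq z / w\<^sup>2) * exp (- v\<^sup>2 / w\<^sup>2))" .
  qed
  also have "\<dots> = ennreal (w\<^sup>2 * exp (- nsq z / w\<^sup>2) * (sqrt pi * w))"
  proof -
    have "has_bochner_integral lborel (\<lambda>v. w\<^sup>2 * exp (- nsq z / w\<^sup>2) * exp (- v\<^sup>2 / w\<^sup>2)) (w\<^sup>2
        * exp (- nsq z / w\<^sup>2) * (sqrt pi * w))"
      by (intro has_bochner_integral_mult_right has_bochner_integral_gauss w)
    then show ?thesis by (subst nn_integral_eq_integral) (auto simp: has_bochner_integral_iff)
  qed
  also have "w\<^sup>2 * exp (- nsq z / w\<^sup>2) * (sqrt pi * w) = sqrt pi * w ^ 3 * exp (- nsq z / w\<^sup>2)"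
    by (simp add: power2_eq_square power3_eq_cube)
  finally show ?thesis .
qed

lemma chord_exp_transform:
  assumes s: "s > 0"
  shows "(\<integral>\<^sup>+t. ennreal (chord z t) * (ennreal (2 * t * exp (- s * t)) * indicator {0..} t) \<partial>lborel) =
     (\<integral>\<^sup>+w. ennreal (s * w ^ 3 * exp (- s\<^sup>2 * w\<^sup>2 / 4)) * indicator {0<..} w * ennreal
         (exp (- nsq z / w\<^sup>2)) \<partial>lborel)"
proof -
  define q where "q w = s / sqrt pi * exp (- s\<^sup>2 * w\<^sup>2 / 4)" for w
  have q: "q w \<ge> 0" for w using s by (simp add: q_def)
  have qm [measurable]: "q \<in> borel_measurable borel" unfolding q_def[abs_def] by measurable
  have "(\<integral>\<^sup>+t. ennreal (chord z t) * (ennreal (2 * t * exp (- s * t)) * indicator {0..} t) \<partial>lborel) =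
     (\<integral>\<^sup>+t. (\<integral>\<^sup>+w. (ennreal (chord z t) * (ennreal (2 * t) * indicator {0..} t)) *
         (ennreal (q w * exp (- t\<^sup>2 / w\<^sup>2)) * indicator {0<..} w) \<partial>lborel) \<partial>lborel)"
  proof (rule nn_integral_cong)
    fix t :: real
    show "ennreal (chord z t) * (ennreal (2 * t * exp (- s * t)) * indicator {0..} t) =
      (\<integral>\<^sup>+w. (ennreal (chord z t) * (ennreal (2 * t) * indicator {0..} t)) *
         (ennreal (q w * exp (- t\<^sup>2 / w\<^sup>2)) * indicator {0<..} w) \<partial>lborel)"
    proof (cases "t > 0")
      case True
      have "(\<integral>\<^sup>+w. ennreal (q w * exp (- t\<^sup>2 / w\<^sup>2)) * indicator {0<..} w \<partial>lborel)
          = ennreal (exp (- s * t))"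
        using exp_subordination[OF s True] by (simp only: q_def)
      then show ?thesis using True by (subst nn_integral_cmult) (auto simp: ennreal_mult mult_ac)
    next
      case False
      then show ?thesis by (cases "t = 0") auto
    qed
  qed
  also have "\<dots> = (\<integral>\<^sup>+w. (\<integral>\<^sup>+t. (ennreal (chord z t) * (ennreal (2 * t) * indicator {0..} t)) *
         (ennreal (q w * exp (- t\<^sup>2 / w\<^sup>2)) * indicator {0<..} w) \<partial>lborel) \<partial>lborel)"
    by (rule lborel_pair.Fubini') measurable
  also have "\<dots>
      = (\<integral>\<^sup>+w. ennreal (s * w ^ 3 * exp (- s\<^sup>2 * w\<^sup>2 / 4)) * indicator {0<..} w * ennreal
      (exp (- nsq z / w\<^sup>2)) \<partial>lborel)"
  proof (rule nn_integral_cong)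
    fix w :: real
    show "(\<integral>\<^sup>+t. (ennreal (chord z t) * (ennreal (2 * t) * indicator {0..} t)) *
         (ennreal (q w * exp (- t\<^sup>2 / w\<^sup>2)) * indicator {0<..} w) \<partial>lborel) =
       ennreal (s * w ^ 3 * exp (- s\<^sup>2 * w\<^sup>2 / 4)) * indicator {0<..} w * ennreal (exp (- nsq z / w\<^sup>2))"
    proof (cases "w > 0")
      case True
      have "(\<integral>\<^sup>+t. (ennreal (chord z t) * (ennreal (2 * t) * indicator {0..} t)) *
         (ennreal (q w * exp (- t\<^sup>2 / w\<^sup>2)) * indicator {0<..} w) \<partial>lborel) =
         (\<integral>\<^sup>+t. ennreal (q w) *
             (ennreal (chord z t) * (ennreal (2 * t * exp (- t\<^sup>2 / w\<^sup>2)) * indicator {0..} t)) \<partial>lborel)"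
        using True q
          by (intro nn_integral_cong) (auto simp: ennreal_mult ennreal_mult'' mult_ac indicator_def)
      also have "\<dots> = ennreal (q w) * ennreal (sqrt pi * w ^ 3 * exp (- nsq z / w\<^sup>2))"
        by (simp only: chord_gauss_transform[OF True, symmetric]) (rule nn_integral_cmult, measurable)
      also have "\<dots> = ennreal (q w * (sqrt pi * w ^ 3 * exp (- nsq z / w\<^sup>2)))"
        using q by (simp add: ennreal_mult')
      also have "q w * (sqrt pi * w ^ 3 * exp (- nsq z / w\<^sup>2))
          = (s * w ^ 3 * exp (- s\<^sup>2 * w\<^sup>2 / 4)) * exp (- nsq z / w\<^sup>2)"
        by (simp add: q_def)
      finally show ?thesis using True by (simp add: ennreal_mult'')
    qed simp
  qed
  finally show ?thesis .
qed

lemma nn_integral_power5_gauss: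
  assumes c: "c > 0"
  shows "(\<integral>\<^sup>+w. ennreal (w ^ 5 * exp (- c * w\<^sup>2)) * indicator {0<..} w \<partial>lborel) = ennreal (1 / c ^ 3)"
proof -
  \<comment> \<open>With d in place of \<open>1 / c\<close>, checking the derivative of F becomes a
    polynomial identity modulo \<open>c * d = 1\<close>.\<close>
  define d where "d = 1 / c"
  have cd: "c * d = 1" "d > 0" using c by (simp_all add: d_def)
  define F where "F w = - exp (- c * w\<^sup>2) * (w ^ 4 * d / 2 + w\<^sup>2 * d\<^sup>2 + d ^ 3)" for w
  have "(\<integral>\<^sup>+w. ennreal (w ^ 5 * exp (- c * w\<^sup>2)) * indicator {0<..} w \<partial>lborel) =
        (\<integral>\<^sup>+w. ennreal (w ^ 5 * exp (- c * w\<^sup>2)) * indicator {0..} w \<partial>lborel)"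
    by (intro nn_integral_cong) (auto simp: indicator_def)
  also have "\<dots> = ennreal (0 - F 0)"
  proof (rule nn_integral_FTC_atLeast)
    show "(F has_real_derivative x ^ 5 * exp (- c * x\<^sup>2)) (at x)" for x
    proof -
      have "(F has_real_derivative (- (exp (- c * x\<^sup>2) * (- c * (2 * x))) * (x ^ 4 * d / 2 + x\<^sup>2 * d\<^sup>2
          + d ^ 3) +
          (- exp (- c * x\<^sup>2)) * (2 * x ^ 3 * d + 2 * x * d\<^sup>2))) (at x)"
        unfolding F_def by (rule derivative_eq_intros refl | simp)+
      moreover have "- (e * (- c * (2 * x))) * (x ^ 4 * d / 2 + x\<^sup>2 * d\<^sup>2 + d ^ 3) +
          (- e) * (2 * x ^ 3 * d + 2 * x * d\<^sup>2) = x ^ 5 * e" for e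
        using cd(1) by algebra
      ultimately show ?thesis by simp
    qed
    show "(F \<longlongrightarrow> 0) at_top" unfolding F_def using c cd by real_asymp
  qed auto
  also have "0 - F 0 = 1 / c ^ 3" by (simp add: F_def d_def power_divide)
  finally show ?thesis .
qed

lemma nn_integral_swap_count_space:
  fixes f :: "int \<times> int \<Rightarrow> real \<Rightarrow> ennreal"
  assumes [measurable]: "\<And>z. f z \<in> borel_measurable lborel"
  shows "(\<integral>\<^sup>+z. (\<integral>\<^sup>+x. f z x \<partial>lborel) \<partial>count_space UNIV)
      = (\<integral>\<^sup>+x. (\<integral>\<^sup>+z. f z x \<partial>count_space UNIV) \<partial>lborel)"
  by (rule nn_integral_count_space_nn_integral[symmetric]) auto

text \<open>Positivity justifies every exchange of sum and integral; the substance is theta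
  inversion inside the w-integral. It contributes \<open>pi * w^2\<close>, which raises
  \<open>w^3\<close> to \<open>w^5\<close> and makes the remaining integral a multiple of
  \<open>1 / c^3\<close> with \<open>c = s^2 / 4 + pi^2 * nsq \<xi>\<close>.\<close>

lemma chord_sum_laplace_nn:
  assumes s: "s > 0"
  shows "(\<integral>\<^sup>+t. (\<integral>\<^sup>+z. ennreal (chord z t) \<partial>count_space UNIV)
      * (ennreal (2 * t * exp (- s * t)) * indicator {0..} t) \<partial>lborel) =
     (\<integral>\<^sup>+\<xi>. ennreal (64 * pi * s / (s\<^sup>2 + 4 * pi\<^sup>2 * nsq \<xi>) ^ 3) \<partial>count_space UNIV)"
proof -
  have "(\<integral>\<^sup>+t. (\<integral>\<^sup>+z. ennreal (chord z t) \<partial>count_space UNIV)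
      * (ennreal (2 * t * exp (- s * t)) * indicator {0..} t) \<partial>lborel) =
    (\<integral>\<^sup>+t.
        (\<integral>\<^sup>+z. ennreal (chord z t) * (ennreal (2 * t * exp (- s * t)) * indicator {0..} t) \<partial>count_space
        UNIV) \<partial>lborel)"
    by (simp add: nn_integral_multc)
  also have "\<dots>
      = (\<integral>\<^sup>+z.
      (\<integral>\<^sup>+t. ennreal (chord z t) * (ennreal (2 * t * exp (- s * t)) * indicator {0..} t) \<partial>lborel)
      \<partial>count_space UNIV)"
    by (rule nn_integral_swap_count_space[symmetric]) measurable
  also have "\<dots>
      = (\<integral>\<^sup>+z. (\<integral>\<^sup>+w. ennreal (s * w ^ 3 * exp (- s\<^sup>2 * w\<^sup>2 / 4)) * indicator {0<..} w * ennreal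
      (exp (- nsq z / w\<^sup>2)) \<partial>lborel) \<partial>count_space UNIV)"
    by (simp only: chord_exp_transform[OF s])
  also have "\<dots>
      = (\<integral>\<^sup>+w. (\<integral>\<^sup>+z. ennreal (s * w ^ 3 * exp (- s\<^sup>2 * w\<^sup>2 / 4)) * indicator {0<..} w * ennreal
      (exp (- nsq z / w\<^sup>2)) \<partial>count_space UNIV) \<partial>lborel)"
    by (rule nn_integral_swap_count_space) measurable
  also have "\<dots>
      = (\<integral>\<^sup>+w. (\<integral>\<^sup>+\<xi>. ennreal (s * w ^ 3 * exp (- s\<^sup>2 * w\<^sup>2 / 4)) * indicator {0<..} w * ennreal
      (pi * w\<^sup>2 * exp (- pi\<^sup>2 * w\<^sup>2 * nsq \<xi>)) \<partial>count_space UNIV) \<partial>lborel)"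
  proof (rule nn_integral_cong)
    fix w :: real
    show "(\<integral>\<^sup>+z. ennreal (s * w ^ 3 * exp (- s\<^sup>2 * w\<^sup>2 / 4)) * indicator {0<..} w
        * ennreal (exp (- nsq z / w\<^sup>2)) \<partial>count_space UNIV) =
      (\<integral>\<^sup>+\<xi>. ennreal (s * w ^ 3 * exp (- s\<^sup>2 * w\<^sup>2 / 4)) * indicator {0<..} w * ennreal
          (pi * w\<^sup>2 * exp (- pi\<^sup>2 * w\<^sup>2 * nsq \<xi>)) \<partial>count_space UNIV)"
    proof (cases "w > 0")
      case True
      show ?thesis
        by (subst (1 2) nn_integral_cmult)
            (simp_all only: theta_functional_equation_2d[OF True], simp_all)
    qed simp
  qed
  also have "\<dots>
      = (\<integral>\<^sup>+\<xi>. (\<integral>\<^sup>+w. ennreal (s * w ^ 3 * exp (- s\<^sup>2 * w\<^sup>2 / 4)) * indicator {0<..} w * ennreal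
      (pi * w\<^sup>2 * exp (- pi\<^sup>2 * w\<^sup>2 * nsq \<xi>)) \<partial>lborel) \<partial>count_space UNIV)"
    by (rule nn_integral_swap_count_space[symmetric]) measurable
  also have "\<dots> = (\<integral>\<^sup>+\<xi>. ennreal (64 * pi * s / (s\<^sup>2 + 4 * pi\<^sup>2 * nsq \<xi>) ^ 3) \<partial>count_space UNIV)"
  proof (rule nn_integral_cong)
    fix \<xi> :: "int \<times> int"
    define c where "c = s\<^sup>2 / 4 + pi\<^sup>2 * nsq \<xi>"
    have c: "c > 0" using s by (simp add: c_def add_pos_nonneg)
    have "(\<integral>\<^sup>+w. ennreal (s * w ^ 3 * exp (- s\<^sup>2 * w\<^sup>2 / 4)) * indicator {0<..} w
        * ennreal (pi * w\<^sup>2 * exp (- pi\<^sup>2 * w\<^sup>2 * nsq \<xi>)) \<partial>lborel) =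
      (\<integral>\<^sup>+w. ennreal (pi * s) * (ennreal (w ^ 5 * exp (- c * w\<^sup>2)) * indicator {0<..} w) \<partial>lborel)"
    proof (rule nn_integral_cong)
      fix w :: real
      have "exp (- c * w\<^sup>2) = exp (- s\<^sup>2 * w\<^sup>2 / 4) * exp (- pi\<^sup>2 * w\<^sup>2 * nsq \<xi>)"
        by (simp add: c_def algebra_simps flip: exp_add)
      then have "s * w ^ 3 * exp (- s\<^sup>2 * w\<^sup>2 / 4) * (pi * w\<^sup>2 * exp (- pi\<^sup>2 * w\<^sup>2 * nsq \<xi>))
          = pi * s * (w ^ 5 * exp (- c * w\<^sup>2))"
        by (simp add: eval_nat_numeral)
      then show "ennreal (s * w ^ 3 * exp (- s\<^sup>2 * w\<^sup>2 / 4)) * indicator {0<..} w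
          * ennreal (pi * w\<^sup>2 * exp (- pi\<^sup>2 * w\<^sup>2 * nsq \<xi>)) =
        ennreal (pi * s) * (ennreal (w ^ 5 * exp (- c * w\<^sup>2)) * indicator {0<..} w)"
        using s by (auto simp: indicator_def simp flip: ennreal_mult)
    qed
    also have "\<dots> = ennreal (pi * s) * ennreal (1 / c ^ 3)"
      by (subst nn_integral_cmult) (simp_all only: nn_integral_power5_gauss[OF c], measurable)
    also have "\<dots> = ennreal (pi * s * (1 / c ^ 3))" using s c by (simp flip: ennreal_mult)
    also have "pi * s * (1 / c ^ 3) = 64 * pi * s / (s\<^sup>2 + 4 * pi\<^sup>2 * nsq \<xi>) ^ 3"
    proof -
      have "s\<^sup>2 + 4 * pi\<^sup>2 * nsq \<xi> = 4 * c" by (simp add: c_def)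
      then show ?thesis by (simp add: power_mult_distrib)
    qed
    finally show "(\<integral>\<^sup>+w. ennreal (s * w ^ 3 * exp (- s\<^sup>2 * w\<^sup>2 / 4)) * indicator {0<..} w
        * ennreal (pi * w\<^sup>2 * exp (- pi\<^sup>2 * w\<^sup>2 * nsq \<xi>)) \<partial>lborel) =
      ennreal (64 * pi * s / (s\<^sup>2 + 4 * pi\<^sup>2 * nsq \<xi>) ^ 3)" .
  qed
  finally show ?thesis .
qed

subsection \<open>Laplace transforms of functions of subexponential growth\<close>

text \<open>Growth below every exponential makes the transform converge on the whole half-plane
  \<open>Re s > 0\<close>, right up to the imaginary axis where the poles are studied.\<close>

definition subexp :: "(real \<Rightarrow> real) \<Rightarrow> bool" where
  "subexp f \<longleftrightarrow> continuous_on UNIV f \<and> (\<forall>e>0. \<exists>K\<ge>0. \<forall>t\<ge>0. \<bar>f t\<bar> \<le> K * exp (e * t))"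

definition laplace :: "(real \<Rightarrow> real) \<Rightarrow> complex \<Rightarrow> complex" where
  "laplace f s = (\<integral>t. indicator {0..} t *\<^sub>R (of_real (f t) * exp (- (s * of_real t))) \<partial>lborel)"

lemma subexp_add: "subexp f \<Longrightarrow> subexp g \<Longrightarrow> subexp (\<lambda>t. f t + g t)"
  unfolding subexp_def
proof (intro conjI allI impI)
  assume f: "continuous_on UNIV f \<and> (\<forall>e>0. \<exists>K\<ge>0. \<forall>t\<ge>0. \<bar>f t\<bar> \<le> K * exp (e * t))"
    and g: "continuous_on UNIV g \<and> (\<forall>e>0. \<exists>K\<ge>0. \<forall>t\<ge>0. \<bar>g t\<bar> \<le> K * exp (e * t))"
  show "continuous_on UNIV (\<lambda>t. f t + g t)" using f g by (intro continuous_on_add) auto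
  fix e :: real assume "e > 0"
  with f obtain K1 where K1: "K1 \<ge> 0" "\<And>t. t \<ge> 0 \<Longrightarrow> \<bar>f t\<bar> \<le> K1 * exp (e * t)" by blast
  from \<open>e > 0\<close> g obtain K2 where K2: "K2 \<ge> 0" "\<And>t. t \<ge> 0 \<Longrightarrow> \<bar>g t\<bar> \<le> K2 * exp (e * t)" by blast
  have "\<bar>f t + g t\<bar> \<le> (K1 + K2) * exp (e * t)" if "t \<ge> 0" for t
    using K1(2)[OF that] K2(2)[OF that] unfolding distrib_right by linarith
  then show "\<exists>K\<ge>0. \<forall>t\<ge>0. \<bar>f t + g t\<bar> \<le> K * exp (e * t)"
    using K1(1) K2(1) by (intro exI[of _ "K1 + K2"]) simp
qed

lemma subexp_cmult: "subexp f \<Longrightarrow> subexp (\<lambda>t. c * f t)"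
  unfolding subexp_def
proof (intro conjI allI impI)
  assume f: "continuous_on UNIV f \<and> (\<forall>e>0. \<exists>K\<ge>0. \<forall>t\<ge>0. \<bar>f t\<bar> \<le> K * exp (e * t))"
  show "continuous_on UNIV (\<lambda>t. c * f t)" using f by (intro continuous_on_mult_left) auto
  fix e :: real assume "e > 0"
  with f obtain K1 where K1: "K1 \<ge> 0" "\<And>t. t \<ge> 0 \<Longrightarrow> \<bar>f t\<bar> \<le> K1 * exp (e * t)" by blast
  have "\<bar>c * f t\<bar> \<le> (\<bar>c\<bar> * K1) * exp (e * t)" if "t \<ge> 0" for t
    using mult_left_mono[OF K1(2)[OF that], of "\<bar>c\<bar>"] by (simp add: abs_mult mult.assoc)
  then show "\<exists>K\<ge>0. \<forall>t\<ge>0. \<bar>c * f t\<bar> \<le> K * exp (e * t)"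
    using K1(1) by (intro exI[of _ "\<bar>c\<bar> * K1"]) simp
qed

lemma power_le_fact_exp:
  fixes y :: real
  assumes "y \<ge> 0"
  shows "y ^ k \<le> fact k * exp y"
proof -
  have "(\<Sum>n\<in>{k}. y ^ n /\<^sub>R fact n) \<le> (\<Sum>n. y ^ n /\<^sub>R fact n)"
    using assms by (intro sum_le_suminf summable_exp_generic) auto
  then show ?thesis by (simp add: exp_def field_simps)
qed

lemma subexpI_poly:
  assumes "continuous_on UNIV f" "\<And>t. t \<ge> 0 \<Longrightarrow> \<bar>f t\<bar> \<le> C * (1 + t) ^ k"
  shows "subexp f"
  unfolding subexp_def
proof (intro conjI allI impI assms(1))
  fix e :: real assume e: "e > 0"
  have C: "C \<ge> 0" using assms(2)[of 0] by simp
  define K where "K = C * (fact k * exp e / e ^ k)"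
  have "\<bar>f t\<bar> \<le> K * exp (e * t)" if t: "t \<ge> 0" for t
  proof -
    have "(e * (1 + t)) ^ k \<le> fact k * exp (e * (1 + t))"
      using e t by (intro power_le_fact_exp) auto
    moreover have "exp (e * (1 + t)) = exp e * exp (e * t)" by (simp add: distrib_left exp_add)
    ultimately have "e ^ k * (1 + t) ^ k \<le> fact k * (exp e * exp (e * t))"
      by (simp only: power_mult_distrib)
    then have "(1 + t) ^ k \<le> fact k * exp e / e ^ k * exp (e * t)"
      using e unfolding power_mult_distrib by (simp add: field_simps exp_add)
    then have "C * (1 + t) ^ k \<le> C * (fact k * exp e / e ^ k * exp (e * t))"
      using C by (intro mult_left_mono)
    then show ?thesis using assms(2)[OF t] by (simp add: K_def)
  qed
  moreover have "K \<ge> 0" using C e by (simp add: K_def)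
  ultimately show "\<exists>K\<ge>0. \<forall>t\<ge>0. \<bar>f t\<bar> \<le> K * exp (e * t)" by blast
qed

lemma has_bochner_integral_exp_tail:
  fixes a c :: real
  assumes "c > 0"
  shows "has_bochner_integral lborel (\<lambda>t. indicator {a..} t *\<^sub>R exp (- (c * t)) :: real)
      (exp (- (c * a)) / c)"
proof -
  have "(\<integral>\<^sup>+t. ennreal (indicator {a..} t *\<^sub>R exp (- (c * t))) \<partial>lborel) =
      (\<integral>\<^sup>+t. ennreal (exp (- (c * t))) * indicator {a..} t \<partial>lborel)"
    by (intro nn_integral_cong) (auto simp: indicator_def)
  also have "\<dots> = ennreal (0 - (- exp (- (c * a)) / c))"
  proof (rule nn_integral_FTC_atLeast)
    show "((\<lambda>t. - exp (- (c * t)) / c) has_real_derivative exp (- (c * x))) (at x)" for x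
      using assms by (auto intro!: derivative_eq_intros)
    show "((\<lambda>t. - exp (- (c * t)) / c) \<longlongrightarrow> 0) at_top" using assms by real_asymp
  qed auto
  finally have "(\<integral>\<^sup>+t. ennreal (indicator {a..} t *\<^sub>R exp (- (c * t))) \<partial>lborel)
      = ennreal (exp (- (c * a)) / c)"
    by simp
  then show ?thesis using assms by (intro has_bochner_integral_nn_integral) auto
qed

lemma laplace_kernel_measurable:
  assumes "continuous_on UNIV f" "A \<in> sets borel"
  shows "(\<lambda>t. indicator A t *\<^sub>R (of_real (f t) * exp (- (s * of_real t)) :: complex)) \<in>
      borel_measurable borel"
proof -
  have "(\<lambda>t. of_real (f t) * exp (- (s * of_real t)) :: complex) \<in> borel_measurable borel"
    by (intro borel_measurable_continuous_onI continuous_intros assms)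
  then show ?thesis using assms(2) by measurable
qed

text \<open>One estimate serves two purposes: a = 0 gives absolute convergence, large a gives tails
  that are small uniformly in \<open>Re s \<ge> 2 * e\<close>. Half of the decay absorbs the growth
  of f, the other half is integrated.\<close>

lemma laplace_tail:
  assumes f: "continuous_on UNIV f" and K: "\<And>t. t \<ge> 0 \<Longrightarrow> \<bar>f t\<bar> \<le> K * exp (e * t)"
    and e: "e > 0" and s: "Re s \<ge> 2 * e" and a: "a \<ge> 0"
  shows "integrable lborel (\<lambda>t. indicator {a..} t *\<^sub>R (of_real (f t)
      * exp (- (s * of_real t)) :: complex))" (is "integrable _ ?g")
    and "cmod (\<integral>t. indicator {a..} t *\<^sub>R (of_real (f t) * exp (- (s * of_real t))) \<partial>lborel)
        \<le> K * exp (- (e * a)) / e"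
proof -
  let ?h = "\<lambda>t. K * (indicator {a..} t *\<^sub>R exp (- (e * t)))"
  have h: "has_bochner_integral lborel ?h (K * (exp (- (e * a)) / e))"
    by (intro has_bochner_integral_mult_right has_bochner_integral_exp_tail e)
  have bd: "norm (?g t) \<le> ?h t" for t
  proof (cases "t \<ge> a")
    case True
    then have t: "t \<ge> 0" using a by simp
    have K0: "K \<ge> 0" using K[of 0] by simp
    have "norm (?g t) = \<bar>f t\<bar> * exp (- (Re s * t))" using True by (simp add: norm_mult)
    also have "\<dots> \<le> (K * exp (e * t)) * exp (- (2 * e * t))"
      using t K[OF t] s K0 by (intro mult_mono) (auto intro!: mult_right_mono)
    also have "\<dots> = K * exp (- (e * t))" by (simp add: mult.assoc flip: exp_add)
    finally show ?thesis using True by simp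
  qed simp
  have m: "?g \<in> borel_measurable lborel"
    using laplace_kernel_measurable[OF f, of "{a..}" s] by simp
  show 1: "integrable lborel ?g"
  proof (rule Bochner_Integration.integrable_bound[of _ ?h])
    show "AE t in lborel. norm (?g t) \<le> norm (?h t)"
      unfolding real_norm_def by (intro AE_I2 order_trans[OF bd abs_ge_self])
  qed (use h m in \<open>simp_all add: has_bochner_integral_iff\<close>)
  have "cmod (\<integral>t. ?g t \<partial>lborel) \<le> (\<integral>t. ?h t \<partial>lborel)"
    by (rule Bochner_Integration.integral_norm_bound_integral)
        (use 1 h bd in \<open>auto simp: has_bochner_integral_iff\<close>)
  also have "\<dots> = K * exp (- (e * a)) / e" using h by (simp add: has_bochner_integral_iff)
  finally show "cmod (\<integral>t. ?g t \<partial>lborel) \<le> K * exp (- (e * a)) / e" .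
qed

lemma laplace_integrable:
  assumes "subexp f" "Re s > 0"
  shows "integrable lborel (\<lambda>t. indicator {0..} t *\<^sub>R (of_real (f t)
      * exp (- (s * of_real t)) :: complex))"
proof -
  obtain K where "\<And>t. t \<ge> 0 \<Longrightarrow> \<bar>f t\<bar> \<le> K * exp (Re s / 2 * t)"
    using assms unfolding subexp_def by (meson half_gt_zero)
  then show ?thesis using assms by (intro laplace_tail(1)[of f K "Re s / 2"]) (auto simp: subexp_def)
qed

lemma laplace_add:
  assumes "subexp f" "subexp g" "Re s > 0"
  shows "laplace (\<lambda>t. f t + g t) s = laplace f s + laplace g s"
  unfolding laplace_def Bochner_Integration.integral_add[OF laplace_integrable[OF assms(1,3)]
      laplace_integrable[OF assms(2,3)], symmetric]
  by (simp add: algebra_simps)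

lemma laplace_cmult: "laplace (\<lambda>t. c * f t) s = of_real c * laplace f s"
proof -
  have "laplace (\<lambda>t. c * f t) s
      = (\<integral>t. of_real c * (indicator {0..} t *\<^sub>R (of_real (f t) * exp (- (s * of_real t)))) \<partial>lborel)"
    unfolding laplace_def
      by (intro Bochner_Integration.integral_cong refl) (simp add: mult_ac scaleR_conv_of_real)
  then show ?thesis unfolding laplace_def by (simp only: integral_mult_right_zero)
qed

lemma laplace_holomorphic:
  assumes f: "subexp f"
  shows "laplace f holomorphic_on {s. Re s > 0}"
proof (rule holomorphic_uniform_sequence)
  let ?S = "{s. Re s > 0}"
  have cf: "continuous_on UNIV f" using f by (simp add: subexp_def)
  have cf': "continuous_on A (\<lambda>x. f (g x))" if "continuous_on A g" for A
      and g :: "'a::topological_space \<Rightarrow> real"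
    using continuous_on_compose2[OF cf that] by simp
  show "open ?S" by (rule open_halfspace_Re_gt)
  define F where "F n s = integral (cbox 0 (real n)) (\<lambda>t. of_real (f t) * exp (- (s * of_real t)))"
      for n and s :: complex
  show "F n holomorphic_on ?S" for n
    unfolding F_def[abs_def]
  proof (rule leibniz_rule_holomorphic[where fx = "\<lambda>s t. of_real (f t)
      * (exp (- (s * of_real t)) * (- of_real t))"])
    show "((\<lambda>s. of_real (f t) * exp (- (s * of_real t))) has_field_derivative of_real (f t)
        * (exp (- (s * of_real t)) * - of_real t)) (at s within ?S)" for s t
      by (auto intro!: derivative_eq_intros)
    show "(\<lambda>t. of_real (f t) * exp (- (s * of_real t))) integrable_on cbox 0 (real n)" for s :: complex
      by (intro integrable_continuous continuous_intros cf')
    show "continuous_on (?S \<times> cbox 0 (real n)) (\<lambda>(s, t). of_real (f t) * (exp (- (s * of_real t)) *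
        - of_real t))"
      unfolding case_prod_beta by (intro continuous_intros cf')
    show "convex ?S" by (rule convex_halfspace_Re_gt)
  qed
  fix s0 :: complex assume s0: "s0 \<in> ?S"
  \<comment> \<open>On the closed disc of radius d around s0 the real part is at least
    \<open>d = 2 * e\<close>, the range in which the tail bound is uniform.\<close>
  define d where "d = Re s0 / 2"
  define e where "e = d / 2"
  have d: "d > 0" "e > 0" using s0 by (auto simp: d_def e_def)
  obtain K where K: "K \<ge> 0" "\<And>t. t \<ge> 0 \<Longrightarrow> \<bar>f t\<bar> \<le> K * exp (e * t)"
    using f d unfolding subexp_def by meson
  have Re_ge: "Re s \<ge> 2 * e" if "s \<in> cball s0 d" for s
  proof -
    have "\<bar>Re (s0 - s)\<bar> \<le> cmod (s0 - s)" by (rule abs_Re_le_cmod)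
    then have "\<bar>Re s0 - Re s\<bar> \<le> d" using that by (simp add: dist_norm)
    then have "Re s0 - Re s \<le> d" by linarith
    then show ?thesis unfolding e_def d_def by linarith
  qed
  have bd: "cmod (F n s - laplace f s) \<le> K * exp (- (e * real n)) / e" if s: "s \<in> cball s0 d" for n s
  proof -
    let ?g = "\<lambda>t. of_real (f t) * exp (- (s * of_real t)) :: complex"
    have i0: "integrable lborel (\<lambda>t. indicator {0..} t *\<^sub>R ?g t)"
      by (rule laplace_tail(1)[OF cf K(2) d(2) Re_ge[OF s]]) auto
    have in': "integrable lborel (\<lambda>t. indicator {real n..} t *\<^sub>R ?g t)"
      by (rule laplace_tail(1)[OF cf K(2) d(2) Re_ge[OF s]]) auto
    have ib: "integrable lborel (\<lambda>t. indicator {0..real n} t *\<^sub>R ?g t)"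
    proof -
      have "indicator {0..real n} t *\<^sub>R ?g t
          = indicator {0..real n} t *\<^sub>R (indicator {0..} t *\<^sub>R ?g t)" for t
        by (auto simp: indicator_def)
      then show ?thesis using integrable_mult_indicator[OF _ i0, of "{0..real n}"] by (simp only:) simp
    qed
    have "F n s = (\<integral>t. indicator {0..real n} t *\<^sub>R ?g t \<partial>lborel)"
      using set_borel_integral_eq_integral(2)[of "{0..real n}" ?g] ib
      by (simp add: F_def set_lebesgue_integral_def set_integrable_def cbox_interval)
    moreover have "laplace f s
        = (\<integral>t. indicator {0..real n} t *\<^sub>R ?g t + indicator {real n..} t *\<^sub>R ?g t \<partial>lborel)"
      unfolding laplace_def
    proof (rule integral_cong_AE)
      show "AE t in lborel. indicator {0..} t *\<^sub>R ?g t = indicator {0..real n} t *\<^sub>R ?g t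
          + indicator {real n..} t *\<^sub>R ?g t"
        using AE_lborel_singleton[of "real n"] by eventually_elim (auto simp: indicator_def)
    qed (use i0 ib in' in \<open>auto intro!: borel_measurable_integrable borel_measurable_add\<close>)
    ultimately have "F n s - laplace f s = - (\<integral>t. indicator {real n..} t *\<^sub>R ?g t \<partial>lborel)"
      using Bochner_Integration.integral_add[OF ib in'] by simp
    then show ?thesis
      using laplace_tail(2)[OF cf K(2) d(2) Re_ge[OF s], of "real n"] by simp
  qed
  have "cball s0 d \<subseteq> ?S" using Re_ge d by fastforce
  moreover have "uniform_limit (cball s0 d) F (laplace f) sequentially"
  proof (rule uniform_limitI)
    fix \<epsilon> :: real assume "\<epsilon> > 0"
    have "((\<lambda>n. exp (- (e * real n))) \<longlongrightarrow> 0) sequentially" using d(2) by real_asymp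
    from tendsto_mult_right_zero[OF this, of "K / e"]
    have "\<forall>\<^sub>F n in sequentially. K / e * exp (- (e * real n)) < \<epsilon>"
      using \<open>\<epsilon> > 0\<close> order_tendstoD(2) by blast
    then show "\<forall>\<^sub>F n in sequentially. \<forall>s\<in>cball s0 d. dist (F n s) (laplace f s) < \<epsilon>"
    proof eventually_elim
      case (elim n)
      show ?case
      proof
        fix s assume "s \<in> cball s0 d"
        from bd[OF this, of n] elim show "dist (F n s) (laplace f s) < \<epsilon>"
          by (simp add: dist_norm)
      qed
    qed
  qed
  ultimately show "\<exists>d>0. cball s0 d \<subseteq> ?S \<and> uniform_limit (cball s0 d) F (laplace f) sequentially"
    using d by blast
qed

text \<open>Identity theorem: the positive reals, where the transforms are computed as nonnegative
  integrals, accumulate at 1 inside the half-plane.\<close>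

lemma laplace_eqI:
  assumes f: "subexp f" and R: "R holomorphic_on {s. Re s > 0}"
    and eq: "\<And>x. x > 0 \<Longrightarrow> laplace f (of_real x) = R (of_real x)" and s: "Re s > 0"
  shows "laplace f s = R s"
proof -
  let ?S = "{s. Re s > 0}"
  have "(1 :: complex) islimpt complex_of_real ` {0<..}"
    unfolding islimpt_approachable
  proof (intro allI impI)
    fix e :: real assume "e > 0"
    then have "complex_of_real (1 + e / 2) \<in> complex_of_real ` {0<..}"
      by (intro imageI) simp
    moreover have "complex_of_real (1 + e / 2) \<noteq> 1 \<and> dist (complex_of_real (1 + e / 2)) 1 < e"
      using \<open>e > 0\<close> by (auto simp: dist_norm)
    ultimately    show "\<exists>x'\<in>complex_of_real ` {0<..}. x' \<noteq> 1 \<and> dist x' 1 < e" by blast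
  qed
  then have "laplace f s - R s = 0"
    by (rule analytic_continuation[where f = "\<lambda>s. laplace f s - R s" and S = ?S and U =
        "complex_of_real ` {0<..}" and \<xi> = 1, rotated 5])
       (use laplace_holomorphic[OF f] R s eq in \<open>auto intro!: holomorphic_intros open_halfspace_Re_gt
           convex_connected convex_halfspace_Re_gt\<close>)
  then show ?thesis by simp
qed

lemma laplace_of_real_nonneg:
  assumes f: "subexp f" "\<And>t. t \<ge> 0 \<Longrightarrow> f t \<ge> 0" and x: "x > 0" and J: "J \<ge> 0"
    and nn: "(\<integral>\<^sup>+t. ennreal (f t * exp (- x * t)) * indicator {0..} t \<partial>lborel) = ennreal J"
  shows "laplace f (of_real x) = of_real J"
proof -
  have "(\<integral>t. indicator {0..} t *\<^sub>R (f t * exp (- x * t)) \<partial>lborel)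
      = enn2real (\<integral>\<^sup>+t. ennreal (indicator {0..} t *\<^sub>R (f t * exp (- x * t))) \<partial>lborel)"
  proof (rule integral_eq_nn_integral)
    have "(\<lambda>t. f t * exp (- x * t)) \<in> borel_measurable borel"
      using f by (intro borel_measurable_continuous_onI continuous_intros) (auto simp: subexp_def)
    then show "(\<lambda>t. indicator {0..} t *\<^sub>R (f t * exp (- x * t))) \<in> borel_measurable lborel"
      by measurable
  qed (use f in \<open>auto simp: indicator_def\<close>)
  also have "(\<integral>\<^sup>+t. ennreal (indicator {0..} t *\<^sub>R (f t * exp (- x * t))) \<partial>lborel) = ennreal J"
    unfolding nn[symmetric] by (intro nn_integral_cong) (auto simp: indicator_def)
  finally have "(\<integral>t. indicator {0..} t *\<^sub>R (f t * exp (- x * t)) \<partial>lborel) = J" using J by simp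
  moreover have "laplace f (of_real x)
      = (\<integral>t. complex_of_real (indicator {0..} t *\<^sub>R (f t * exp (- x * t))) \<partial>lborel)"
    unfolding laplace_def
    by (intro Bochner_Integration.integral_cong refl) (auto simp: indicator_def exp_of_real[symmetric])
  ultimately show ?thesis by (simp only: integral_complex_of_real)
qed

text \<open>On the positive axis this is the Gamma integral after the substitution of
  \<open>x * t\<close> for t; \<open>laplace_eqI\<close> extends it.\<close>

lemma laplace_power:
  assumes s: "Re s > 0"
  shows "laplace (\<lambda>t. t ^ k) s = of_real (fact k) / s ^ Suc k"
proof (rule laplace_eqI[OF _ _ _ s])
  show sub: "subexp (\<lambda>t. t ^ k)"
    by (rule subexpI_poly[where C = 1 and k = k]) (auto intro!: continuous_intros power_mono)
  show "(\<lambda>s. of_real (fact k) / s ^ Suc k) holomorphic_on {s. Re s > 0}"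
    by (intro holomorphic_intros) auto
  fix x :: real assume x: "x > 0"
  have "ennreal (fact k) = (\<integral>\<^sup>+t. ennreal (t ^ k * exp (- t)) * indicator {0..} t \<partial>lborel)"
    using nn_intergal_power_times_exp_Ici[of k] by (simp add: mult.commute)
  also have "\<dots>
      = ennreal x * (\<integral>\<^sup>+t. ennreal ((0 + x * t) ^ k * exp (- (0 + x * t))) * indicator {0..}
      (0 + x * t) \<partial>lborel)"
    using x by (subst nn_integral_real_affine[where c = x and t = 0]) auto
  also have "\<dots>
      = ennreal x *
      (\<integral>\<^sup>+t. ennreal (x ^ k) * (ennreal (t ^ k * exp (- x * t)) * indicator {0..} t) \<partial>lborel)"
  proof -
    have "ennreal ((0 + x * t) ^ k * exp (- (0 + x * t))) * indicator {0..} (0 + x * t) =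
        ennreal (x ^ k) * (ennreal (t ^ k * exp (- x * t)) * indicator {0..} t)" for t
    proof -
      have "(0 + x * t) ^ k * exp (- (0 + x * t)) = x ^ k * (t ^ k * exp (- x * t))"
        by (simp add: power_mult_distrib)
      moreover have "indicator {0..} (0 + x * t) = (indicator {0..} t :: ennreal)"
        using x by (auto simp: indicator_def zero_le_mult_iff)
      ultimately show ?thesis using x by (simp add: ennreal_mult' mult.assoc)
    qed
    then show ?thesis by simp
  qed
  also have "\<dots>
      = ennreal (x ^ Suc k) * (\<integral>\<^sup>+t. ennreal (t ^ k * exp (- x * t)) * indicator {0..} t \<partial>lborel)"
    using x by (subst nn_integral_cmult) (auto simp: ennreal_mult mult.assoc)
  finally have *: "ennreal (fact k)
      = ennreal (x ^ Suc k) * (\<integral>\<^sup>+t. ennreal (t ^ k * exp (- x * t)) * indicator {0..} t \<partial>lborel)" .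
  have "ennreal (1 / x ^ Suc k) * ennreal (fact k)
      = ennreal (1 / x ^ Suc k) * ennreal (x ^ Suc k) *
      (\<integral>\<^sup>+t. ennreal (t ^ k * exp (- x * t)) * indicator {0..} t \<partial>lborel)"
    unfolding * by (simp add: mult.assoc)
  also have "ennreal (1 / x ^ Suc k) * ennreal (x ^ Suc k) = 1" using x by (simp flip: ennreal_mult)
  finally have "(\<integral>\<^sup>+t. ennreal (t ^ k * exp (- x * t)) * indicator {0..} t \<partial>lborel)
      = ennreal (1 / x ^ Suc k * fact k)"
    by (subst ennreal_mult) (use x in auto)
  from laplace_of_real_nonneg[OF sub _ x _ this] x
  show "laplace (\<lambda>t. t ^ k) (of_real x) = of_real (fact k) / of_real x ^ Suc k" by simp
qed

subsection \<open>The sum of the chords over the lattice\<close>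

definition disc :: "real \<Rightarrow> (int \<times> int) set" where
  "disc y = {z. nsq z \<le> y}"

lemma disc_subset: "disc y \<subseteq> {-\<lfloor>sqrt y\<rfloor>..\<lfloor>sqrt y\<rfloor>} \<times> {-\<lfloor>sqrt y\<rfloor>..\<lfloor>sqrt y\<rfloor>}"
proof
  fix z assume z: "z \<in> disc y"
  have mem: "a \<in> {-\<lfloor>sqrt y\<rfloor>..\<lfloor>sqrt y\<rfloor>}" if "(real_of_int a)\<^sup>2 \<le> y" for a :: int
  proof -
    have "\<bar>real_of_int a\<bar> \<le> sqrt y" using that real_sqrt_le_iff[of "(real_of_int a)\<^sup>2" y] by simp
    then have "\<bar>a\<bar> \<le> \<lfloor>sqrt y\<rfloor>" by (simp add: le_floor_iff)
    then show ?thesis by auto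
  qed
  have "(real_of_int (fst z))\<^sup>2 + (real_of_int (snd z))\<^sup>2 \<le> y"
    using z by (simp add: disc_def nsq_def)
  then have "(real_of_int (fst z))\<^sup>2 \<le> y" "(real_of_int (snd z))\<^sup>2 \<le> y"
    using zero_le_power2[of "real_of_int (fst z)"] zero_le_power2[of "real_of_int (snd z)"] by linarith+
  then show "z \<in> {-\<lfloor>sqrt y\<rfloor>..\<lfloor>sqrt y\<rfloor>} \<times> {-\<lfloor>sqrt y\<rfloor>..\<lfloor>sqrt y\<rfloor>}"
    using mem by (cases z) auto
qed

lemma finite_disc [simp]: "finite (disc y)"
  using disc_subset by (rule finite_subset) auto

lemma card_disc_le:
  assumes "y \<ge> 0"
  shows "real (card (disc y)) \<le> (2 * sqrt y + 1)\<^sup>2"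
proof -
  define k where "k = \<lfloor>sqrt y\<rfloor>"
  have k: "k \<ge> 0" "of_int k \<le> sqrt y" using assms by (auto simp: k_def)
  have "card (disc y) \<le> card ({-k..k} \<times> {-k..k})"
    using disc_subset[of y] unfolding k_def by (intro card_mono) auto
  also have "\<dots> = nat (2 * k + 1) * nat (2 * k + 1)" using k by (simp add: card_cartesian_product)
  finally have "real (card (disc y)) \<le> real (nat (2 * k + 1) * nat (2 * k + 1))"
    by (rule of_nat_mono)
  also have "\<dots> = (2 * of_int k + 1)\<^sup>2" using k by (simp add: power2_eq_square)
  also have "\<dots> \<le> (2 * sqrt y + 1)\<^sup>2" using k by (intro power_mono) auto
  finally show ?thesis .
qed

definition chord_sum :: "real \<Rightarrow> real" where
  "chord_sum t = (\<Sum>z\<in>disc (t\<^sup>2). chord z t)"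

lemma chord_eq_0: "t\<^sup>2 \<le> nsq z \<Longrightarrow> chord z t = 0"
  by (simp add: chord_def)

text \<open>Lattice points with \<open>nsq z \<ge> t^2\<close> contribute 0, so the index set can be
  held fixed while t varies. Continuity of \<open>chord_sum\<close> rests on this.\<close>

lemma chord_sum_eq:
  assumes "t\<^sup>2 \<le> y"
  shows "chord_sum t = (\<Sum>z\<in>disc y. chord z t)"
  unfolding chord_sum_def
  by (rule sum.mono_neutral_left[OF finite_disc])
      (use assms in \<open>auto simp: disc_def intro!: chord_eq_0\<close>)

lemma chord_sum_nonneg [simp]: "chord_sum t \<ge> 0"
  by (simp add: chord_sum_def sum_nonneg)

lemma nn_integral_chord: "(\<integral>\<^sup>+z. ennreal (chord z t) \<partial>count_space UNIV) = ennreal (chord_sum t)"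
proof -
  have "(\<integral>\<^sup>+z. ennreal (chord z t) \<partial>count_space UNIV) = (\<Sum>z\<in>disc (t\<^sup>2). ennreal (chord z t))"
    by (rule nn_integral_count_space'[OF finite_disc]) (auto simp: disc_def chord_eq_0)
  then show ?thesis by (simp add: chord_sum_def)
qed

lemma chord_sum_continuous: "continuous_on UNIV chord_sum"
proof (rule continuous_at_imp_continuous_on, rule ballI)
  fix t :: real
  define R where "R = \<bar>t\<bar> + 1"
  have "continuous_on {-R<..<R} (\<lambda>u. \<Sum>z\<in>disc (R\<^sup>2). chord z u)"
    by (intro continuous_on_sum chord_continuous)
  moreover have "chord_sum u = (\<Sum>z\<in>disc (R\<^sup>2). chord z u)" if "u \<in> {-R<..<R}" for u
    using that
      by (intro chord_sum_eq) (auto simp: abs_square_le_1 intro!: power2_le_iff_abs_le[THEN iffD2])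
  ultimately have "continuous_on {-R<..<R} chord_sum"
    by (blast intro: continuous_on_eq[OF _ sym])
  then show "isCont chord_sum t"
    by (rule continuous_on_interior) (auto simp: R_def)
qed

lemma chord_sum_le:
  assumes "t \<ge> 0"
  shows "chord_sum t \<le> 8 * (1 + t) ^ 3"
proof -
  have "chord_sum t \<le> (\<Sum>z\<in>disc (t\<^sup>2). 2 * t)"
    unfolding chord_sum_def
  proof (rule sum_mono)
    fix z
    have "sqrt (max 0 (t\<^sup>2 - nsq z)) \<le> sqrt (t\<^sup>2)" by (intro real_sqrt_le_mono) auto
    then show "chord z t \<le> 2 * t" using assms by (simp add: chord_def)
  qed
  also have "\<dots> = real (card (disc (t\<^sup>2))) * (2 * t)" by simp
  also have "\<dots> \<le> (2 * sqrt (t\<^sup>2) + 1)\<^sup>2 * (2 * t)" using assms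
    by (intro mult_right_mono card_disc_le) auto
  also have "\<dots> \<le> (2 * (1 + t))\<^sup>2 * (2 * (1 + t))"
    using assms by (intro mult_mono power_mono) auto
  also have "\<dots> = 8 * (1 + t) ^ 3" by (simp add: power2_eq_square power3_eq_cube algebra_simps)
  finally show ?thesis .
qed

lemma subexp_chord_sum: "subexp (\<lambda>t. 2 * t * chord_sum t)"
proof (rule subexpI_poly[where C = 16 and k = 4])
  show "continuous_on UNIV (\<lambda>t. 2 * t * chord_sum t)"
    by (intro continuous_intros chord_sum_continuous)
  fix t :: real assume t: "t \<ge> 0"
  have "2 * t * chord_sum t \<le> 2 * (1 + t) * (8 * (1 + t) ^ 3)"
    using t chord_sum_le[OF t] by (intro mult_mono) auto
  also have "\<dots> = 16 * (1 + t) ^ 4" by (simp add: power4_eq_xxxx power3_eq_cube algebra_simps)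
  finally show "\<bar>2 * t * chord_sum t\<bar> \<le> 16 * (1 + t) ^ 4" using t by simp
qed

abbreviation freq :: "int \<times> int \<Rightarrow> real" where
  "freq \<xi> \<equiv> 4 * pi\<^sup>2 * nsq \<xi>"

abbreviation chord_term :: "complex \<Rightarrow> int \<times> int \<Rightarrow> complex" where
  "chord_term s \<xi> \<equiv> of_real (64 * pi) * s / (s\<^sup>2 + of_real (freq \<xi>)) ^ 3"

lemma nn_integral_count_space_real_summable:
  fixes f :: "'a \<Rightarrow> real"
  assumes "\<And>x. f x \<ge> 0" "(\<integral>\<^sup>+x. ennreal (f x) \<partial>count_space UNIV) < \<infinity>"
  shows "f summable_on UNIV" "(\<integral>\<^sup>+x. ennreal (f x) \<partial>count_space UNIV) = ennreal (infsum f UNIV)"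
proof -
  have a: "Infinite_Set_Sum.abs_summable_on f UNIV"
    unfolding Infinite_Set_Sum.abs_summable_on_def
    using assms by (intro integrableI_bounded) auto
  then have "(\<lambda>x. norm (f x)) summable_on UNIV" unfolding abs_summable_equivalent[symmetric] .
  then show "f summable_on UNIV" using assms by simp
  show "(\<integral>\<^sup>+x. ennreal (f x) \<partial>count_space UNIV) = ennreal (infsum f UNIV)"
    using nn_integral_conv_infsetsum[OF a] assms infsetsum_infsum[OF a] by simp
qed

text \<open>The Laplace integral is finite by subexponential growth and equals the series over \<xi>
  in the extended sense, so the summability of the series comes together with its value.\<close>

lemma chord_laplace_real:
  assumes x: "x > 0"
  shows "(\<lambda>\<xi>. 64 * pi * x / (x\<^sup>2 + freq \<xi>) ^ 3) summable_on UNIV"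
    and "laplace (\<lambda>t. 2 * t * chord_sum t) (of_real x)
        = of_real (\<Sum>\<^sub>\<infinity>\<xi>. 64 * pi * x / (x\<^sup>2 + freq \<xi>) ^ 3)"
proof -
  let ?r = "\<lambda>\<xi>. 64 * pi * x / (x\<^sup>2 + freq \<xi>) ^ 3"
  have r: "?r \<xi> \<ge> 0" for \<xi> using x by auto
  have eq: "(\<integral>\<^sup>+t. ennreal (2 * t * chord_sum t * exp (- x * t)) * indicator {0..} t \<partial>lborel) =
     (\<integral>\<^sup>+\<xi>. ennreal (?r \<xi>) \<partial>count_space UNIV)"
    unfolding chord_sum_laplace_nn[OF x, symmetric] nn_integral_chord
  proof (rule nn_integral_cong)
    fix t :: real
    show "ennreal (2 * t * chord_sum t * exp (- x * t)) * indicator {0..} t =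
      ennreal (chord_sum t) * (ennreal (2 * t * exp (- x * t)) * indicator {0..} t)"
      by (auto simp: indicator_def mult_ac simp flip: ennreal_mult)
  qed
  obtain K where K: "K \<ge> 0" "\<And>t. t \<ge> 0 \<Longrightarrow> \<bar>2 * t * chord_sum t\<bar> \<le> K * exp (x / 2 * t)"
    using subexp_chord_sum x unfolding subexp_def by (meson half_gt_zero)
  have "(\<integral>\<^sup>+t. ennreal (2 * t * chord_sum t * exp (- x * t)) * indicator {0..} t \<partial>lborel) \<le>
    (\<integral>\<^sup>+t. ennreal (K * (indicator {0..} t *\<^sub>R exp (- (x / 2 * t)))) \<partial>lborel)"
  proof (rule nn_integral_mono)
    fix t :: real
    show "ennreal (2 * t * chord_sum t * exp (- x * t)) * indicator {0..} t
        \<le> ennreal (K * (indicator {0..} t *\<^sub>R exp (- (x / 2 * t))))"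
    proof (cases "t \<ge> 0")
      case True
      have "2 * t * chord_sum t * exp (- x * t) \<le> K * exp (x / 2 * t) * exp (- x * t)"
        using K(2)[OF True] by (intro mult_right_mono) auto
      also have "\<dots> = K * exp (- (x / 2 * t))" by (simp add: mult.assoc flip: exp_add)
      finally show ?thesis using True by (simp add: ennreal_leI)
    qed simp
  qed
  also have "\<dots> < \<infinity>"
  proof -
    have "has_bochner_integral lborel (\<lambda>t. K * (indicator {0..} t *\<^sub>R exp (- (x / 2 * t)))) (K
        * (exp (- (x / 2 * 0)) / (x / 2)))"
      using x by (intro has_bochner_integral_mult_right has_bochner_integral_exp_tail) auto
    then show ?thesis using K by (subst nn_integral_eq_integral) (auto simp: has_bochner_integral_iff)
  qed
  finally have fin: "(\<integral>\<^sup>+\<xi>. ennreal (?r \<xi>) \<partial>count_space UNIV) < \<infinity>" unfolding eq .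
  show "?r summable_on UNIV" by (rule nn_integral_count_space_real_summable(1)[OF r fin])
  have nn: "(\<integral>\<^sup>+t. ennreal (2 * t * chord_sum t * exp (- x * t)) * indicator {0..} t \<partial>lborel)
      = ennreal (infsum ?r UNIV)"
    unfolding eq by (rule nn_integral_count_space_real_summable(2)[OF r fin])
  show "laplace (\<lambda>t. 2 * t * chord_sum t) (of_real x) = of_real (infsum ?r UNIV)"
    by (rule laplace_of_real_nonneg[OF subexp_chord_sum _ x infsum_nonneg[OF r] nn]) simp
qed

text \<open>The case x = 1 of the preceding lemma, up to the factor \<open>64 * pi\<close>. It
  supplies the majorant for the complex series.\<close>

lemma freq_summable: "(\<lambda>\<xi>. 1 / (1 + freq \<xi>) ^ 3) summable_on UNIV"
proof -
  have "(\<lambda>\<xi>. 1 / (64 * pi) * (64 * pi * 1 / (1\<^sup>2 + freq \<xi>) ^ 3)) summable_on UNIV"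
    by (intro summable_on_cmult_right chord_laplace_real(1)) auto
  then show ?thesis by simp
qed

lemma chord_term_bound:
  assumes \<delta>: "\<delta> > 0" "Re s \<ge> \<delta>" and B: "cmod s \<le> B"
  shows "cmod (chord_term s \<xi>) \<le> 64 * pi * B / (min (\<delta>\<^sup>2 / (3 + 2 * B\<^sup>2)) (1 / 4)) ^ 3
      * (1 / (1 + freq \<xi>) ^ 3)"
proof -
  \<comment> \<open>Chosen so that \<open>c * (1 + W) \<le> |s^2 + W|\<close> for all
    \<open>W \<ge> 0\<close>. If \<open>W \<le> 2 * B^2 + 2\<close>, both factors
    \<open>s + i * sqrt W\<close> and \<open>s - i * sqrt W\<close> have real part at least
    \<delta>, while \<open>1 + W \<le> 3 + 2 * B^2\<close>. For larger W, subtracting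
    \<open>|s^2| \<le> B^2\<close> leaves at least a quarter of \<open>1 + W\<close>.\<close>
  define c where "c = min (\<delta>\<^sup>2 / (3 + 2 * B\<^sup>2)) (1 / 4)"
  have c: "c > 0" using \<delta> by (auto simp: c_def intro!: divide_pos_pos add_pos_nonneg)
  have B0: "B \<ge> 0" using B norm_ge_zero[of s] by linarith
  have "cmod (chord_term s \<xi>) \<le> 64 * pi * B / c ^ 3 * (1 / (1 + freq \<xi>) ^ 3)"
  proof -
    define W where "W = freq \<xi>"
    have W: "W \<ge> 0" by (simp add: W_def)
    have "c * (1 + W) \<le> cmod (s\<^sup>2 + of_real W)"
    proof (cases "W \<le> 2 * B\<^sup>2 + 2")
      case True
      have "s\<^sup>2 + of_real W = (s + \<i> * of_real (sqrt W)) * (s - \<i> * of_real (sqrt W))"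
        using W by (simp add: algebra_simps power2_eq_square flip: of_real_mult)
      then have "cmod (s\<^sup>2 + of_real W)
          = cmod (s + \<i> * of_real (sqrt W)) * cmod (s - \<i> * of_real (sqrt W))"
        by (simp add: norm_mult)
      moreover have "\<delta> \<le> cmod (s + \<i> * of_real (sqrt W))" "\<delta> \<le> cmod (s - \<i> * of_real (sqrt W))"
        using \<delta> complex_Re_le_cmod[of "s + \<i> * of_real (sqrt W)"] complex_Re_le_cmod[of "s
            - \<i> * of_real (sqrt W)"] by auto
      ultimately have "\<delta> * \<delta> \<le> cmod (s\<^sup>2 + of_real W)" using \<delta>
        by (metis mult_mono less_imp_le norm_ge_zero)
      moreover have "c * (1 + W) \<le> \<delta>\<^sup>2 / (3 + 2 * B\<^sup>2) * (3 + 2 * B\<^sup>2)"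
        using True W c by (intro mult_mono) (auto simp: c_def)
      moreover have "3 + 2 * B\<^sup>2 \<noteq> 0" using zero_le_power2[of B] by linarith
      ultimately show ?thesis by (simp add: power2_eq_square)
    next
      case False
      have "W = cmod (of_real W)" using W by simp
      also have "\<dots> \<le> cmod (s\<^sup>2 + of_real W) + cmod (s\<^sup>2)"
        by (metis add.commute norm_diff_ineq norm_triangle_sub add_diff_cancel_left'
          norm_triangle_ineq4 diff_add_cancel)
      also have "cmod (s\<^sup>2) \<le> B\<^sup>2" using B by (simp add: norm_power power_mono)
      finally have "W - B\<^sup>2 \<le> cmod (s\<^sup>2 + of_real W)" by simp
      moreover have "c \<le> 1 / 4" unfolding c_def by (rule min.cobounded2)
      then have "c * (1 + W) \<le> 1 / 4 * (1 + W)" using W by (intro mult_right_mono) auto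
      moreover have "1 + W \<le> 4 * (W - B\<^sup>2)" using False zero_le_power2[of B] by (smt (verit))
      ultimately show ?thesis by simp
    qed
    then have "(c * (1 + W)) ^ 3 \<le> cmod (s\<^sup>2 + of_real W) ^ 3" using c W by (intro power_mono) auto
    moreover have "(c * (1 + W)) ^ 3 > 0" using c W by (simp add: add_pos_nonneg)
    ultimately have "64 * pi * cmod s / cmod (s\<^sup>2 + of_real W) ^ 3 \<le> 64 * pi * B / (c * (1 + W)) ^ 3"
      using B B0 by (intro frac_le) auto
    then show ?thesis by (simp add: norm_mult norm_divide norm_power W_def power_mult_distrib)
  qed
  then show ?thesis unfolding c_def .
qed

lemma chord_term_summable:
  assumes "Re s > 0"
  shows "(\<lambda>\<xi>. norm (chord_term s \<xi>)) summable_on A"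
proof -
  have "(\<lambda>\<xi>. norm (chord_term s \<xi>)) summable_on UNIV"
    by (rule Infinite_Sum.abs_summable_on_comparison_test'[OF _
        chord_term_bound[OF assms order_refl order_refl]])
       (intro summable_on_cmult_right freq_summable)
  then show ?thesis using summable_on_subset_banach by blast
qed

lemma chord_term_infsum_holomorphic: "(\<lambda>s. \<Sum>\<^sub>\<infinity>\<xi>. chord_term s \<xi>) holomorphic_on {s. Re s > 0}"
proof -
  have "\<exists>f'. ((\<lambda>s. \<Sum>\<^sub>\<infinity>\<xi>. chord_term s \<xi>) has_field_derivative f') (at s0)" if "Re s0 > 0" for s0
  proof -
    define \<delta> where "\<delta> = Re s0 / 2"
    define B where "B = cmod s0 + \<delta>"
    have \<delta>: "\<delta> > 0" using that by (simp add: \<delta>_def)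
    have R: "Re s \<ge> \<delta>" if "s \<in> cball s0 \<delta>" for s
    proof -
      have "\<bar>Re (s0 - s)\<bar> \<le> \<delta>" using that abs_Re_le_cmod[of "s0 - s"] by (simp add: dist_norm)
      then have "Re s0 - Re s \<le> \<delta>" by simp
      then show ?thesis by (simp add: \<delta>_def)
    qed
    have Bb: "cmod s \<le> B" if "s \<in> cball s0 \<delta>" for s
      using that norm_triangle_ineq2[of s s0] by (simp add: B_def dist_norm norm_minus_commute)
    have ul: "uniform_limit (cball s0 \<delta>) (\<lambda>X s. \<Sum>\<xi>\<in>X. chord_term s \<xi>) (\<lambda>s. \<Sum>\<^sub>\<infinity>\<xi>. chord_term s \<xi>)
        (finite_subsets_at_top UNIV)"
    proof (rule Weierstrass_m_test_general)
      show "cmod (chord_term s \<xi>) \<le> 64 * pi * B / (min (\<delta>\<^sup>2 / (3 + 2 * B\<^sup>2)) (1 / 4)) ^ 3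
          * (1 / (1 + freq \<xi>) ^ 3)"
        if "s \<in> cball s0 \<delta>" for s \<xi>
        by (rule chord_term_bound[OF \<delta> R[OF that] Bb[OF that]])
    qed (intro summable_on_cmult_right freq_summable)
    have nz: "s\<^sup>2 + of_real (freq \<xi>) \<noteq> 0" if "s \<in> cball s0 \<delta>" for s \<xi>
    proof
      assume "s\<^sup>2 + of_real (freq \<xi>) = 0"
      then have "Re (s\<^sup>2 + of_real (freq \<xi>)) = 0" "Im (s\<^sup>2 + of_real (freq \<xi>)) = 0" by auto
      then have "Im s = 0" "(Re s)\<^sup>2 + freq \<xi> = (Im s)\<^sup>2" using R[OF that] \<delta>
        by (auto simp: Re_power2 Im_power2)
      then have "(Re s)\<^sup>2 + freq \<xi> = 0" by simp
      moreover have "(Re s)\<^sup>2 > 0" using R[OF that] \<delta> by (intro zero_less_power) linarith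
      ultimately show False using nsq_nonneg[of \<xi>] by (smt (verit) mult_nonneg_nonneg zero_le_power2)
    qed
    have hol: "(\<lambda>s. \<Sum>\<xi>\<in>X. chord_term s \<xi>) holomorphic_on cball s0 \<delta>" for X
      by (intro holomorphic_intros) (use nz in auto)
    obtain "(\<lambda>s. \<Sum>\<^sub>\<infinity>\<xi>. chord_term s \<xi>) holomorphic_on ball s0 \<delta>"
    proof (rule holomorphic_uniform_limit[OF _ ul])
      show "\<forall>\<^sub>F X in finite_subsets_at_top UNIV. continuous_on (cball s0 \<delta>) (\<lambda>s. \<Sum>\<xi>\<in>X. chord_term s \<xi>) \<and>
          (\<lambda>s. \<Sum>\<xi>\<in>X. chord_term s \<xi>) holomorphic_on ball s0 \<delta>"
        using hol holomorphic_on_imp_continuous_on holomorphic_on_subset[OF hol ball_subset_cball]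
          by (intro always_eventually) blast
    qed auto
    then show ?thesis using \<delta> by (meson centre_in_ball holomorphic_on_open open_ball)
  qed
  then show ?thesis by (simp add: holomorphic_on_open open_halfspace_Re_gt)
qed

lemma chord_laplace:
  assumes "Re s > 0"
  shows "laplace (\<lambda>t. 2 * t * chord_sum t) s = (\<Sum>\<^sub>\<infinity>\<xi>. chord_term s \<xi>)"
proof (rule laplace_eqI[OF subexp_chord_sum chord_term_infsum_holomorphic _ assms])
  fix x :: real assume x: "x > 0"
  have "complex_of_real (\<Sum>\<^sub>\<infinity>\<xi>. 64 * pi * x / (x\<^sup>2 + freq \<xi>) ^ 3)
      = (\<Sum>\<^sub>\<infinity>\<xi>. of_real (64 * pi * x / (x\<^sup>2 + freq \<xi>) ^ 3))"
    by (rule infsumI[symmetric], rule has_sum_of_real, rule has_sum_infsum,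
        rule chord_laplace_real(1)[OF x])
  then show "laplace (\<lambda>t. 2 * t * chord_sum t) (of_real x) = (\<Sum>\<^sub>\<infinity>\<xi>. chord_term (of_real x) \<xi>)"
    using chord_laplace_real(2)[OF x] by simp
qed

subsection \<open>The Fourier--Bohr coefficients of the error term\<close>

definition chord_error :: "real \<Rightarrow> real" where
  "chord_error t = chord_sum t - 4 / 3 * pi * t ^ 3"

lemma nsq_eq_0_iff [simp]: "nsq \<xi> = 0 \<longleftrightarrow> \<xi> = (0, 0)"
  by (cases \<xi>) (auto simp: nsq_def sum_power2_eq_zero_iff)

lemma subexp_chord_error: "subexp (\<lambda>t. 2 * t * chord_error t)"
proof -
  have "subexp (\<lambda>t. t ^ 4)"
    by (rule subexpI_poly[where C = 1 and k = 4]) (auto intro!: continuous_intros power_mono)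
  from subexp_add[OF subexp_chord_sum subexp_cmult[OF this, of "- (8 / 3 * pi)"]]
  have "subexp (\<lambda>t. 2 * t * chord_sum t + - (8 / 3 * pi) * t ^ 4)" .
  moreover have "2 * t * chord_sum t + - (8 / 3 * pi) * t ^ 4 = 2 * t * chord_error t" for t
    by (simp add: chord_error_def algebra_simps eval_nat_numeral)
  ultimately show ?thesis by simp
qed

abbreviation error_laplace :: "complex \<Rightarrow> complex" where
  "error_laplace \<equiv> laplace (\<lambda>t. 2 * t * chord_error t)"

text \<open>The volume of the ball is exactly the zero frequency: \<open>8/3 * pi * t^4\<close> has
  transform \<open>8/3 * pi * 4! / s^5 = 64 * pi / s^5\<close>, which is
  \<open>chord_term s (0, 0)\<close>.\<close>

lemma chord_error_laplace:
  assumes s: "Re s > 0"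
  shows "error_laplace s = (\<Sum>\<^sub>\<infinity>\<xi>\<in>UNIV - {(0, 0)}. chord_term s \<xi>)"
proof -
  have p4: "subexp (\<lambda>t. t ^ 4)"
    by (rule subexpI_poly[where C = 1 and k = 4]) (auto intro!: continuous_intros power_mono)
  have "2 * t * chord_sum t + - (8 / 3 * pi) * t ^ 4 = 2 * t * chord_error t" for t
    by (simp add: chord_error_def algebra_simps eval_nat_numeral)
  then have "error_laplace s = laplace (\<lambda>t. 2 * t * chord_sum t) s
      + laplace (\<lambda>t. - (8 / 3 * pi) * t ^ 4) s"
    using laplace_add[OF subexp_chord_sum subexp_cmult[OF p4] s, of "- (8 / 3 * pi)"] by simp
  also have "laplace (\<lambda>t. - (8 / 3 * pi) * t ^ 4) s = - (of_real (64 * pi) / s ^ 5)"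
    unfolding laplace_cmult laplace_power[OF s] by (simp add: fact_numeral eval_nat_numeral)
  also have "laplace (\<lambda>t. 2 * t * chord_sum t) s
      = chord_term s (0, 0) + (\<Sum>\<^sub>\<infinity>\<xi>\<in>UNIV - {(0, 0)}. chord_term s \<xi>)"
  proof -
    have sm: "chord_term s summable_on A" for A
      by (rule abs_summable_summable[OF chord_term_summable[OF s]])
    have "(\<Sum>\<^sub>\<infinity>\<xi>. chord_term s \<xi>) = (\<Sum>\<^sub>\<infinity>\<xi>\<in>{(0,0)} \<union> (UNIV - {(0, 0)}). chord_term s \<xi>)" by simp
    also have "\<dots> = (\<Sum>\<^sub>\<infinity>\<xi>\<in>{(0,0)}. chord_term s \<xi>) + (\<Sum>\<^sub>\<infinity>\<xi>\<in>UNIV - {(0, 0)}. chord_term s \<xi>)"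
      by (rule infsum_Un_disjoint) (use sm in auto)
    finally show ?thesis using chord_laplace[OF s] by simp
  qed
  also have "chord_term s (0, 0) = of_real (64 * pi) / s ^ 5"
    using s by (auto simp: nsq_def field_simps eval_nat_numeral)
  finally show ?thesis by simp
qed

text \<open>At \<open>s = \<sigma> - i * l\<close> a term with \<open>freq \<xi> = l^2\<close> has
  denominator \<open>(\<sigma> * (\<sigma> - 2 * i * l))^3\<close>, so the factor
  \<open>\<sigma>^3\<close> keeps the finitely many \<xi> in G. The finitely many other terms near l
  stay bounded, and the far tail is bounded uniformly in \<sigma>.\<close>

lemma bohr_coefficient:
  fixes l :: real
  defines "G \<equiv> {\<xi>. \<xi> \<noteq> (0, 0) \<and> freq \<xi> = l\<^sup>2}"
  shows "((\<lambda>\<sigma>. of_real (\<sigma> ^ 3) * error_laplace (of_real \<sigma> - \<i> * of_real l)) \<longlongrightarrow>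
            of_real (- (2 / pi) * (\<Sum>\<xi>\<in>G. 1 / nsq \<xi>))) (at_right 0)"
proof -
  define s where "s \<sigma> = of_real \<sigma> - \<i> * of_real l" for \<sigma> :: real
  \<comment> \<open>Beyond the cut \<open>freq \<xi> \<le> 2 * l^2 + 2\<close> the frequency term is
    more than twice \<open>1 + l^2\<close>, which bounds \<open>|s^2|\<close> for
    \<open>\<sigma> < 1\<close>. The denominators of the tail therefore stay away from 0 as \<sigma>
    tends to 0.\<close>
  define y where "y = (2 * l\<^sup>2 + 2) / (4 * pi\<^sup>2)"
  define F where "F = disc y - {(0, 0)} - G"
  define T where "T = UNIV - disc y"
  have freq_disc: "\<xi> \<in> disc y \<longleftrightarrow> freq \<xi> \<le> 2 * l\<^sup>2 + 2" for \<xi>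
    by (simp add: disc_def y_def pos_le_divide_eq mult_ac)
  have Gsub: "G \<subseteq> disc y" unfolding G_def by (auto simp: freq_disc)
  have fin: "finite G" "finite F" using finite_subset[OF Gsub] by (auto simp: F_def)
  have "(0, 0) \<in> disc y" unfolding freq_disc by (simp add: nsq_def add_nonneg_pos)
  then have part: "UNIV - {(0, 0)} = (G \<union> F) \<union> T" "G \<inter> F = {}" "(G \<union> F) \<inter> T = {}"
    using Gsub by (auto simp: F_def T_def G_def)
  have split: "error_laplace (s \<sigma>) =
      (\<Sum>\<xi>\<in>G. chord_term (s \<sigma>) \<xi>) + (\<Sum>\<xi>\<in>F. chord_term (s \<sigma>) \<xi>) +
          (\<Sum>\<^sub>\<infinity>\<xi>\<in>T. chord_term (s \<sigma>) \<xi>)" if "\<sigma> > 0" for \<sigma>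
  proof -
    have R: "Re (s \<sigma>) > 0" using that by (simp add: s_def)
    have sm: "chord_term (s \<sigma>) summable_on A" for A
      by (rule abs_summable_summable[OF chord_term_summable[OF R]])
    have "error_laplace (s \<sigma>) = (\<Sum>\<^sub>\<infinity>\<xi>\<in>(G \<union> F) \<union> T. chord_term (s \<sigma>) \<xi>)"
      unfolding chord_error_laplace[OF R] part ..
    also have "\<dots> = (\<Sum>\<^sub>\<infinity>\<xi>\<in>G \<union> F. chord_term (s \<sigma>) \<xi>) + (\<Sum>\<^sub>\<infinity>\<xi>\<in>T. chord_term (s \<sigma>) \<xi>)"
      by (rule infsum_Un_disjoint) (use sm part in auto)
    also have "(\<Sum>\<^sub>\<infinity>\<xi>\<in>G \<union> F. chord_term (s \<sigma>) \<xi>) = (\<Sum>\<xi>\<in>G. chord_term (s \<sigma>) \<xi>)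
        + (\<Sum>\<xi>\<in>F. chord_term (s \<sigma>) \<xi>)"
      using fin part by (simp add: infsum_finite sum.union_disjoint)
    finally show ?thesis .
  qed
  have lim_s: "(s \<longlongrightarrow> - \<i> * of_real l) (at_right 0)"
  proof -
    have "((\<lambda>\<sigma>. complex_of_real \<sigma> - \<i> * of_real l) \<longlongrightarrow> complex_of_real 0 - \<i> * of_real l) (at_right 0)"
      by (intro tendsto_intros)
    then show ?thesis by (simp add: s_def[abs_def])
  qed
  have lim3: "((\<lambda>\<sigma>. complex_of_real (\<sigma> ^ 3)) \<longlongrightarrow> 0) (at_right 0)"
  proof -
    have "((\<lambda>\<sigma>. complex_of_real (\<sigma> ^ 3)) \<longlongrightarrow> complex_of_real (0 ^ 3)) (at_right 0)"
      by (intro tendsto_intros)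
    then show ?thesis by simp
  qed
  have limG: "((\<lambda>\<sigma>. of_real (\<sigma> ^ 3) * chord_term (s \<sigma>) \<xi>)
      \<longlongrightarrow> of_real (- (2 / pi) * (1 / nsq \<xi>))) (at_right 0)"
    if \<xi>: "\<xi> \<in> G" for \<xi>
  proof -
    have W: "freq \<xi> = l\<^sup>2" "nsq \<xi> \<noteq> 0" using \<xi> unfolding G_def by auto
    then have l0: "l \<noteq> 0" by auto
    have "((\<lambda>\<sigma>. of_real (64 * pi) * s \<sigma> / (of_real \<sigma> - 2 * \<i> * of_real l) ^ 3) \<longlongrightarrow>
        of_real (64 * pi) * (- \<i> * of_real l) / (of_real 0 - 2 * \<i> * of_real l) ^ 3) (at_right 0)"
      using l0 by (intro tendsto_intros lim_s) auto
    \<comment> \<open>Here \<open>(- 2 * i * l)^3 = 8 * i * l^3\<close>; afterwards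
      \<open>l^2 = 4 * pi^2 * nsq \<xi>\<close> is inserted.\<close>
    also have "of_real (64 * pi) * (- \<i> * of_real l) / (of_real 0 - 2 * \<i> * of_real l) ^ 3
        = complex_of_real (- (8 * pi / l\<^sup>2))"
      using l0 by (simp add: field_simps eval_nat_numeral)
    also have "- (8 * pi / l\<^sup>2) = - (2 / pi) * (1 / nsq \<xi>)"
      unfolding W(1)[symmetric] by (simp add: power2_eq_square)
    finally show ?thesis
    proof (rule Lim_transform_eventually)
      have "\<forall>\<^sub>F \<sigma> in at_right 0. \<sigma> > (0::real)" by (rule eventually_at_right_less)
      then show "\<forall>\<^sub>F \<sigma> in at_right 0. of_real (64 * pi) * s \<sigma> / (of_real \<sigma> - 2 * \<i> * of_real l) ^ 3
          = of_real (\<sigma> ^ 3) * chord_term (s \<sigma>) \<xi>"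
      proof eventually_elim
        case (elim \<sigma>)
        have "(s \<sigma>)\<^sup>2 + of_real (freq \<xi>) = of_real \<sigma> * (of_real \<sigma> - 2 * \<i> * of_real l)"
          unfolding W(1) by (simp add: s_def power2_eq_square algebra_simps)
        then show ?case using elim by (simp add: power_mult_distrib)
      qed
    qed
  qed
  have limF: "((\<lambda>\<sigma>. of_real (\<sigma> ^ 3) * chord_term (s \<sigma>) \<xi>) \<longlongrightarrow> 0) (at_right 0)" if \<xi>: "\<xi> \<in> F" for \<xi>
  proof -
    have "freq \<xi> - l\<^sup>2 \<noteq> 0" using \<xi> by (auto simp: F_def G_def)
    moreover have "(- \<i> * of_real l)\<^sup>2 + of_real (freq \<xi>) = complex_of_real (freq \<xi> - l\<^sup>2)"
      by (simp add: power_mult_distrib)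
    ultimately have "(- \<i> * of_real l)\<^sup>2 + of_real (freq \<xi>) \<noteq> (0::complex)" by (metis of_real_eq_0_iff)
    then have "((\<lambda>\<sigma>. of_real (\<sigma> ^ 3) * chord_term (s \<sigma>) \<xi>)
        \<longlongrightarrow> 0 * chord_term (- \<i> * of_real l) \<xi>) (at_right 0)"
      by (intro tendsto_intros lim_s lim3) auto
    then show ?thesis by simp
  qed
  have limT: "((\<lambda>\<sigma>. of_real (\<sigma> ^ 3) * (\<Sum>\<^sub>\<infinity>\<xi>\<in>T. chord_term (s \<sigma>) \<xi>)) \<longlongrightarrow> 0) (at_right 0)"
  proof -
    define C where "C = 64 * pi * (1 + \<bar>l\<bar>) * 64"
    define M where "M = (\<Sum>\<^sub>\<infinity>\<xi>\<in>T. C * (1 / (1 + freq \<xi>) ^ 3))"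
    have Msum: "(\<lambda>\<xi>. C * (1 / (1 + freq \<xi>) ^ 3)) summable_on T"
      using freq_summable summable_on_subset_banach by (intro summable_on_cmult_right) blast
    have bd: "cmod (\<Sum>\<^sub>\<infinity>\<xi>\<in>T. chord_term (s \<sigma>) \<xi>) \<le> M" if \<sigma>: "0 < \<sigma>" "\<sigma> < 1" for \<sigma>
    proof -
      have R: "Re (s \<sigma>) > 0" using \<sigma> by (simp add: s_def)
      have cs: "cmod (s \<sigma>) \<le> 1 + \<bar>l\<bar>" using norm_triangle_ineq4[of "of_real \<sigma>" "\<i> * of_real l"] \<sigma>
        by (simp add: s_def norm_mult)
      have cs2: "cmod ((s \<sigma>)\<^sup>2) \<le> 1 + l\<^sup>2"
      proof -
        have "cmod ((s \<sigma>)\<^sup>2) = \<sigma>\<^sup>2 + l\<^sup>2" by (simp add: norm_power cmod_power2 s_def)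
        moreover have "\<sigma>\<^sup>2 \<le> 1" using \<sigma> by (simp add: power_le_one)
        ultimately show ?thesis by simp
      qed
      have b: "cmod (chord_term (s \<sigma>) \<xi>) \<le> C * (1 / (1 + freq \<xi>) ^ 3)" if "\<xi> \<in> T" for \<xi>
      proof -
        define W where "W = freq \<xi>"
        have W: "W > 2 * l\<^sup>2 + 2" using that by (simp add: T_def freq_disc W_def)
        then have W2: "W > 2" using zero_le_power2[of l] by linarith
        have "W = cmod (of_real W)" using W2 by simp
        also have "\<dots> \<le> cmod ((s \<sigma>)\<^sup>2 + of_real W) + cmod ((s \<sigma>)\<^sup>2)"
          using norm_triangle_ineq4[of "(s \<sigma>)\<^sup>2 + of_real W" "(s \<sigma>)\<^sup>2"] by simp
        finally have "1 + W \<le> 4 * cmod ((s \<sigma>)\<^sup>2 + of_real W)" using cs2 W W2 by linarith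
        then have "(1 + W) / 4 \<le> cmod ((s \<sigma>)\<^sup>2 + of_real W)" by simp
        then have "((1 + W) / 4) ^ 3 \<le> cmod ((s \<sigma>)\<^sup>2 + of_real W) ^ 3" using W2
          by (intro power_mono) auto
        moreover have "((1 + W) / 4) ^ 3 > 0" using W2 by simp
        ultimately have "64 * pi * cmod (s \<sigma>) / cmod ((s \<sigma>)\<^sup>2 + of_real W) ^ 3
            \<le> 64 * pi * (1 + \<bar>l\<bar>) / ((1 + W) / 4) ^ 3"
          using cs by (intro frac_le) auto
        also have "\<dots> = C * (1 / (1 + W) ^ 3)" by (simp add: C_def power_divide)
        finally show ?thesis by (simp add: norm_mult norm_divide norm_power W_def)
      qed
      have "cmod (\<Sum>\<^sub>\<infinity>\<xi>\<in>T. chord_term (s \<sigma>) \<xi>) \<le> (\<Sum>\<^sub>\<infinity>\<xi>\<in>T. cmod (chord_term (s \<sigma>) \<xi>))"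
        by (rule norm_infsum_bound[OF chord_term_summable[OF R]])
      also have "\<dots> \<le> M" unfolding M_def
        by (rule infsum_mono[OF chord_term_summable[OF R] Msum b])
      finally show ?thesis .
    qed
    show ?thesis
    proof (rule Lim_null_comparison)
      have "\<forall>\<^sub>F \<sigma> in at_right 0. \<sigma> \<in> {0<..<1::real}" by (rule eventually_at_right_real) simp
      then show "\<forall>\<^sub>F \<sigma> in at_right 0. norm (of_real (\<sigma> ^ 3) * (\<Sum>\<^sub>\<infinity>\<xi>\<in>T. chord_term (s \<sigma>) \<xi>)) \<le> \<sigma> ^ 3 * M"
      proof eventually_elim
        case (elim \<sigma>)
        then show ?case using bd[of \<sigma>] unfolding norm_mult
            by (intro mult_mono) (auto simp: norm_power)
      qed
      have "((\<lambda>\<sigma>. \<sigma> ^ 3 * M) \<longlongrightarrow> 0 ^ 3 * M) (at_right (0::real))" by (intro tendsto_intros)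
      then show "((\<lambda>\<sigma>. \<sigma> ^ 3 * M) \<longlongrightarrow> 0) (at_right (0::real))" by simp
    qed
  qed
  have "((\<lambda>\<sigma>. (\<Sum>\<xi>\<in>G. of_real (\<sigma> ^ 3) * chord_term (s \<sigma>) \<xi>)
      + (\<Sum>\<xi>\<in>F. of_real (\<sigma> ^ 3) * chord_term (s \<sigma>) \<xi>) +
      of_real (\<sigma> ^ 3) * (\<Sum>\<^sub>\<infinity>\<xi>\<in>T. chord_term (s \<sigma>) \<xi>)) \<longlongrightarrow> (\<Sum>\<xi>\<in>G. of_real (- (2 / pi) * (1 / nsq \<xi>))) +
          (\<Sum>\<xi>\<in>F. 0) + 0) (at_right 0)"
    by (intro tendsto_add tendsto_sum limG limF limT)
  also have "(\<Sum>\<xi>\<in>G. complex_of_real (- (2 / pi) * (1 / nsq \<xi>))) + (\<Sum>\<xi>\<in>F. 0) + 0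
      = of_real (- (2 / pi) * (\<Sum>\<xi>\<in>G. 1 / nsq \<xi>))"
    by (simp add: sum_distrib_left)
  finally show ?thesis
  proof (rule Lim_transform_eventually)
    have "\<forall>\<^sub>F \<sigma> in at_right 0. \<sigma> > (0::real)" by (rule eventually_at_right_less)
    then show "\<forall>\<^sub>F \<sigma> in at_right 0. (\<Sum>\<xi>\<in>G. of_real (\<sigma> ^ 3) * chord_term (s \<sigma>) \<xi>)
        + (\<Sum>\<xi>\<in>F. of_real (\<sigma> ^ 3) * chord_term (s \<sigma>) \<xi>) +
      of_real (\<sigma> ^ 3) * (\<Sum>\<^sub>\<infinity>\<xi>\<in>T. chord_term (s \<sigma>) \<xi>) =
      of_real (\<sigma> ^ 3) * error_laplace (of_real \<sigma> - \<i> * of_real l)"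
    proof eventually_elim
      case (elim \<sigma>)
      show ?case unfolding s_def[symmetric] split[OF elim]
        by (simp only: sum_distrib_left distrib_left)
    qed
  qed
qed

subsection \<open>Nonnegative trigonometric polynomials as test functions\<close>

text \<open>Evaluation at \<open>\<sigma> - i * l\<close> multiplies the integrand by
  \<open>cis (l * t)\<close>, so the combination is the integral of
  \<open>h t * exp (- \<sigma> * t) * T t\<close>, a product of nonnegative factors.\<close>

lemma laplace_trig_poly_nonneg:
  assumes h: "subexp h" "\<And>t. t \<ge> 0 \<Longrightarrow> h t \<ge> 0" and I: "finite I"
    and T: "\<And>t. (\<Sum>g\<in>I. C g * cis (l g * t)) = of_real (T t)" "\<And>t. T t \<ge> 0" and \<sigma>: "\<sigma> > 0"
  shows "Re (\<Sum>g\<in>I. C g * laplace h (of_real \<sigma> - \<i> * of_real (l g))) \<ge> 0"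
proof -
  let ?k = "\<lambda>g t. indicator {0..} t *\<^sub>R (of_real (h t)
      * exp (- ((of_real \<sigma> - \<i> * of_real (l g)) * of_real t))) :: complex"
  have int: "integrable lborel (?k g)" for g
    by (rule laplace_integrable[OF h(1)]) (use \<sigma> in simp)
  have "(\<Sum>g\<in>I. C g * laplace h (of_real \<sigma> - \<i> * of_real (l g))) = (\<integral>t. (\<Sum>g\<in>I. C g * ?k g t) \<partial>lborel)"
  proof -
    have "(\<Sum>g\<in>I. C g * laplace h (of_real \<sigma> - \<i> * of_real (l g))) = (\<Sum>g\<in>I. \<integral>t. C g * ?k g t \<partial>lborel)"
      unfolding laplace_def by (simp only: integral_mult_right_zero)
    also have "\<dots> = (\<integral>t. (\<Sum>g\<in>I. C g * ?k g t) \<partial>lborel)"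
      by (intro Bochner_Integration.integral_sum[symmetric] integrable_mult_right int)
    finally show ?thesis .
  qed
  also have "(\<lambda>t. \<Sum>g\<in>I. C g * ?k g t)
      = (\<lambda>t. complex_of_real (indicator {0..} t * (h t * exp (- (\<sigma> * t)) * T t)))"
  proof
    fix t
    have "exp (- ((of_real \<sigma> - \<i> * of_real (l g)) * of_real t))
        = of_real (exp (- (\<sigma> * t))) * cis (l g * t)" for g
    proof -
      have "- ((of_real \<sigma> - \<i> * of_real (l g)) * of_real t)
          = of_real (- (\<sigma> * t)) + \<i> * of_real (l g * t)"
        by (simp add: algebra_simps)
      then show ?thesis by (simp only: exp_add cis_conv_exp exp_of_real)
    qed
    then have "(\<Sum>g\<in>I. C g * ?k g t) = of_real (indicator {0..} t * (h t * exp (- (\<sigma> * t))))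
        * (\<Sum>g\<in>I. C g * cis (l g * t))"
      by (simp add: sum_distrib_left scaleR_conv_of_real mult_ac)
    then show "(\<Sum>g\<in>I. C g * ?k g t)
        = complex_of_real (indicator {0..} t * (h t * exp (- (\<sigma> * t)) * T t))"
      unfolding T(1) by simp
  qed
  also have "(\<integral>t. complex_of_real (indicator {0..} t * (h t * exp (- (\<sigma> * t)) * T t)) \<partial>lborel) =
      complex_of_real (\<integral>t. indicator {0..} t * (h t * exp (- (\<sigma> * t)) * T t) \<partial>lborel)"
    by (rule integral_complex_of_real)
  finally have eq: "(\<Sum>g\<in>I. C g * laplace h (of_real \<sigma> - \<i> * of_real (l g)))
      = complex_of_real (\<integral>t. indicator {0..} t * (h t * exp (- (\<sigma> * t)) * T t) \<partial>lborel)" .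
  have "(\<integral>t. indicator {0..} t * (h t * exp (- (\<sigma> * t)) * T t) \<partial>lborel) \<ge> 0"
    by (rule Bochner_Integration.integral_nonneg) (use h T in \<open>auto simp: indicator_def\<close>)
  then show ?thesis unfolding eq by simp
qed

definition shell_sum :: "real \<Rightarrow> real" where
  "shell_sum l = (\<Sum>\<xi>\<in>{\<xi>. \<xi> \<noteq> (0, 0) \<and> freq \<xi> = l\<^sup>2}. 1 / nsq \<xi>)"

text \<open>The assumed bound makes \<open>2 * t * (C0 * (1 + t) - \<kappa> * chord_error t)\<close>
  nonnegative. After multiplication by \<open>\<sigma>^3\<close> the limit sees only triple poles:
  that of \<open>2 * C0 * t^2\<close> at frequency 0, which gives \<open>4 * C0\<close>, and those
  of the error at the lattice frequencies. The linear part has a double pole and disappears.\<close>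

lemma trig_poly_test:
  fixes \<kappa> :: real
  assumes bound: "\<And>t. t \<ge> 0 \<Longrightarrow> \<kappa> * chord_error t \<le> C0 * (1 + t)" and I: "finite I"
    and T: "\<And>t. (\<Sum>g\<in>I. C g * cis (l g * t)) = of_real (T t)" "\<And>t. T t \<ge> 0"
  shows "0 \<le> Re (\<Sum>g\<in>I. C g * of_real ((if l g = 0 then 4 * C0 else 0)
      + \<kappa> * (2 / pi) * shell_sum (l g)))"
proof -
  define h where "h t = (2 * C0) * t ^ 1 + ((2 * C0) * t ^ 2 + - \<kappa> * (2 * t * chord_error t))" for t
  have pow: "subexp (\<lambda>t. t ^ k)" for k
    by (rule subexpI_poly[where C = 1 and k = k]) (auto intro!: continuous_intros power_mono)
  have sub: "subexp h" unfolding h_def[abs_def]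
    by (intro subexp_add subexp_cmult pow subexp_chord_error)
  have h0: "h t \<ge> 0" if "t \<ge> 0" for t
  proof -
    have "h t = 2 * t * (C0 * (1 + t) - \<kappa> * chord_error t)"
      by (simp add: h_def algebra_simps power2_eq_square)
    then show ?thesis using bound[OF that] that by simp
  qed
  have lap: "laplace h s
      = (2 * of_real C0) / s ^ 2 + ((4 * of_real C0) / s ^ 3 - of_real \<kappa> * error_laplace s)"
    if "Re s > 0" for s
  proof -
    have "laplace h s = laplace (\<lambda>t. (2 * C0) * t ^ 1) s
        + (laplace (\<lambda>t. (2 * C0) * t ^ 2) s + laplace (\<lambda>t. - \<kappa> * (2 * t * chord_error t)) s)"
      unfolding h_def[abs_def]
      by (subst laplace_add[OF _ _ that], (intro subexp_add subexp_cmult pow subexp_chord_error)+)+ simp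
    then show ?thesis unfolding laplace_cmult laplace_power[OF that] by (simp add: eval_nat_numeral)
  qed
  have lim: "((\<lambda>\<sigma>. of_real (\<sigma> ^ 3) * laplace h (of_real \<sigma> - \<i> * of_real x)) \<longlongrightarrow>
      of_real ((if x = 0 then 4 * C0 else 0) + \<kappa> * (2 / pi) * shell_sum x)) (at_right 0)" for x
  proof -
    define s where "s \<sigma> = of_real \<sigma> - \<i> * of_real x" for \<sigma> :: real
    have main: "((\<lambda>\<sigma>. of_real (\<sigma> ^ 3) * ((2 * of_real C0) / s \<sigma> ^ 2 + (4 * of_real C0) / s \<sigma> ^ 3)) \<longlongrightarrow>
       complex_of_real (if x = 0 then 4 * C0 else 0)) (at_right 0)"
    proof (cases "x = 0")
      case True
      have "((\<lambda>\<sigma>. complex_of_real (2 * C0 * \<sigma> + 4 * C0))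
          \<longlongrightarrow> complex_of_real (2 * C0 * 0 + 4 * C0)) (at_right 0)"
        by (intro tendsto_intros)
      then have "((\<lambda>\<sigma>. complex_of_real (2 * C0 * \<sigma> + 4 * C0))
          \<longlongrightarrow> complex_of_real (if x = 0 then 4 * C0 else 0)) (at_right 0)"
        using True by simp
      then show ?thesis
      proof (rule Lim_transform_eventually)
        have "\<forall>\<^sub>F \<sigma> in at_right 0. \<sigma> > (0::real)" by (rule eventually_at_right_less)
        then show "\<forall>\<^sub>F \<sigma> in at_right 0. complex_of_real (2 * C0 * \<sigma> + 4 * C0)
            = of_real (\<sigma> ^ 3) * ((2 * of_real C0) / s \<sigma> ^ 2 + (4 * of_real C0) / s \<sigma> ^ 3)"
          by eventually_elim (use True in \<open>simp add: s_def field_simps eval_nat_numeral\<close>)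
      qed
    next
      case False
      have lim_s: "(s \<longlongrightarrow> complex_of_real 0 - \<i> * of_real x) (at_right 0)"
        unfolding s_def[abs_def] by (intro tendsto_intros)
      have "((\<lambda>\<sigma>. of_real (\<sigma> ^ 3) * ((2 * of_real C0) / s \<sigma> ^ 2 + (4 * of_real C0) / s \<sigma> ^ 3)) \<longlongrightarrow>
       of_real (0 ^ 3) * ((2 * of_real C0) / (complex_of_real 0 - \<i> * of_real x) ^ 2 +
           (4 * of_real C0) / (complex_of_real 0 - \<i> * of_real x) ^ 3)) (at_right 0)"
        using False by (intro tendsto_intros lim_s) auto
      then show ?thesis using False by simp
    qed
    have L: "((\<lambda>\<sigma>. of_real (\<sigma> ^ 3) * ((2 * of_real C0) / s \<sigma> ^ 2 + (4 * of_real C0) / s \<sigma> ^ 3) -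
        of_real \<kappa> * (of_real (\<sigma> ^ 3) * error_laplace (s \<sigma>))) \<longlongrightarrow>
        complex_of_real (if x = 0 then 4 * C0 else 0) - of_real \<kappa> * of_real (- (2 / pi) * shell_sum x))
            (at_right 0)"
      using bohr_coefficient[of x] unfolding s_def shell_sum_def
      by (intro tendsto_diff tendsto_mult_left main[unfolded s_def])
    have E: "complex_of_real (if x = 0 then 4 * C0 else 0)
        - of_real \<kappa> * of_real (- (2 / pi) * shell_sum x) =
        of_real ((if x = 0 then 4 * C0 else 0) + \<kappa> * (2 / pi) * shell_sum x)" by simp
    from L[unfolded E] show ?thesis
    proof (rule Lim_transform_eventually)
      have "\<forall>\<^sub>F \<sigma> in at_right 0. \<sigma> > (0::real)" by (rule eventually_at_right_less)
      then show "\<forall>\<^sub>F \<sigma> in at_right 0. of_real (\<sigma> ^ 3) * ((2 * of_real C0) / s \<sigma> ^ 2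
          + (4 * of_real C0) / s \<sigma> ^ 3) -
        of_real \<kappa> * (of_real (\<sigma> ^ 3) * error_laplace (s \<sigma>)) = of_real (\<sigma> ^ 3) * laplace h
            (of_real \<sigma> - \<i> * of_real x)"
      proof eventually_elim
        case (elim \<sigma>)
        have "Re (s \<sigma>) > 0" using elim by (simp add: s_def)
        show ?case unfolding s_def[symmetric] lap[OF \<open>Re (s \<sigma>) > 0\<close>] by (simp add: algebra_simps)
      qed
    qed
  qed
  have "((\<lambda>\<sigma>. Re (\<Sum>g\<in>I. C g * (of_real (\<sigma> ^ 3) * laplace h (of_real \<sigma> - \<i> * of_real (l g))))) \<longlongrightarrow>
     Re (\<Sum>g\<in>I. C g * of_real ((if l g = 0 then 4 * C0 else 0) + \<kappa> * (2 / pi) * shell_sum (l g))))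
         (at_right 0)"
    by (intro tendsto_intros lim)
  then show ?thesis
  proof (rule tendsto_lowerbound)
    have "\<forall>\<^sub>F \<sigma> in at_right 0. \<sigma> > (0::real)" by (rule eventually_at_right_less)
    then show "\<forall>\<^sub>F \<sigma> in at_right 0. 0
        \<le> Re (\<Sum>g\<in>I. C g * (of_real (\<sigma> ^ 3) * laplace h (of_real \<sigma> - \<i> * of_real (l g))))"
    proof eventually_elim
      case (elim \<sigma>)
      have eq: "(\<Sum>g\<in>I. C g * (of_real (\<sigma> ^ 3) * laplace h (of_real \<sigma> - \<i> * of_real (l g)))) =
         of_real (\<sigma> ^ 3) * (\<Sum>g\<in>I. C g * laplace h (of_real \<sigma> - \<i> * of_real (l g)))"
        by (simp add: sum_distrib_left mult_ac)
      have re: "Re (complex_of_real r * z) = r * Re z" for r z by simp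
      show ?case unfolding eq re using laplace_trig_poly_nonneg[OF sub h0 I T elim] elim
        by (intro mult_nonneg_nonneg) auto
    qed
  qed simp
qed

subsection \<open>Products of Fejer kernels\<close>

definition nat_nsq :: "int \<times> int \<Rightarrow> nat" where
  "nat_nsq \<xi> = nat ((fst \<xi>)\<^sup>2 + (snd \<xi>)\<^sup>2)"

lemma real_nat_nsq: "real (nat_nsq \<xi>) = nsq \<xi>"
  by (simp add: nat_nsq_def nsq_def)

lemma nat_nsq_eq_0_iff [simp]: "nat_nsq \<xi> = 0 \<longleftrightarrow> \<xi> = (0, 0)"
  using real_nat_nsq[of \<xi>] by (metis nsq_eq_0_iff of_nat_eq_0_iff)

abbreviation sq_root :: "int \<times> int \<Rightarrow> nat" where
  "sq_root \<xi> \<equiv> square_part (nat_nsq \<xi>)"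

abbreviation sf_part :: "int \<times> int \<Rightarrow> nat" where
  "sf_part \<xi> \<equiv> squarefree_part (nat_nsq \<xi>)"

lemma sqrt_nsq: "sqrt (nsq \<xi>) = real (sq_root \<xi>) * sqrt (real (sf_part \<xi>))"
proof -
  have "nsq \<xi> = real (sf_part \<xi> * sq_root \<xi> ^ 2)"
    using real_nat_nsq[of \<xi>] squarefree_decompose[of "nat_nsq \<xi>"] by metis
  then show ?thesis by (simp add: real_sqrt_mult)
qed

text \<open>The difference of the two sides is an integer relation among roots of distinct
  squarefree numbers, hence trivial. Consequently a frequency \<open>s * sqrt q0\<close> can arise
  from one factor of the kernel product alone.\<close>

lemma squarefree_combination_eq:
  fixes g :: "nat \<Rightarrow> int" and s :: int
  assumes Q: "finite Q" "\<And>q. q \<in> Q \<Longrightarrow> squarefree q" and q0: "squarefree q0" and s: "s \<noteq> 0"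
    and eq: "(\<Sum>q\<in>Q. of_int (g q) * sqrt (real q)) = of_int s * sqrt (real q0)"
  shows "q0 \<in> Q" "g q0 = s" "\<And>q. q \<in> Q \<Longrightarrow> q \<noteq> q0 \<Longrightarrow> g q = 0"
proof -
  define d where "d q = (if q \<in> Q then g q else 0) - (if q = q0 then s else 0)" for q
  have "(\<Sum>q\<in>insert q0 Q. of_int (d q) * sqrt (real q)) =
     (\<Sum>q\<in>insert q0 Q. (if q \<in> Q then of_int (g q) * sqrt (real q) else 0)) -
         (\<Sum>q\<in>insert q0 Q. (if q = q0 then of_int s * sqrt (real q) else 0))"
    unfolding sum_subtractf[symmetric] by (intro sum.cong refl) (auto simp: d_def left_diff_distrib)
  also have "(\<Sum>q\<in>insert q0 Q. (if q \<in> Q then of_int (g q) * sqrt (real q) else 0))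
      = (\<Sum>q\<in>Q. of_int (g q) * sqrt (real q))"
    using Q by (intro sum.mono_neutral_cong_right) auto
  also have "(\<Sum>q\<in>insert q0 Q. (if q = q0 then of_int s * sqrt (real q) else 0))
      = of_int s * sqrt (real q0)"
    using Q by (subst sum.delta) auto
  finally have "(\<Sum>q\<in>insert q0 Q. of_int (d q) * sqrt (real q)) = 0" using eq by simp
  then have d0: "d q = 0" if "q \<in> insert q0 Q" for q
    using sqrt_squarefree_independent[of "insert q0 Q" d q] Q q0 that by auto
  show 1: "q0 \<in> Q" using d0[of q0] s by (auto simp: d_def split: if_splits)
  show "g q0 = s" using d0[of q0] 1 by (simp add: d_def)
  show "g q = 0" if "q \<in> Q" "q \<noteq> q0" for q using d0[of q] that by (simp add: d_def)
qed

abbreviation fejer_weight :: "nat \<Rightarrow> int \<times> int \<Rightarrow> real" where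
  "fejer_weight N \<xi> \<equiv> (1 - real (sq_root \<xi>) / real N) / nsq \<xi>"

text \<open>Expanding the product gives one exponential for each choice g of an index per factor. By
  independence, frequency 0 arises only from the zero choice, with coefficient 1. For \<xi> in X the
  frequencies plus and minus \<open>2 * pi * |\<xi>|\<close> come from exactly two g, supported at
  \<open>sf_part \<xi>\<close> with values plus and minus \<open>sq_root \<xi>\<close>; this doubles
  the factor \<open>2 / pi\<close>. The phase \<open>pi * \<epsilon>\<close> sits in every factor,
  so the pair contributes the cosine of \<open>pi * \<epsilon> * sq_root \<xi>\<close>.\<close>

lemma fejer_product_test:
  fixes \<kappa> :: real and \<epsilon> :: int and Q :: "nat set"
  assumes bound: "\<And>t. t \<ge> 0 \<Longrightarrow> \<kappa> * chord_error t \<le> C0 * (1 + t)"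
    and Q: "finite Q" "\<And>q. q \<in> Q \<Longrightarrow> squarefree q" and N: "N > 0" and \<epsilon>: "\<epsilon> = 0 \<or> \<epsilon> = 1"
  defines "X \<equiv> {\<xi>. \<xi> \<noteq> (0, 0) \<and> sf_part \<xi> \<in> Q \<and> sq_root \<xi> < N}"
  shows "finite X"
    and "0 \<le> 4 * C0 + \<kappa> * (4 / pi) * (\<Sum>\<xi>\<in>X. cos (pi * of_int \<epsilon> * real (sq_root \<xi>)) * fejer_weight N \<xi>)"
proof -
  define J where "J = {-int N<..<int N}"
  define I where "I = PiE Q (\<lambda>_. J)"
  define c where "c j = 1 - \<bar>of_int j\<bar> / real N" for j :: int
  define \<phi> where "\<phi> = pi * of_int \<epsilon>"
  define \<mu> where "\<mu> g = (\<Sum>q\<in>Q. of_int (g q) * sqrt (real q))" for g :: "nat \<Rightarrow> int"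
  define l where "l g = 2 * pi * \<mu> g" for g
  define C where "C g = (\<Prod>q\<in>Q. of_real (c (g q)) * cis (of_int (g q) * \<phi>))" for g :: "nat \<Rightarrow> int"
  define T where "T t = (\<Prod>q\<in>Q. fejer N (2 * pi * sqrt (real q) * t + \<phi>))" for t
  have finI: "finite I" unfolding I_def J_def using Q by (intro finite_PiE) auto
  have T1: "(\<Sum>g\<in>I. C g * cis (l g * t)) = of_real (T t)" for t
  proof -
    have "complex_of_real (T t)
        = (\<Prod>q\<in>Q. \<Sum>j\<in>J. of_real (c j) * cis (of_int j * (2 * pi * sqrt (real q) * t + \<phi>)))"
      unfolding T_def of_real_prod c_def J_def fejer_complex ..
    also have "\<dots>
        = (\<Sum>g\<in>I. \<Prod>q\<in>Q. of_real (c (g q)) * cis (of_int (g q) * (2 * pi * sqrt (real q) * t + \<phi>)))"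
      unfolding I_def by (rule prod_sum_PiE) (use Q in \<open>auto simp: J_def\<close>)
    also have "\<dots> = (\<Sum>g\<in>I. C g * cis (l g * t))"
    proof (rule sum.cong[OF refl])
      fix g
      have "cis (l g * t) = (\<Prod>q\<in>Q. cis (of_int (g q) * (2 * pi * sqrt (real q) * t)))"
      proof -
        have "l g * t = (\<Sum>q\<in>Q. of_int (g q) * (2 * pi * sqrt (real q) * t))"
          by (simp add: l_def \<mu>_def sum_distrib_left sum_distrib_right mult_ac)
        then show ?thesis by (simp only: cis_conv_exp of_real_sum sum_distrib_left exp_sum[OF Q(1)])
      qed
      then show "(\<Prod>q\<in>Q. of_real (c (g q)) * cis (of_int (g q) * (2 * pi * sqrt (real q) * t + \<phi>)))
          = C g * cis (l g * t)"
        unfolding C_def by (simp add: prod.distrib[symmetric] distrib_left cis_mult[symmetric] mult_ac)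
    qed
    finally show ?thesis by simp
  qed
  have T2: "T t \<ge> 0" for t unfolding T_def by (intro prod_nonneg) (simp add: fejer_nonneg)
  note test = trig_poly_test[OF bound finI T1 T2]
  \<comment> \<open>Members of \<open>PiE\<close> take the value \<open>undefined\<close> outside Q,
    hence \<open>restrict\<close> here and in \<open>single\<close>.\<close>
  define zero where "zero = restrict (\<lambda>q::nat. 0::int) Q"
  have zero_I: "zero \<in> I" using N by (auto simp: zero_def I_def J_def)
  have C_zero: "C zero = 1" by (simp add: C_def zero_def c_def)
  have l_zero: "l g = 0 \<longleftrightarrow> g = zero" if "g \<in> I" for g
  proof
    assume "l g = 0"
    then have "\<mu> g = 0" by (simp add: l_def)
    then have "g q = 0" if "q \<in> Q" for q
      using sqrt_squarefree_independent[OF Q _ that, of g] by (simp add: \<mu>_def)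
    then show "g = zero" using that unfolding I_def zero_def
      by (auto simp: PiE_def extensional_def fun_eq_iff)
  next
    assume "g = zero"
    then show "l g = 0" by (simp add: l_def \<mu>_def zero_def)
  qed
  have sum1: "(\<Sum>g\<in>I. C g * of_real (if l g = 0 then 4 * C0 else 0)) = of_real (4 * C0)"
  proof -
    have "(\<Sum>g\<in>I. C g * of_real (if l g = 0 then 4 * C0 else 0))
        = (\<Sum>g\<in>I. if g = zero then C g * of_real (4 * C0) else 0)"
      using l_zero by (intro sum.cong) auto
    then show ?thesis using finI zero_I by (simp add: C_zero)
  qed
  define single where "single q0 v = restrict (\<lambda>q::nat. if q = q0 then v else 0 :: int) Q" for q0 v
  have C_single: "C (single q0 v) = of_real (c v) * cis (of_int v * \<phi>)" if "q0 \<in> Q" for q0 v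
  proof -
    have "C (single q0 v) = (\<Prod>q\<in>Q. if q = q0 then of_real (c v) * cis (of_int v * \<phi>) else 1)"
      unfolding C_def by (intro prod.cong refl) (auto simp: single_def c_def)
    then show ?thesis using Q that by simp
  qed
  have mu_single: "\<mu> (single q0 v) = of_int v * sqrt (real q0)" if "q0 \<in> Q" for q0 v
  proof -
    have "\<mu> (single q0 v) = (\<Sum>q\<in>Q. if q = q0 then of_int v * sqrt (real q) else 0)"
      unfolding \<mu>_def by (intro sum.cong refl) (auto simp: single_def)
    then show ?thesis using Q that by simp
  qed
  have sets: "{g \<in> I. freq \<xi> = (l g)\<^sup>2} = (if \<xi> \<in> X then {single q s, single q (- s)} else {})"
    if \<xi>: "\<xi> \<noteq> (0, 0)" and q: "q = sf_part \<xi>" and s: "s = int (sq_root \<xi>)" for \<xi> q s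
  proof -
    have nz: "nat_nsq \<xi> \<noteq> 0" using \<xi> by simp
    have s0: "s > 0" using s nz by (metis gr0I of_nat_0_less_iff square_part_0_iff)
    have iff: "freq \<xi> = (l g)\<^sup>2 \<longleftrightarrow> \<mu> g = of_int s * sqrt (real q) \<or> \<mu> g = of_int (- s) * sqrt (real q)"
        for g
    proof -
      have "freq \<xi> = (l g)\<^sup>2 \<longleftrightarrow> (sqrt (nsq \<xi>))\<^sup>2 = (\<mu> g)\<^sup>2"
        by (simp add: l_def power_mult_distrib)
      also have "\<dots> \<longleftrightarrow> \<mu> g = sqrt (nsq \<xi>) \<or> \<mu> g = - sqrt (nsq \<xi>)"
        by (metis power2_eq_iff)
      finally show ?thesis unfolding sqrt_nsq q s by simp
    qed
    have sf: "squarefree q" unfolding q by simp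
    have unique: "q \<in> Q \<and> g = single q v \<and> \<bar>v\<bar> < int N"
        if g: "g \<in> I" "\<mu> g = of_int v * sqrt (real q)" "v \<noteq> 0" for g v
    proof -
      note c = squarefree_combination_eq[OF Q sf g(3) g(2)[unfolded \<mu>_def]]
      have "g = single q v"
        using g(1) c unfolding I_def single_def by (auto simp: PiE_def extensional_def fun_eq_iff)
      moreover have "g q \<in> J" using g(1) c(1) by (auto simp: I_def)
      ultimately show ?thesis using c by (auto simp: J_def)
    qed
    show ?thesis
    proof (cases "\<xi> \<in> X")
      case True
      then have qQ: "q \<in> Q" and sN: "s < int N" using q s by (auto simp: X_def)
      have "single q v \<in> I" if "\<bar>v\<bar> < int N" for v
        using that N by (auto simp: single_def I_def J_def)
      then have "single q s \<in> I" "single q (- s) \<in> I" using s0 sN by auto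
      note mem = this
      have "{g \<in> I. freq \<xi> = (l g)\<^sup>2} = {single q s, single q (- s)}"
      proof (intro set_eqI iffI)
        fix g assume g: "g \<in> {g \<in> I. freq \<xi> = (l g)\<^sup>2}"
        then have "\<mu> g = of_int s * sqrt (real q) \<or> \<mu> g = of_int (- s) * sqrt (real q)" using iff
          by simp
        then show "g \<in> {single q s, single q (- s)}"
          using unique[of g s] unique[of g "- s"] g s0 by auto
      next
        fix g assume "g \<in> {single q s, single q (- s)}"
        then consider "g = single q s" | "g = single q (- s)" by blast
        then show "g \<in> {g \<in> I. freq \<xi> = (l g)\<^sup>2}"
          by cases (use mem iff mu_single[OF qQ] in blast)+
      qed
      then show ?thesis using True by simp
    next
      case False
      have "\<not> (g \<in> I \<and> freq \<xi> = (l g)\<^sup>2)" for g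
      proof
        assume g: "g \<in> I \<and> freq \<xi> = (l g)\<^sup>2"
        then have "q \<in> Q \<and> \<bar>s\<bar> < int N" using unique[of g s] unique[of g "- s"] s0 unfolding iff by auto
        then show False using False \<xi> s0 unfolding X_def q s by auto
      qed
      then show ?thesis using False by auto
    qed
  qed
  \<comment> \<open>All lattice points met by some frequency of the product. This finite set
    contains X and allows the sums over g and \<xi> to be exchanged.\<close>
  define Y where "Y = (\<Union>g\<in>I. {\<xi>. \<xi> \<noteq> (0, 0) \<and> freq \<xi> = (l g)\<^sup>2})"
  have finY: "finite Y"
  proof -
    have "{\<xi>. \<xi> \<noteq> (0, 0) \<and> freq \<xi> = (l g)\<^sup>2} \<subseteq> disc ((l g)\<^sup>2 / (4 * pi\<^sup>2))" for g
      by (auto simp: disc_def field_simps)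
    then have "finite {\<xi>. \<xi> \<noteq> (0, 0) \<and> freq \<xi> = (l g)\<^sup>2}" for g using finite_subset finite_disc by blast
    then show ?thesis unfolding Y_def using finI by blast
  qed
  have XY: "X \<subseteq> Y"
  proof
    fix \<xi> assume \<xi>: "\<xi> \<in> X"
    then have "\<xi> \<noteq> (0, 0)" by (simp add: X_def)
    from sets[OF this refl refl] \<xi> show "\<xi> \<in> Y" unfolding Y_def using \<open>\<xi> \<noteq> (0, 0)\<close> by auto
  qed
  show finX: "finite X" using XY finY finite_subset by blast
  have inner: "(\<Sum>g\<in>{g\<in>I. freq \<xi> = (l g)\<^sup>2}. C g) =
     (if \<xi> \<in> X then of_real (2 * (cos (\<phi> * real (sq_root \<xi>)) * (1 - real (sq_root \<xi>) / real N))) else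
         0)"
    if "\<xi> \<in> Y" for \<xi>
  proof -
    have \<xi>: "\<xi> \<noteq> (0, 0)" using that by (auto simp: Y_def)
    define q where "q = sf_part \<xi>"
    define s where "s = int (sq_root \<xi>)"
    have nz: "nat_nsq \<xi> \<noteq> 0" using \<xi> by simp
    have s0: "s > 0" using s_def nz by (metis gr0I of_nat_0_less_iff square_part_0_iff)
    show ?thesis
    proof (cases "\<xi> \<in> X")
      case True
      have qQ: "q \<in> Q" using True by (simp add: X_def q_def)
      have "single q s q \<noteq> single q (- s) q" using qQ s0 by (simp add: single_def)
      then have ne: "single q s \<noteq> single q (- s)" by metis
      have "(\<Sum>g\<in>{g\<in>I. freq \<xi> = (l g)\<^sup>2}. C g) = C (single q s) + C (single q (- s))"
        using sets[OF \<xi> q_def s_def] True ne by simp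
      also have "\<dots> = of_real (c s) * (cis (of_int s * \<phi>) + cis (- (of_int s * \<phi>)))"
        unfolding C_single[OF qQ] by (simp add: c_def algebra_simps)
      also have "cis (of_int s * \<phi>) + cis (- (of_int s * \<phi>)) = of_real (2 * cos (\<phi> * of_int s))"
        by (simp add: complex_eq_iff mult.commute)
      finally show ?thesis using True s0 by (simp add: c_def s_def mult_ac)
    next
      case False
      then have emp: "{g \<in> I. freq \<xi> = (l g)\<^sup>2} = {}" using sets[OF \<xi> q_def s_def]
        by (simp only: if_False)
      show ?thesis unfolding emp using False by simp
    qed
  qed
  have "(\<Sum>g\<in>I. C g * of_real (shell_sum (l g)))
      = (\<Sum>g\<in>I. \<Sum>\<xi>\<in>Y. if freq \<xi> = (l g)\<^sup>2 then C g * of_real (1 / nsq \<xi>) else 0)"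
  proof (rule sum.cong[OF refl])
    fix g assume g: "g \<in> I"
    have eqY: "{\<xi>. \<xi> \<noteq> (0, 0) \<and> freq \<xi> = (l g)\<^sup>2} = {\<xi> \<in> Y. freq \<xi> = (l g)\<^sup>2}"
      using g by (auto simp: Y_def)
    have "shell_sum (l g) = (\<Sum>\<xi>\<in>Y. if freq \<xi> = (l g)\<^sup>2 then 1 / nsq \<xi> else 0)"
      unfolding shell_sum_def eqY by (rule sum.inter_filter[OF finY])
    then show "C g * of_real (shell_sum (l g))
        = (\<Sum>\<xi>\<in>Y. if freq \<xi> = (l g)\<^sup>2 then C g * of_real (1 / nsq \<xi>) else 0)"
      by (simp add: sum_distrib_left if_distrib cong: if_cong)
  qed
  also have "\<dots> = (\<Sum>\<xi>\<in>Y. of_real (1 / nsq \<xi>) * (\<Sum>g\<in>{g\<in>I. freq \<xi> = (l g)\<^sup>2}. C g))"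
    unfolding sum_distrib_left sum.inter_filter[OF finI]
      by (subst sum.swap) (auto intro!: sum.cong simp: mult.commute)
  also have "\<dots>
      = (\<Sum>\<xi>\<in>Y. if \<xi> \<in> X then of_real (2 * (cos (\<phi> * real (sq_root \<xi>)) * fejer_weight N \<xi>)) else 0)"
    by (intro sum.cong refl) (simp add: inner)
  also have "\<dots> = of_real (2 * (\<Sum>\<xi>\<in>X. cos (\<phi> * real (sq_root \<xi>)) * fejer_weight N \<xi>))"
    using finY XY by (simp add: sum.If_cases Int_absorb1 sum_distrib_left)
  finally have sum2: "(\<Sum>g\<in>I. C g * of_real (shell_sum (l g))) =
    of_real (2 * (\<Sum>\<xi>\<in>X. cos (\<phi> * real (sq_root \<xi>)) * fejer_weight N \<xi>))" .
  have "(\<Sum>g\<in>I. C g * of_real ((if l g = 0 then 4 * C0 else 0) + \<kappa> * (2 / pi) * shell_sum (l g))) =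
     (\<Sum>g\<in>I. C g * of_real (if l g = 0 then 4 * C0 else 0)) + of_real (\<kappa> * (2 / pi)) *
         (\<Sum>g\<in>I. C g * of_real (shell_sum (l g)))"
    unfolding sum_distrib_left sum.distrib[symmetric] by (intro sum.cong refl) (simp add: algebra_simps)
  also have "\<dots>
      = of_real (4 * C0 + \<kappa> * (4 / pi) * (\<Sum>\<xi>\<in>X. cos (\<phi> * real (sq_root \<xi>)) * fejer_weight N \<xi>))"
    unfolding sum1 sum2 by simp
  finally show "0
      \<le> 4 * C0 + \<kappa> * (4 / pi) * (\<Sum>\<xi>\<in>X. cos (pi * of_int \<epsilon> * real (sq_root \<xi>)) * fejer_weight N \<xi>)"
    using test unfolding \<phi>_def by simp
qed

subsection \<open>Unboundedness of the error term\<close>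

text \<open>Compared prime by prime: multiplicities in the square part are halved with rounding
  down, and \<open>2 * multiplicity p k\<close> passes through the rounding.\<close>

lemma square_part_square_mult:
  fixes k n :: nat
  assumes "k \<noteq> 0" "n \<noteq> 0"
  shows "square_part (k\<^sup>2 * n) = k * square_part n" "squarefree_part (k\<^sup>2 * n) = squarefree_part n"
proof -
  have "normalize (square_part (k\<^sup>2 * n)) = normalize (k * square_part n)"
  proof (rule multiplicity_eq_imp_eq)
    fix p :: nat assume p: "prime p"
    have "multiplicity p (square_part (k\<^sup>2 * n)) = (2 * multiplicity p k + multiplicity p n) div 2"
      using p assms by (simp add: prime_multiplicity_square_part prime_elem_multiplicity_mult_distrib
          prime_elem_multiplicity_power_distrib)
    also have "\<dots> = multiplicity p k + multiplicity p (square_part n)"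
      using p assms by (simp add: prime_multiplicity_square_part)
    also have "\<dots> = multiplicity p (k * square_part n)"
      using p assms by (simp add: prime_elem_multiplicity_mult_distrib)
    finally show "multiplicity p (square_part (k\<^sup>2 * n)) = multiplicity p (k * square_part n)" .
  qed (use assms in auto)
  then show 1: "square_part (k\<^sup>2 * n) = k * square_part n" by simp
  have "k\<^sup>2 * n = squarefree_part (k\<^sup>2 * n) * (k * square_part n)\<^sup>2"
    using squarefree_decompose[of "k\<^sup>2 * n"] unfolding 1 .
  then have "k\<^sup>2 * n = k\<^sup>2 * (squarefree_part (k\<^sup>2 * n) * (square_part n)\<^sup>2)"
    by (simp add: power_mult_distrib mult_ac)
  then have "n = squarefree_part (k\<^sup>2 * n) * (square_part n)\<^sup>2" using assms by simp
  then have "squarefree_part (k\<^sup>2 * n) * (square_part n)\<^sup>2 = squarefree_part n * (square_part n)\<^sup>2"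
    using squarefree_decompose[of n] by metis
  then show "squarefree_part (k\<^sup>2 * n) = squarefree_part n" using assms by simp
qed

lemma sum_squares_mod_4:
  fixes a b :: int
  assumes "4 dvd a\<^sup>2 + b\<^sup>2"
  shows "even a" "even b"
proof -
  have sq: "x\<^sup>2 mod 4 = (if even x then 0 else 1)" for x :: int
  proof (cases "even x")
    case True
    then obtain y where "x = 2 * y" by blast
    then show ?thesis by (simp add: power_mult_distrib)
  next
    case False
    then obtain y where "x = 2 * y + 1" by (blast elim: oddE)
    then have "x\<^sup>2 = 1 + 4 * (y\<^sup>2 + y)" by (simp add: power2_eq_square algebra_simps)
    then have "x\<^sup>2 mod 4 = 1" by (simp only: mod_mult_self2) simp
    then show ?thesis using False by simp
  qed
  have "(a\<^sup>2 mod 4 + b\<^sup>2 mod 4) mod 4 = 0" using assms by (simp add: mod_add_eq dvd_eq_mod_eq_0)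
  then show "even a" "even b" unfolding sq by (auto split: if_splits)
qed

text \<open>An even square part makes \<open>nat_nsq \<xi>\<close> divisible by 4; squares being 0
  or 1 modulo 4, both coordinates are even.\<close>

lemma nat_nsq_halve:
  assumes "even (sq_root \<xi>)"
  shows "\<xi> = (2 * (fst \<xi> div 2), 2 * (snd \<xi> div 2))"
    and "nat_nsq \<xi> = 4 * nat_nsq (fst \<xi> div 2, snd \<xi> div 2)"
proof -
  have "2\<^sup>2 dvd (sq_root \<xi>)\<^sup>2" using assms by (rule dvd_power_same)
  also have "\<dots> dvd nat_nsq \<xi>" by simp
  finally have "4 dvd nat_nsq \<xi>" by simp
  then have "int 4 dvd int (nat_nsq \<xi>)" by (simp only: of_nat_dvd_iff)
  then have "4 dvd (fst \<xi>)\<^sup>2 + (snd \<xi>)\<^sup>2" by (simp add: nat_nsq_def)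
  then have ev: "even (fst \<xi>)" "even (snd \<xi>)" using sum_squares_mod_4 by blast+
  then show eq: "\<xi> = (2 * (fst \<xi> div 2), 2 * (snd \<xi> div 2))" by (simp add: prod_eq_iff)
  have "real (nat_nsq \<xi>) = real (4 * nat_nsq (fst \<xi> div 2, snd \<xi> div 2))"
    by (subst eq) (simp add: real_nat_nsq nsq_def power_mult_distrib)
  then show "nat_nsq \<xi> = 4 * nat_nsq (fst \<xi> div 2, snd \<xi> div 2)" by (simp only: of_nat_eq_iff)
qed

text \<open>For \<open>\<kappa> = -1\<close> the kernels centred at 0 bound the sum over all of X by
  \<open>pi * C0\<close>. For \<open>\<kappa> = 1\<close> the centre 1/2 bounds the odd sum minus
  the even sum by \<open>pi * C0\<close>. Halving coordinates maps the even points injectively into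
  X and at least quadruples the weight, so four times the even sum is at most the full sum. Thus the
  even sum is at most a third of the odd one, whence the constant 3/2.\<close>

lemma odd_shell_bound:
  fixes \<kappa> :: real and Q :: "nat set"
  assumes bound: "\<And>t. t \<ge> 0 \<Longrightarrow> \<kappa> * chord_error t \<le> C0 * (1 + t)" and \<kappa>: "\<kappa> = 1 \<or> \<kappa> = -1"
    and Q: "finite Q" "\<And>q. q \<in> Q \<Longrightarrow> squarefree q" and N: "N > 0"
  defines "X \<equiv> {\<xi>. \<xi> \<noteq> (0, 0) \<and> sf_part \<xi> \<in> Q \<and> sq_root \<xi> < N}"
  shows "finite X"
    and "(\<Sum>\<xi>\<in>{\<xi>\<in>X. odd (sq_root \<xi>)}. fejer_weight N \<xi>) \<le> 3 / 2 * pi * C0"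
proof -
  define s where "s \<xi> = sq_root \<xi>" for \<xi>
  define a where "a \<xi> = (1 - real (s \<xi>) / real N) / nsq \<xi>" for \<xi>
  define Od where "Od = {\<xi>\<in>X. odd (s \<xi>)}"
  define Ev where "Ev = {\<xi>\<in>X. even (s \<xi>)}"
  show finX: "finite X" unfolding X_def by (rule fejer_product_test(1)[OF bound Q N, of 0]) auto
  have fin: "finite Od" "finite Ev" "X = Od \<union> Ev" "Od \<inter> Ev = {}"
    using finX by (auto simp: Od_def Ev_def)
  have a0: "a \<xi> \<ge> 0" if "\<xi> \<in> X" for \<xi> using that by (auto simp: a_def X_def s_def)
  have split: "(\<Sum>\<xi>\<in>X. f \<xi>) = (\<Sum>\<xi>\<in>Od. f \<xi>) + (\<Sum>\<xi>\<in>Ev. f \<xi>)" for f :: "int \<times> int \<Rightarrow> real"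
    unfolding fin(3) by (rule sum.union_disjoint) (use fin in auto)
  have od0: "(\<Sum>\<xi>\<in>Od. a \<xi>) \<ge> 0" and ev0: "(\<Sum>\<xi>\<in>Ev. a \<xi>) \<ge> 0"
    by (intro sum_nonneg, use a0 in \<open>auto simp: Od_def Ev_def\<close>)+
  show "(\<Sum>\<xi>\<in>{\<xi>\<in>X. odd (sq_root \<xi>)}. fejer_weight N \<xi>) \<le> 3 / 2 * pi * C0"
    using \<kappa>
  proof
    assume k: "\<kappa> = -1"
    have "0 \<le> 4 * C0 + \<kappa> * (4 / pi) * (\<Sum>\<xi>\<in>X. cos (pi * of_int 0 * real (sq_root \<xi>)) * fejer_weight N \<xi>)"
      unfolding X_def by (rule fejer_product_test(2)[OF bound Q N]) auto
    then have "0 \<le> 4 * C0 - 4 / pi * ((\<Sum>\<xi>\<in>Od. a \<xi>) + (\<Sum>\<xi>\<in>Ev. a \<xi>))"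
      unfolding k split[symmetric] by (simp add: a_def s_def)
    then have "(\<Sum>\<xi>\<in>Od. a \<xi>) + (\<Sum>\<xi>\<in>Ev. a \<xi>) \<le> pi * C0" by (simp add: field_simps)
    then have "(\<Sum>\<xi>\<in>Od. a \<xi>) \<le> 3 / 2 * pi * C0" using od0 ev0 by simp
    then show ?thesis by (simp add: a_def Od_def s_def)
  next
    assume k: "\<kappa> = 1"
    have "0 \<le> 4 * C0 + \<kappa> * (4 / pi) * (\<Sum>\<xi>\<in>X. cos (pi * of_int 1 * real (sq_root \<xi>)) * fejer_weight N \<xi>)"
      unfolding X_def by (rule fejer_product_test(2)[OF bound Q N]) auto
    also have "(\<Sum>\<xi>\<in>X. cos (pi * of_int 1 * real (sq_root \<xi>)) * fejer_weight N \<xi>) =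
        (\<Sum>\<xi>\<in>X. (-1) ^ s \<xi> * a \<xi>)"
      by (intro sum.cong refl) (simp add: a_def s_def)
    also have "\<dots> = (\<Sum>\<xi>\<in>Od. - a \<xi>) + (\<Sum>\<xi>\<in>Ev. a \<xi>)"
      unfolding split by (intro arg_cong2[of _ _ _ _ "(+)"] sum.cong refl) (auto simp: Od_def Ev_def)
    finally have 1: "(\<Sum>\<xi>\<in>Od. a \<xi>) - (\<Sum>\<xi>\<in>Ev. a \<xi>) \<le> pi * C0"
      unfolding k by (simp add: sum_negf field_simps)
    define h where "h \<xi> = (fst \<xi> div 2, snd \<xi> div 2)" for \<xi> :: "int \<times> int"
    have ev: "h \<xi> \<in> X" "a \<xi> \<le> a (h \<xi>) / 4" "\<xi> = (2 * fst (h \<xi>), 2 * snd (h \<xi>))" if "\<xi> \<in> Ev" for \<xi>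
    proof -
      have e: "even (sq_root \<xi>)" and \<xi>: "\<xi> \<in> X" "\<xi> \<noteq> (0, 0)" using that
        by (auto simp: Ev_def s_def X_def)
      show eq: "\<xi> = (2 * fst (h \<xi>), 2 * snd (h \<xi>))" using nat_nsq_halve(1)[OF e] by (simp add: h_def)
      have n4: "nat_nsq \<xi> = 4 * nat_nsq (h \<xi>)" using nat_nsq_halve(2)[OF e] by (simp add: h_def)
      have hn: "nat_nsq (h \<xi>) \<noteq> 0" using n4 \<xi>(2) by (metis mult_is_0 nat_nsq_eq_0_iff)
      have n4': "nat_nsq \<xi> = 2\<^sup>2 * nat_nsq (h \<xi>)" using n4 by simp
      have sp: "sq_root \<xi> = 2 * square_part (nat_nsq (h \<xi>))"
        "sf_part \<xi> = squarefree_part (nat_nsq (h \<xi>))"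
        unfolding n4' by (rule square_part_square_mult; use hn in simp)+
      show "h \<xi> \<in> X" using \<xi>(1) sp hn unfolding X_def by auto
      have "real (nat_nsq \<xi>) = real (4 * nat_nsq (h \<xi>))" using n4 by simp
      then have nsq4: "nsq \<xi> = 4 * nsq (h \<xi>)" by (simp add: real_nat_nsq)
      have "a \<xi> = (1 - real (2 * s (h \<xi>)) / real N) / (4 * nsq (h \<xi>))"
        unfolding a_def nsq4 by (simp add: s_def sp)
      \<comment> \<open>Halving \<xi> halves its square part, which can only increase the Fejer
        factor.\<close>
      also have "\<dots> \<le> (1 - real (s (h \<xi>)) / real N) / (4 * nsq (h \<xi>))"
        using N by (intro divide_right_mono diff_left_mono) auto
      also have "\<dots> = a (h \<xi>) / 4" by (simp add: a_def)
      finally show "a \<xi> \<le> a (h \<xi>) / 4" .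
    qed
    have inj: "inj_on h Ev"
    proof (rule inj_onI)
      fix x y assume "x \<in> Ev" "y \<in> Ev" "h x = h y"
      then show "x = y" using ev(3) by metis
    qed
    have "(\<Sum>\<xi>\<in>Ev. a \<xi>) \<le> (\<Sum>\<xi>\<in>Ev. a (h \<xi>) / 4)" by (intro sum_mono ev(2))
    also have "\<dots> = (\<Sum>\<xi>\<in>h ` Ev. a \<xi> / 4)" using inj by (simp add: sum.reindex)
    also have "\<dots> \<le> (\<Sum>\<xi>\<in>X. a \<xi> / 4)"
      using finX ev(1) a0 by (intro sum_mono2) auto
    also have "\<dots> = ((\<Sum>\<xi>\<in>Od. a \<xi>) + (\<Sum>\<xi>\<in>Ev. a \<xi>)) / 4" by (simp add: split flip: sum_divide_distrib)
    finally have 2: "4 * (\<Sum>\<xi>\<in>Ev. a \<xi>) \<le> (\<Sum>\<xi>\<in>Od. a \<xi>) + (\<Sum>\<xi>\<in>Ev. a \<xi>)" by simp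
    have "(\<Sum>\<xi>\<in>Od. a \<xi>) \<le> 3 / 2 * (pi * C0)" using 1 2 by simp
    then show ?thesis by (simp add: a_def Od_def s_def)
  qed
qed

text \<open>The lattice points with one odd and one even coordinate already make the sum of
  \<open>1 / nsq \<xi>\<close> diverge.\<close>

lemma chord_error_unbounded:
  fixes \<kappa> :: real
  assumes \<kappa>: "\<kappa> = 1 \<or> \<kappa> = -1"
  shows "\<not> (\<exists>C. \<forall>t\<ge>0. \<kappa> * chord_error t \<le> C * (1 + t))"
proof
  assume "\<exists>C. \<forall>t\<ge>0. \<kappa> * chord_error t \<le> C * (1 + t)"
  then obtain C0 where bound: "\<And>t. t \<ge> 0 \<Longrightarrow> \<kappa> * chord_error t \<le> C0 * (1 + t)" by blast
  \<comment> \<open>The constant is 24 = 16 * 3/2. The Fejer factor is at least 1/2,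
    \<open>nsq\<close> is at most \<open>8 * (i + 1)^2\<close>, and the i + 1 values of j together
    leave \<open>1 / (16 * (i + 1))\<close>.\<close>
  have harm: "harm M \<le> 24 * pi * C0" for M :: nat
  proof -
    \<comment> \<open>All points used have \<open>nsq \<le> K\<close>, so Q contains their
      squarefree parts, and \<open>N = 2 * K + 1\<close> keeps their Fejer factor at least
      1/2.\<close>
    define K where "K = 8 * M\<^sup>2"
    define N where "N = 2 * K + 1"
    define Q where "Q = {q \<in> {..K}. squarefree q}"
    define X where "X = {\<xi>. \<xi> \<noteq> (0, 0) \<and> sf_part \<xi> \<in> Q \<and> sq_root \<xi> < N}"
    define Od where "Od = {\<xi>\<in>X. odd (sq_root \<xi>)}"
    define pt where "pt = (\<lambda>(i, j). (2 * int i + 1, 2 * int j))"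
    define P where "P = (SIGMA i:{..<M}. {..i})"
    have Q: "finite Q" "\<And>q. q \<in> Q \<Longrightarrow> squarefree q" by (auto simp: Q_def)
    have N: "N > 0" by (simp add: N_def)
    have X: "finite X" and le: "(\<Sum>\<xi>\<in>Od. fejer_weight N \<xi>) \<le> 3 / 2 * pi * C0"
      unfolding Od_def X_def by (rule odd_shell_bound[OF bound \<kappa> Q N]; assumption)+
    have inj: "inj_on pt P" by (auto simp: inj_on_def pt_def)
    have ptle: "nsq (pt (i, j)) \<le> 8 * (real i + 1)\<^sup>2" if "j \<le> i" for i j
    proof -
      have "(2 * real i + 1)\<^sup>2 \<le> (2 * (real i + 1))\<^sup>2" by (intro power_mono) auto
      moreover have "(2 * real j)\<^sup>2 \<le> (2 * (real i + 1))\<^sup>2" using that by (intro power_mono) auto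
      moreover have "(2 * (real i + 1))\<^sup>2 = 4 * (real i + 1)\<^sup>2" by (simp only: power_mult_distrib) simp
      moreover have "nsq (pt (i, j)) = (2 * real i + 1)\<^sup>2 + (2 * real j)\<^sup>2"
        by (simp add: pt_def nsq_def)
      ultimately show ?thesis by linarith
    qed
    have mem: "pt x \<in> Od" and half: "1 / 2 / nsq (pt x) \<le> fejer_weight N (pt x)"
      if "x \<in> P" for x
    proof -
      obtain i j where x: "x = (i, j)" "i < M" "j \<le> i" using \<open>x \<in> P\<close> by (cases x) (auto simp: P_def)
      define n where "n = nat_nsq (pt x)"
      have "nsq (pt x) \<le> 8 * (real i + 1)\<^sup>2" using ptle x by simp
      also have "\<dots> \<le> 8 * (real M)\<^sup>2" using x by (intro mult_left_mono power_mono) auto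
      finally have "real n \<le> real K" by (simp add: n_def real_nat_nsq K_def)
      then have nK: "n \<le> K" by simp
      have pne: "pt x \<noteq> (0, 0)" by (simp add: pt_def x)
      then have n0: "n > 0" unfolding n_def using nat_nsq_eq_0_iff by blast
      have "int n = (2 * int i + 1)\<^sup>2 + (2 * int j)\<^sup>2" by (simp add: n_def nat_nsq_def pt_def x)
      then have "odd (int n)" by simp
      then have odd: "odd n" by simp
      have spd: "square_part n dvd n" using square_part_square_dvd[of n]
        by (metis dvd_mult_left power2_eq_square)
      then have sn: "square_part n \<le> K" using n0 nK dvd_imp_le le_trans by blast
      have "squarefree_part n dvd n" by (metis dvd_triv_left squarefree_decompose)
      then have "squarefree_part n \<le> K" using n0 nK dvd_imp_le le_trans by blast
      moreover have "odd (square_part n)" using odd spd dvd_trans by blast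
      ultimately show "pt x \<in> Od" using sn pne unfolding Od_def X_def Q_def N_def n_def by auto
      have "real (square_part n) / real N \<le> 1 / 2" using sn by (simp add: N_def field_simps)
      then show "1 / 2 / nsq (pt x) \<le> fejer_weight N (pt x)"
        unfolding n_def by (intro divide_right_mono) auto
    qed
    have "harm M / 16 = (\<Sum>i<M. \<Sum>j\<le>i. 1 / 2 / (8 * (real i + 1)\<^sup>2))"
    proof -
      have "harm M = (\<Sum>i<M. 1 / (real i + 1))"
        by (induction M) (simp add: harm_def, simp add: harm_Suc inverse_eq_divide add.commute)
      moreover have "(\<Sum>j\<le>i. 1 / 2 / (8 * (real i + 1)\<^sup>2)) = 1 / (real i + 1) / 16" for i
        by (simp add: power2_eq_square add.commute)
      ultimately show ?thesis by (simp only: sum_divide_distrib)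
    qed
    also have "\<dots> \<le> (\<Sum>i<M. \<Sum>j\<le>i. 1 / 2 / nsq (pt (i, j)))"
    proof (intro sum_mono divide_left_mono)
      fix i j assume "i \<in> {..<M}" "j \<in> {..i}"
      then show "nsq (pt (i, j)) \<le> 8 * (real i + 1)\<^sup>2" using ptle by simp
      have "nsq (pt (i, j)) > 0" by (simp add: pt_def nsq_def add_pos_nonneg)
      then show "0 < 8 * (real i + 1)\<^sup>2 * nsq (pt (i, j))" by simp
    qed auto
    also have "\<dots> = (\<Sum>x\<in>P. 1 / 2 / nsq (pt x))"
      unfolding P_def by (subst sum.Sigma) (auto simp: case_prod_unfold)
    also have "\<dots> \<le> (\<Sum>x\<in>P. fejer_weight N (pt x))"
      by (intro sum_mono half)
    also have "\<dots> = (\<Sum>\<xi>\<in>pt ` P. fejer_weight N \<xi>)"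
      using inj by (simp add: sum.reindex)
    also have "\<dots> \<le> (\<Sum>\<xi>\<in>Od. fejer_weight N \<xi>)"
    proof (rule sum_mono2)
      show "finite Od" using X by (simp add: Od_def)
      fix \<xi> assume "\<xi> \<in> Od - pt ` P"
      then show "0 \<le> fejer_weight N \<xi>"
        by (auto simp: Od_def X_def)
    qed (use mem in auto)
    also note le
    finally show ?thesis by simp
  qed
  have "\<forall>\<^sub>F M in sequentially. harm M > 24 * pi * C0"
    using harm_at_top by (simp add: filterlim_at_top_dense)
  then obtain M where "harm M > 24 * pi * C0" by (metis eventually_sequentially order_refl)
  with harm[of M] show False by simp
qed

subsection \<open>Elementary summation over the lattice\<close>

lemma sum_int_symmetric_square:
  fixes e :: real
  shows "(\<Sum>b\<in>{-int n..int n}. e - (of_int b)\<^sup>2)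
      = (2 * real n + 1) * e - real n * (real n + 1) * (2 * real n + 1) / 3"
proof (induction n)
  case (Suc n)
  have set: "{-int (Suc n)..int (Suc n)}
      = insert (- int (Suc n)) (insert (int (Suc n)) {-int n..int n})" by auto
  show ?case unfolding set using Suc.IH by (simp add: field_simps power2_eq_square)
qed simp

text \<open>The difference is a polynomial in \<open>n = \<lfloor>sqrt e\<rfloor>\<close> and \<open>\<theta> = sqrt e - n\<close>, linear in \<open>n\<close>.\<close>

lemma row_sum_asymp:
  assumes e: "e \<ge> 0"
  shows "\<bar>(\<Sum>b | (real_of_int b)\<^sup>2 \<le> e. e - (of_int b)\<^sup>2) - 4 / 3 * (e * sqrt e)\<bar> \<le> sqrt e + 1"
proof -
  define n where "n = nat \<lfloor>sqrt e\<rfloor>"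
  define \<theta> where "\<theta> = sqrt e - real n"
  have n: "real n = of_int \<lfloor>sqrt e\<rfloor>" using e by (simp add: n_def)
  have \<theta>: "0 \<le> \<theta>" "\<theta> \<le> 1" unfolding \<theta>_def n using e by linarith+
  have "{b. (real_of_int b)\<^sup>2 \<le> e} = {-int n..int n}"
  proof (intro set_eqI)
    fix b
    have "(real_of_int b)\<^sup>2 \<le> e \<longleftrightarrow> \<bar>real_of_int b\<bar> \<le> sqrt e"
      using real_sqrt_le_iff[of "(real_of_int b)\<^sup>2" e] by simp
    also have "\<dots> \<longleftrightarrow> \<bar>b\<bar> \<le> \<lfloor>sqrt e\<rfloor>" by (simp add: le_floor_iff)
    finally show "b \<in> {b. (real_of_int b)\<^sup>2 \<le> e} \<longleftrightarrow> b \<in> {-int n..int n}" using e by (auto simp: n_def)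
  qed
  then have "(\<Sum>b | (real_of_int b)\<^sup>2 \<le> e. e - (of_int b)\<^sup>2)
      = (2 * real n + 1) * e - real n * (real n + 1) * (2 * real n + 1) / 3"
    using sum_int_symmetric_square by simp
  moreover have "e = (real n + \<theta>) * (real n + \<theta>)" using e by (simp add: \<theta>_def)
  ultimately have 1: "(\<Sum>b | (real_of_int b)\<^sup>2 \<le> e. e - (of_int b)\<^sup>2) =
     (2 * real n + 1) * ((real n + \<theta>) * (real n + \<theta>)) - real n * (real n + 1) *
         (2 * real n + 1) / 3" by metis
  have 2: "e * sqrt e = (real n + \<theta>) * (real n + \<theta>) * (real n + \<theta>)" using e by (simp add: \<theta>_def)
  have eq: "(\<Sum>b | (real_of_int b)\<^sup>2 \<le> e. e - (of_int b)\<^sup>2) - 4 / 3 * (e * sqrt e) =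
     real n * (2 * \<theta> - 2 * \<theta>\<^sup>2 - 1 / 3) + (\<theta>\<^sup>2 - 4 / 3 * \<theta> ^ 3)"
    unfolding 1 2 by (simp add: field_simps power2_eq_square power3_eq_cube)
  have t2: "0 \<le> \<theta>\<^sup>2" "\<theta>\<^sup>2 \<le> 1" using \<theta> by (auto simp: power_le_one)
  have t3: "0 \<le> \<theta> ^ 3" "\<theta> ^ 3 \<le> 1" using \<theta> by (auto simp: power_le_one)
  have t32: "\<theta> ^ 3 \<le> \<theta>\<^sup>2" using \<theta> by (intro power_decreasing) auto
  \<comment> \<open>These two facts place \<open>2 * \<theta> - 2 * \<theta>^2\<close> between 0 and
    1/2.\<close>
  have "0 \<le> \<theta> * (1 - \<theta>)" "0 \<le> (2 * \<theta> - 1) * (2 * \<theta> - 1)" using \<theta> by auto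
  then have "\<bar>2 * \<theta> - 2 * \<theta>\<^sup>2 - 1 / 3\<bar> \<le> 1" unfolding abs_le_iff
    by (simp add: algebra_simps power2_eq_square)
  then have "\<bar>real n * (2 * \<theta> - 2 * \<theta>\<^sup>2 - 1 / 3)\<bar> \<le> real n * 1"
    unfolding abs_mult by (intro mult_mono) auto
  moreover have "\<bar>\<theta>\<^sup>2 - 4 / 3 * \<theta> ^ 3\<bar> \<le> 1" using t2 t3 t32 unfolding abs_le_iff
    by (intro conjI) linarith+
  moreover have "real n \<le> sqrt e" using \<theta> by (simp add: \<theta>_def)
  ultimately show ?thesis unfolding eq by linarith
qed

section \<open>Superpositions of truncated linear functions\<close>

lemma has_integral_le_abs:
  fixes f g w :: "real \<Rightarrow> real"
  assumes f: "((\<lambda>x. f x * w x) has_integral F) S" and g: "((\<lambda>x. g x * w x) has_integral G) S"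
    and w: "(w has_integral W) S" and w0: "\<And>x. x \<in> S \<Longrightarrow> w x \<ge> 0" and B: "\<And>x. x \<in> S \<Longrightarrow> \<bar>f x - g x\<bar> \<le> B"
  shows "\<bar>F - G\<bar> \<le> B * W"
proof -
  have fg: "((\<lambda>x. f x * w x - g x * w x) has_integral F - G) S" by (intro has_integral_diff f g)
  have bd: "- B * w x \<le> f x * w x - g x * w x" "f x * w x - g x * w x \<le> B * w x" if "x \<in> S" for x
  proof -
    have "- B \<le> f x - g x" "f x - g x \<le> B" using B[OF that] by (simp_all add: abs_le_iff)
    then have "- B * w x \<le> (f x - g x) * w x" "(f x - g x) * w x \<le> B * w x"
      using w0[OF that] mult_right_mono by blast+
    then show "- B * w x \<le> f x * w x - g x * w x" "f x * w x - g x * w x \<le> B * w x"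
      by (simp_all add: left_diff_distrib)
  qed
  have "- B * W \<le> F - G" by (rule has_integral_le[OF has_integral_mult_right[OF w] fg bd(1)])
  moreover have "F - G \<le> B * W" by (rule has_integral_le[OF fg has_integral_mult_right[OF w] bd(2)])
  ultimately show ?thesis by (simp add: abs_le_iff)
qed

text \<open>H has to be differentiable only in the interior, so densities w with an integrable
  singularity at b are covered.\<close>

lemma has_integral_max_0_shift:
  fixes w H :: "real \<Rightarrow> real"
  assumes c: "a \<le> c" "c \<le> b" and cont: "continuous_on {c..b} H"
    and deriv: "\<And>x. x \<in> {c<..<b} \<Longrightarrow> (H has_real_derivative (x - c) * w x) (at x)"
  shows "((\<lambda>x. max 0 (x - c) * w x) has_integral H b - H c) {a..b}"
proof -
  have "((\<lambda>x. (x - c) * w x) has_integral H b - H c) {c..b}"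
    using c(2) cont deriv
    by (intro fundamental_theorem_of_calculus_interior)
        (auto simp: has_real_derivative_iff_has_vector_derivative)
  then have 1: "((\<lambda>x. max 0 (x - c) * w x) has_integral H b - H c) {c..b}"
    by (rule has_integral_eq[rotated]) auto
  have 2: "((\<lambda>x. max 0 (x - c) * w x) has_integral 0) {a..c}"
    by (rule has_integral_is_0) auto
  from has_integral_combine[OF c 2 1] show ?thesis by simp
qed

lemma sqrt_deriv_minus:
  fixes x y :: real
  assumes "x < y"
  shows "((\<lambda>x. sqrt (y - x)) has_real_derivative - (1 / (2 * sqrt (y - x)))) (at x)"
  using assms by (auto intro!: derivative_eq_intros simp: inverse_eq_divide)

lemma has_integral_inverse_sqrt:
  fixes y :: real
  assumes "y \<ge> 0"
  shows "((\<lambda>x. 1 / sqrt (y - x)) has_integral 2 * sqrt y) {0..y}"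
proof -
  have "((\<lambda>x. 1 / sqrt (y - x)) has_integral (- 2 * sqrt (y - y)) - (- 2 * sqrt (y - 0))) {0..y}"
  proof (rule fundamental_theorem_of_calculus_interior[OF assms])
    show "continuous_on {0..y} (\<lambda>x. - 2 * sqrt (y - x))" by (intro continuous_intros)
    fix x assume "x \<in> {0<..<y}"
    then have "((\<lambda>x. - 2 * sqrt (y - x)) has_real_derivative - 2 * (- (1 / (2 * sqrt (y - x))))) (at x)"
      by (intro DERIV_cmult sqrt_deriv_minus) auto
    then show "((\<lambda>x. - 2 * sqrt (y - x)) has_vector_derivative 1 / sqrt (y - x)) (at x)"
      by (simp add: has_real_derivative_iff_has_vector_derivative)
  qed
  then show ?thesis by simp
qed

text \<open>The main term \<open>4/3 * e * sqrt e\<close> of a row, with \<open>e = y - c\<close>,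
  is a superposition of the functions \<open>max 0 (x - c)\<close>. For \<open>c = a^2\<close> the
  sum of these functions over a is again a row sum, so the one-dimensional estimate can be applied a
  second time.\<close>

lemma has_integral_row:
  fixes y c :: real
  assumes "0 \<le> c" "c \<le> y"
  shows "((\<lambda>x. max 0 (x - c) * (1 / sqrt (y - x)))
      has_integral 4 / 3 * ((y - c) * sqrt (y - c))) {0..y}"
proof -
  define H where "H x = - 2 * ((x - c) * sqrt (y - x)) - 4 / 3 * ((y - x) * sqrt (y - x))" for x
  have "((\<lambda>x. max 0 (x - c) * (1 / sqrt (y - x))) has_integral H y - H c) {0..y}"
  proof (rule has_integral_max_0_shift[OF assms])
    show "continuous_on {c..y} H" unfolding H_def[abs_def] by (intro continuous_intros)
    fix x assume x: "x \<in> {c<..<y}"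
    define r where "r = sqrt (y - x)"
    have r: "r > 0" "r * r = y - x" using x by (auto simp: r_def)
    have d: "((\<lambda>x. sqrt (y - x)) has_real_derivative - (1 / (2 * r))) (at x)"
      unfolding r_def using x by (intro sqrt_deriv_minus) auto
    have "(H has_real_derivative - 2 * ((1 - 0) * r + - (1 / (2 * r)) * (x - c))
        - 4 / 3 * ((0 - 1) * r + - (1 / (2 * r)) * (y - x))) (at x)"
      unfolding H_def[abs_def] r_def
      by (intro DERIV_diff DERIV_cmult DERIV_mult DERIV_const DERIV_ident d[unfolded r_def])
    moreover have "- 2 * ((1 - 0) * r + - (1 / (2 * r)) * (x - c))
        - 4 / 3 * ((0 - 1) * r + - (1 / (2 * r)) * (y - x)) = (x - c) * (1 / r)"
    proof -
      have "1 / (2 * r) * (y - x) = r / 2" using r(1) by (simp add: r(2)[symmetric])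
      then have "- 2 * ((1 - 0) * r + - (1 / (2 * r)) * (x - c))
          - 4 / 3 * ((0 - 1) * r + - (1 / (2 * r)) * (y - x)) =
         - 2 * (r + - (1 / (2 * r)) * (x - c)) - 4 / 3 *
             (- r - r / 2)" by (simp only: mult_minus_left) simp
      also have "\<dots> = (x - c) * (1 / r)" using r(1) by (simp add: field_simps)
      finally show ?thesis .
    qed
    ultimately show "(H has_real_derivative (x - c) * (1 / sqrt (y - x))) (at x)" by (simp add: r_def)
  qed
  then show ?thesis by (simp add: H_def)
qed

text \<open>The value is \<open>4/3 * y^2\<close> times the Beta integral with parameters 5/2 and
  1/2, which equals \<open>3 * pi / 8\<close>.\<close>

lemma has_integral_beta:
  fixes y :: real
  assumes y: "y > 0"
  shows "((\<lambda>x. 4 / 3 * (x * sqrt x) * (1 / sqrt (y - x))) has_integral pi / 2 * y\<^sup>2) {0..y}"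
proof -
  define H where "H x = y\<^sup>2 * arcsin (sqrt (x / y)) - y * (sqrt x * sqrt (y - x))
      - 2 / 3 * (x * (sqrt x * sqrt (y - x)))" for x
  have "((\<lambda>x. 4 / 3 * (x * sqrt x) * (1 / sqrt (y - x))) has_integral H y - H 0) {0..y}"
  proof (rule fundamental_theorem_of_calculus_interior)
    show "continuous_on {0..y} H" unfolding H_def[abs_def]
      using y by (intro continuous_intros) (auto intro: order_trans[of "-1" 0])
    fix x assume x: "x \<in> {0<..<y}"
    define r where "r = sqrt x"
    define q where "q = sqrt (y - x)"
    have r: "r > 0" "r\<^sup>2 = x" and q: "q > 0" "q\<^sup>2 = y - x" using x by (auto simp: r_def q_def)
    have dr: "(sqrt has_real_derivative 1 / (2 * r)) (at x)"
      unfolding r_def using x by (auto intro!: derivative_eq_intros simp: inverse_eq_divide)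
    have dq: "((\<lambda>x. sqrt (y - x)) has_real_derivative - (1 / (2 * q))) (at x)"
      unfolding q_def using x by (intro sqrt_deriv_minus) auto
    have da: "((\<lambda>x. arcsin (sqrt (x / y))) has_real_derivative 1 / (2 * (r * q))) (at x)"
    proof -
      have xy: "x / y < 1" "x / y > 0" using x y by auto
      have "((\<lambda>x. sqrt (x / y)) has_real_derivative (1 / (2 * sqrt (x / y))) * (1 / y)) (at x)"
        using DERIV_chain2[OF DERIV_real_sqrt[OF xy(2)] DERIV_cdivide[OF DERIV_ident, of y]]
          by (simp add: inverse_eq_divide mult_ac)
      then have "((\<lambda>x. arcsin (sqrt (x / y))) has_real_derivative inverse (sqrt (1 - (sqrt (x / y))\<^sup>2))
          * ((1 / (2 * sqrt (x / y))) * (1 / y))) (at x)"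
        by (intro DERIV_chain2[OF DERIV_arcsin])
            (use xy in \<open>auto simp: real_sqrt_lt_1_iff intro: less_le_trans[of _ 0]\<close>)
      moreover have "inverse (sqrt (1 - (sqrt (x / y))\<^sup>2)) * ((1 / (2 * sqrt (x / y))) * (1 / y))
          = 1 / (2 * (r * q))"
      proof -
        have "1 - (sqrt (x / y))\<^sup>2 = (y - x) / y" using xy y by (simp add: diff_divide_distrib)
        then have e1: "sqrt (1 - (sqrt (x / y))\<^sup>2) = q / sqrt y" by (simp add: q_def real_sqrt_divide)
        have e2: "sqrt (x / y) = r / sqrt y" by (simp add: r_def real_sqrt_divide)
        show ?thesis unfolding e1 unfolding e2 using y r(1) q(1) by (simp add: field_simps)
      qed
      ultimately show ?thesis by simp
    qed
    have "(H has_real_derivative y\<^sup>2 * (1 / (2 * (r * q))) - y * (1 / (2 * r) * q + - (1 / (2 * q)) * r)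
        - 2 / 3 * (1 * (r * q) + (1 / (2 * r) * q + - (1 / (2 * q)) * r) * x)) (at x)"
      unfolding H_def[abs_def] r_def q_def
      by (intro DERIV_diff DERIV_cmult DERIV_mult DERIV_ident dr[unfolded r_def] dq[unfolded q_def]
          da[unfolded r_def q_def])
    moreover have "y\<^sup>2 * (1 / (2 * (r * q))) - y * (1 / (2 * r) * q + - (1 / (2 * q)) * r)
        - 2 / 3 * (1 * (r * q) + (1 / (2 * r) * q + - (1 / (2 * q)) * r) * x) = 4 / 3 * (x * r) *
            (1 / q)"
    proof -
      have xr: "x = r * r" using r by (simp add: power2_eq_square)
      have yr: "y = r * r + q * q" using r q by (simp add: power2_eq_square)
      show ?thesis unfolding xr yr using r(1) q(1) by (simp add: field_simps power2_eq_square)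
    qed
    ultimately show "(H has_vector_derivative 4 / 3 * (x * sqrt x) * (1 / sqrt (y - x))) (at x)"
      by (simp add: has_real_derivative_iff_has_vector_derivative r_def q_def)
  qed (use y in auto)
  then show ?thesis using y by (simp add: H_def mult.commute)
qed

text \<open>This is the integral over v from 0 to y of the number of lattice points in
  \<open>disc v\<close>; the averaging brings an error linear in y within elementary reach.\<close>

definition cone_sum :: "real \<Rightarrow> real" where
  "cone_sum y = (\<Sum>z\<in>disc y. y - nsq z)"

text \<open>Each of the at most \<open>2 * sqrt y + 1\<close> rows costs at most
  \<open>sqrt y + 1\<close>. The sum S of their main terms is an integral of row sums against
  \<open>1 / sqrt (y - x)\<close>, a density of mass \<open>2 * sqrt y\<close>, where the row
  estimate again costs at most \<open>sqrt y + 1\<close>.\<close>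

lemma cone_sum_asymp:
  assumes y: "y \<ge> 0"
  shows "\<bar>cone_sum y - pi / 2 * y\<^sup>2\<bar> \<le> 10 * (y + 1)"
proof (cases "y = 0")
  case True
  have "nsq z \<le> 0 \<longleftrightarrow> z = (0, 0)" for z using nsq_nonneg[of z] nsq_eq_0_iff[of z] by linarith
  then have "disc 0 = {(0, 0)}" by (auto simp: disc_def)
  then show ?thesis using True by (simp add: cone_sum_def nsq_def)
next
  case False
  then have y: "y > 0" using y by simp
  define A where "A = {a. (real_of_int a)\<^sup>2 \<le> y}"
  have Ak: "A \<subseteq> {-\<lfloor>sqrt y\<rfloor>..\<lfloor>sqrt y\<rfloor>}"
  proof
    fix a assume "a \<in> A"
    then have "\<bar>real_of_int a\<bar> \<le> sqrt y" unfolding A_def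
      using real_sqrt_le_iff[of "(real_of_int a)\<^sup>2" y] by simp
    then have "\<bar>a\<bar> \<le> \<lfloor>sqrt y\<rfloor>" by (simp add: le_floor_iff)
    then show "a \<in> {-\<lfloor>sqrt y\<rfloor>..\<lfloor>sqrt y\<rfloor>}" by auto
  qed
  then have finA: "finite A" by (rule finite_subset) simp
  have "card A \<le> card {-\<lfloor>sqrt y\<rfloor>..\<lfloor>sqrt y\<rfloor>}" using Ak by (intro card_mono) auto
  then have "real (card A) \<le> real (nat (2 * \<lfloor>sqrt y\<rfloor> + 1))" by simp
  also have "\<dots> \<le> 2 * sqrt y + 1" using y by simp
  finally have cardA: "real (card A) \<le> 2 * sqrt y + 1" .
  define m where "m e = (\<Sum>b | (real_of_int b)\<^sup>2 \<le> e. e - (of_int b)\<^sup>2)" for e :: real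
  have finrow: "finite {b. (real_of_int b)\<^sup>2 \<le> e}" for e
  proof -
    have "{b. (real_of_int b)\<^sup>2 \<le> e} \<subseteq> snd ` disc e"
      by (auto simp: disc_def nsq_def image_iff intro!: exI[of _ 0])
    then show ?thesis using finite_disc finite_subset finite_imageI by metis
  qed
  have rows: "cone_sum y = (\<Sum>a\<in>A. m (y - (of_int a)\<^sup>2))"
  proof -
    have "disc y = (SIGMA a:A. {b. (real_of_int b)\<^sup>2 \<le> y - (of_int a)\<^sup>2})"
    proof (intro set_eqI)
      fix z :: "int \<times> int"
      have "nsq z \<le> y \<Longrightarrow> (real_of_int (fst z))\<^sup>2 \<le> y" using zero_le_power2[of "real_of_int (snd z)"]
        unfolding nsq_def by linarith
      then show "z \<in> disc y \<longleftrightarrow> z \<in> (SIGMA a:A. {b. (real_of_int b)\<^sup>2 \<le> y - (of_int a)\<^sup>2})"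
        by (cases z) (auto simp: disc_def A_def nsq_def)
    qed
    then have "cone_sum y = (\<Sum>z\<in>(SIGMA a:A. {b. (real_of_int b)\<^sup>2 \<le> y - (of_int a)\<^sup>2}). y - nsq z)"
      by (simp add: cone_sum_def)
    also have "\<dots> = (\<Sum>a\<in>A. m (y - (of_int a)\<^sup>2))"
    proof -
      have "(\<Sum>a\<in>A. m (y - (of_int a)\<^sup>2)) =
          (\<Sum>(a, b)\<in>(SIGMA a:A. {b. (real_of_int b)\<^sup>2 \<le> y - (of_int a)\<^sup>2}). (y - (of_int a)\<^sup>2) -
              (of_int b)\<^sup>2)"
        unfolding m_def by (rule sum.Sigma[OF finA]) (rule ballI, rule finrow)
      also have "\<dots> = (\<Sum>z\<in>(SIGMA a:A. {b. (real_of_int b)\<^sup>2 \<le> y - (of_int a)\<^sup>2}). y - nsq z)"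
        by (intro sum.cong refl) (auto simp: nsq_def)
      finally show ?thesis ..
    qed
    finally show ?thesis .
  qed
  define S where "S = (\<Sum>a\<in>A. 4 / 3 * ((y - (of_int a)\<^sup>2) * sqrt (y - (of_int a)\<^sup>2)))"
  have "\<bar>cone_sum y - S\<bar>
      \<le> (\<Sum>a\<in>A. \<bar>m (y - (of_int a)\<^sup>2) - 4 / 3 * ((y - (of_int a)\<^sup>2) * sqrt (y - (of_int a)\<^sup>2))\<bar>)"
    unfolding rows S_def sum_subtractf[symmetric] by (rule sum_abs)
  also have "\<dots> \<le> (\<Sum>a\<in>A. sqrt y + 1)"
  proof (rule sum_mono)
    fix a assume a: "a \<in> A"
    have "\<bar>m (y - (of_int a)\<^sup>2) - 4 / 3 * ((y - (of_int a)\<^sup>2) * sqrt (y - (of_int a)\<^sup>2))\<bar>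
        \<le> sqrt (y - (of_int a)\<^sup>2) + 1"
      unfolding m_def by (rule row_sum_asymp) (use a in \<open>simp add: A_def\<close>)
    also have "sqrt (y - (of_int a)\<^sup>2) \<le> sqrt y" by (intro real_sqrt_le_mono) simp
    finally show "\<bar>m (y - (of_int a)\<^sup>2) - 4 / 3 * ((y - (of_int a)\<^sup>2) * sqrt (y - (of_int a)\<^sup>2))\<bar>
        \<le> sqrt y + 1" by simp
  qed
  also have "\<dots> = real (card A) * (sqrt y + 1)" by simp
  also have "\<dots> \<le> (2 * sqrt y + 1) * (sqrt y + 1)" using cardA y by (intro mult_right_mono) auto
  finally have 1: "\<bar>cone_sum y - S\<bar> \<le> (2 * sqrt y + 1) * (sqrt y + 1)" .
  have "((\<lambda>x. \<Sum>a\<in>A. max 0 (x - (of_int a)\<^sup>2) * (1 / sqrt (y - x))) has_integral S) {0..y}"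
    unfolding S_def by (intro has_integral_sum finA has_integral_row) (auto simp: A_def)
  then have mS: "((\<lambda>x. m x * (1 / sqrt (y - x))) has_integral S) {0..y}"
  proof (rule has_integral_eq[rotated])
    fix x assume x: "x \<in> {0..y}"
    have "(\<Sum>a\<in>A. max 0 (x - (of_int a)\<^sup>2)) = m x"
      unfolding m_def
    proof (rule sum.mono_neutral_cong_right[OF finA])
      show "{b. (real_of_int b)\<^sup>2 \<le> x} \<subseteq> A" using x by (auto simp: A_def)
    qed auto
    then show "(\<Sum>a\<in>A. max 0 (x - (of_int a)\<^sup>2) * (1 / sqrt (y - x))) = m x * (1 / sqrt (y - x))"
      by (simp flip: sum_distrib_right sum_divide_distrib)
  qed
  have "\<bar>S - pi / 2 * y\<^sup>2\<bar> \<le> (sqrt y + 1) * (2 * sqrt y)"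
  proof (rule has_integral_le_abs[OF mS has_integral_beta[OF y] has_integral_inverse_sqrt])
    fix x assume x: "x \<in> {0..y}"
    have "\<bar>m x - 4 / 3 * (x * sqrt x)\<bar> \<le> sqrt x + 1" unfolding m_def
      by (rule row_sum_asymp) (use x in simp)
    also have "sqrt x \<le> sqrt y" using x by simp
    finally show "\<bar>m x - 4 / 3 * (x * sqrt x)\<bar> \<le> sqrt y + 1" by simp
  qed (use y in auto)
  with 1 have "\<bar>cone_sum y - pi / 2 * y\<^sup>2\<bar> \<le> (2 * sqrt y + 1) * (sqrt y + 1)
      + (sqrt y + 1) * (2 * sqrt y)" by linarith
  also have "\<dots> = 4 * (sqrt y * sqrt y) + 5 * sqrt y + 1" by (simp only: distrib_left distrib_right)
  also have "\<dots> = 4 * y + 5 * sqrt y + 1" using y by simp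
  also have "\<dots> \<le> 10 * (y + 1)"
  proof -
    have "0 \<le> (sqrt y - 1) * (sqrt y - 1)" by simp
    also have "\<dots> = sqrt y * sqrt y - 2 * sqrt y + 1" by (simp add: algebra_simps)
    finally have "2 * sqrt y \<le> y + 1" using y by simp
    then show ?thesis using y by (smt (verit))
  qed
  finally show ?thesis .
qed


subsection \<open>From the sum of chords to the lattice point count\<close>

text \<open>With \<open>u = |z|\<^sup>2 / t\<^sup>2\<close>, \<open>t\<^sup>2 * chord_gap u\<close> is the difference of the summands \<open>2 sqrt
    (t\<^sup>4 - |z|\<^sup>4)\<close>
  and \<open>sqrt 2 * t * 2 sqrt (t\<^sup>2 - |z|\<^sup>2)\<close>. On \<open>[0, 1]\<close> it is concave and vanishes together with its
  derivative at \<open>1\<close>, so it is a superposition of the functions \<open>u \<mapsto> max 0 (v - u)\<close> with density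
  \<open>chord_gap'' v\<close>.\<close>

definition chord_gap :: "real \<Rightarrow> real" where
  "chord_gap u = 2 * sqrt (1 - u\<^sup>2) - 2 * sqrt 2 * sqrt (1 - u)"

text \<open>Plain differentiation gives a difference of two terms that blow up at 1. Here it is
  rationalised with \<open>sqrt 2 * sqrt (1 + u) + 2 * u\<close>, which exhibits the factor
  \<open>sqrt (1 - u)\<close> and hence continuity up to 1.\<close>

definition chord_gap' :: "real \<Rightarrow> real" where
  "chord_gap' u = 2 * sqrt (1 - u) * (1 + 2 * u) / (sqrt (1 + u) * (sqrt 2 * sqrt (1 + u) + 2 * u))"

definition chord_gap'' :: "real \<Rightarrow> real" where
  "chord_gap'' u = 1 / (sqrt 2 * sqrt (1 - u) ^ 3) - 2 / (sqrt (1 - u) * sqrt (1 + u)) ^ 3"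

lemma chord_gap_derivs:
  assumes u: "0 < u" "u < 1"
  shows "(chord_gap has_real_derivative chord_gap' u) (at u)"
    and "(chord_gap' has_real_derivative chord_gap'' u) (at u)"
proof -
  \<comment> \<open>The derivative before rationalising, the form that is differentiated a second
    time.\<close>
  define E where "E u = sqrt 2 / sqrt (1 - u) - 2 * (u / (sqrt (1 - u) * sqrt (1 + u)))" for u :: real
  have E: "chord_gap' v = E v" if v: "0 < v" "v < 1" for v
  proof -
    define p where "p = sqrt (1 - v)"
    define q where "q = sqrt (1 + v)"
    have pq: "p > 0" "q > 0" "p * p = 1 - v" "q * q = 1 + v" using v by (auto simp: p_def q_def)
    have d: "sqrt 2 * q + 2 * v > 0" using pq v by (simp add: add_pos_pos)
    have "(sqrt 2 * q - 2 * v) * (sqrt 2 * q + 2 * v) = (sqrt 2 * sqrt 2) * (q * q) - 4 * (v * v)"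
      by (simp only: algebra_simps)
    also have "\<dots> = 2 * (p * p) * (1 + 2 * v)" unfolding pq(3,4) by (simp add: algebra_simps)
    finally have "sqrt 2 * q - 2 * v = 2 * (p * p) * (1 + 2 * v) / (sqrt 2 * q + 2 * v)"
      using d by (simp add: field_simps)
    moreover have "E v = (sqrt 2 * q - 2 * v) / (p * q)"
      using pq by (simp add: E_def diff_divide_distrib flip: p_def q_def)
    ultimately have "E v = 2 * (p * p) * (1 + 2 * v) / (sqrt 2 * q + 2 * v) / (p * q)" by simp
    also have "\<dots> = 2 * p * (1 + 2 * v) / (q * (sqrt 2 * q + 2 * v))" using pq(1,2)
      by (simp add: mult.commute)
    finally show ?thesis by (simp add: chord_gap'_def p_def q_def)
  qed
  define p where "p = sqrt (1 - u)"
  define q where "q = sqrt (1 + u)"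
  have pq: "p > 0" "q > 0" "p * p = 1 - u" "q * q = 1 + u" using u by (auto simp: p_def q_def)
  have dp: "((\<lambda>u. sqrt (1 - u)) has_real_derivative - (1 / (2 * p))) (at u)"
    unfolding p_def using u by (intro sqrt_deriv_minus) auto
  have dq: "((\<lambda>u. sqrt (1 + u)) has_real_derivative 1 / (2 * q)) (at u)"
    unfolding q_def using u by (auto intro!: derivative_eq_intros simp: inverse_eq_divide)
  have sq: "sqrt (1 - v\<^sup>2) = sqrt (1 - v) * sqrt (1 + v)" for v :: real
    by (simp add: power2_eq_square algebra_simps flip: real_sqrt_mult)
  have "((\<lambda>u. 2 * (sqrt (1 - u) * sqrt (1 + u)) - 2 * sqrt 2 * sqrt (1 - u)) has_real_derivative
      2 * (- (1 / (2 * p)) * q + 1 / (2 * q) * p) - 2 * sqrt 2 * (- (1 / (2 * p)))) (at u)"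
    unfolding p_def q_def
      by (intro DERIV_diff DERIV_cmult DERIV_mult dp[unfolded p_def] dq[unfolded q_def])
  moreover have "2 * (- (1 / (2 * p)) * q + 1 / (2 * q) * p) - 2 * sqrt 2 * (- (1 / (2 * p))) = E u"
  proof -
    have "2 * (- (1 / (2 * p)) * q + 1 / (2 * q) * p) = (p * p - q * q) / (p * q)"
      using pq(1,2) by (simp add: field_simps)
    also have "\<dots> = - 2 * (u / (p * q))" unfolding pq by simp
    finally show ?thesis by (simp add: E_def flip: p_def q_def)
  qed
  ultimately show "(chord_gap has_real_derivative chord_gap' u) (at u)"
    unfolding E[OF u] chord_gap_def[abs_def] sq by simp
  have "(E has_real_derivative sqrt 2 * (1 / (2 * p)) / (p * p)
      - 2 * ((1 * (p * q) - u * (- (1 / (2 * p)) * q + 1 / (2 * q) * p)) / ((p * q) * (p * q)))) (at u)"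
  proof -
    have "((\<lambda>u. u / (sqrt (1 - u) * sqrt (1 + u))) has_real_derivative
       (1 * (p * q) - u * (- (1 / (2 * p)) * q + 1 / (2 * q) * p)) / ((p * q) * (p * q))) (at u)"
      using pq unfolding p_def q_def
      by (intro DERIV_divide DERIV_ident DERIV_mult dp[unfolded p_def] dq[unfolded q_def]) auto
    moreover have "((\<lambda>u. sqrt 2 / sqrt (1 - u))
        has_real_derivative (0 * p - sqrt 2 * (- (1 / (2 * p)))) / (p * p)) (at u)"
      using pq unfolding p_def by (intro DERIV_divide DERIV_const dp[unfolded p_def]) auto
    ultimately have "(E has_real_derivative (0 * p - sqrt 2 * (- (1 / (2 * p)))) / (p * p) -
        2 * ((1 * (p * q) - u * (- (1 / (2 * p)) * q + 1 / (2 * q) * p)) / ((p * q) * (p * q)))) (at u)"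
      unfolding E_def[abs_def] by (intro DERIV_diff DERIV_cmult)
    then show ?thesis by simp
  qed
  moreover have "sqrt 2 * (1 / (2 * p)) / (p * p)
      - 2 * ((1 * (p * q) - u * (- (1 / (2 * p)) * q + 1 / (2 * q) * p)) / ((p * q) * (p * q))) =
      chord_gap'' u"
  proof -
    have "(p * q) * (p * q) = (p * p) * (q * q)" by simp
    then have pq2: "(p * q) * (p * q) = 1 - u * u" unfolding pq by (simp add: algebra_simps)
    have "- (1 / (2 * p)) * q + 1 / (2 * q) * p = (p * p - q * q) / (2 * (p * q))"
      using pq(1,2) by (simp add: field_simps)
    also have "\<dots> = - u / (p * q)" unfolding pq by simp
    finally have "1 * (p * q) - u * (- (1 / (2 * p)) * q + 1 / (2 * q) * p)
        = ((p * q) * (p * q) + u * u) / (p * q)"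
      using pq(1,2) by (simp add: add_divide_distrib)
    also have "\<dots> = 1 / (p * q)" unfolding pq2 by simp
    finally have 1: "1 * (p * q) - u * (- (1 / (2 * p)) * q + 1 / (2 * q) * p) = 1 / (p * q)" .
    have "sqrt 2 * (1 / (2 * p)) / (p * p) = 1 / (sqrt 2 * p ^ 3)"
    proof -
      have "sqrt 2 * (1 / (2 * p)) / (p * p) = sqrt 2 / ((sqrt 2 * sqrt 2) * p ^ 3)"
        by (simp add: power3_eq_cube)
      also have "\<dots> = sqrt 2 / (sqrt 2 * (sqrt 2 * p ^ 3))" by (simp only: mult.assoc)
      finally show ?thesis by simp
    qed
    then show ?thesis unfolding 1 by (simp add: chord_gap''_def power3_eq_cube flip: p_def q_def)
  qed
  ultimately have "(E has_real_derivative chord_gap'' u) (at u)" by simp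
  then show "(chord_gap' has_real_derivative chord_gap'' u) (at u)"
    by (rule has_field_derivative_transform_within_open[of _ _ _ "{0<..<1}"]) (use u E in auto)
qed

text \<open>For u < 1 the bound \<open>sqrt (1 + u) ^ 3 \<le> 2 * sqrt 2\<close> decides the sign;
  at u = 1 division by zero makes both terms 0.\<close>

lemma chord_gap''_nonpos:
  assumes "0 \<le> u" "u \<le> 1"
  shows "chord_gap'' u \<le> 0"
proof (cases "u = 1")
  case True
  then show ?thesis by (simp add: chord_gap''_def)
next
  case False
  define p where "p = sqrt (1 - u)"
  define q where "q = sqrt (1 + u)"
  have p: "p > 0" and q: "q > 0" using assms False by (auto simp: p_def q_def)
  have "q \<le> sqrt 2" unfolding q_def using assms by simp
  then have "q ^ 3 \<le> sqrt 2 ^ 3" using q by (intro power_mono) auto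
  also have "\<dots> = 2 * sqrt 2" by (simp add: power3_eq_cube)
  finally have "p ^ 3 * q ^ 3 \<le> p ^ 3 * (2 * sqrt 2)" using p by (intro mult_left_mono) auto
  then have "1 / (sqrt 2 * p ^ 3) \<le> 2 / (p * q) ^ 3"
    using p q by (simp add: field_simps power_mult_distrib)
  then show ?thesis by (simp add: chord_gap''_def flip: p_def q_def)
qed

lemma chord_gap_continuous: "continuous_on {0..1} chord_gap" "continuous_on {0..1} chord_gap'"
proof -
  show "continuous_on {0..1} chord_gap" unfolding chord_gap_def[abs_def] by (intro continuous_intros)
  have "sqrt 2 * sqrt (1 + u) + 2 * u > 0" if "u \<in> {0..1}" for u :: real
    using that by (intro add_pos_nonneg) auto
  then have nz: "sqrt (1 + u) * (sqrt 2 * sqrt (1 + u) + 2 * u) \<noteq> 0" if "u \<in> {0..1}" for u :: real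
    using that by fastforce
  show "continuous_on {0..1} chord_gap'" unfolding chord_gap'_def[abs_def]
    by (intro continuous_intros ballI nz)
qed

lemma chord_gap_1: "chord_gap 1 = 0" "chord_gap' 1 = 0" "chord_gap' 0 = sqrt 2"
  by (simp_all add: chord_gap_def chord_gap'_def real_div_sqrt)

lemma has_integral_chord_gap'': "(chord_gap'' has_integral - sqrt 2) {0..1}"
proof -
  have "(chord_gap'' has_integral chord_gap' 1 - chord_gap' 0) {0..1}"
    by (rule fundamental_theorem_of_calculus_interior)
       (use chord_gap_continuous chord_gap_derivs in \<open>auto simp:
           has_real_derivative_iff_has_vector_derivative\<close>)
  then show ?thesis by (simp add: chord_gap_1)
qed

text \<open>Taylor's formula at 1 with integral remainder: \<open>chord_gap\<close> and its
  derivative vanish there, so of the boundary terms only \<open>- H c = chord_gap c\<close>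
  survives.\<close>

lemma has_integral_chord_gap:
  assumes c: "0 \<le> c" "c \<le> 1"
  shows "((\<lambda>u. max 0 (u - c) * chord_gap'' u) has_integral chord_gap c) {0..1}"
proof -
  define H where "H u = (u - c) * chord_gap' u - chord_gap u" for u
  have "((\<lambda>u. max 0 (u - c) * chord_gap'' u) has_integral H 1 - H c) {0..1}"
  proof (rule has_integral_max_0_shift[OF c])
    show "continuous_on {c..1} H" unfolding H_def[abs_def]
      using c by
          (intro continuous_intros continuous_on_subset[OF chord_gap_continuous(1)]
          continuous_on_subset[OF chord_gap_continuous(2)]) auto
    fix x assume "x \<in> {c<..<1}"
    then have x: "0 < x" "x < 1" using c by auto
    have "(H has_real_derivative (1 - 0) * chord_gap' x + chord_gap'' x * (x - c)
        - chord_gap' x) (at x)"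
      unfolding H_def[abs_def]
      by (intro DERIV_diff DERIV_mult DERIV_ident DERIV_const chord_gap_derivs[OF x])
    then show "(H has_real_derivative (x - c) * chord_gap'' x) (at x)" by (simp add: mult.commute)
  qed
  then show ?thesis by (simp add: H_def chord_gap_1)
qed

text \<open>Two integrations by parts reduce this to the integral of \<open>chord_gap\<close>, whose
  antiderivative is \<Phi>. The other boundary terms vanish at both ends.\<close>

lemma has_integral_chord_gap_square:
  "((\<lambda>u. (u\<^sup>2 / 2) * chord_gap'' u) has_integral pi / 2 - 4 / 3 * sqrt 2) {0..1}"
proof -
  define \<Phi> where "\<Phi> u = u * sqrt (1 - u\<^sup>2) + arcsin u + 4 / 3 * sqrt 2 * ((1 - u) * sqrt (1 - u))"
      for u :: real
  define H where "H u = (u\<^sup>2 / 2) * chord_gap' u - u * chord_gap u + \<Phi> u" for u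
  have "((\<lambda>u. (u\<^sup>2 / 2) * chord_gap'' u) has_integral H 1 - H 0) {0..1}"
  proof (rule fundamental_theorem_of_calculus_interior)
    show "continuous_on {0..1} H" unfolding H_def[abs_def] \<Phi>_def[abs_def]
      by (intro continuous_intros chord_gap_continuous) auto
    fix u :: real assume "u \<in> {0<..<1}"
    then have u: "0 < u" "u < 1" by auto
    define p where "p = sqrt (1 - u)"
    have p: "p > 0" "p * p = 1 - u" using u by (auto simp: p_def)
    have dp: "((\<lambda>u. sqrt (1 - u)) has_real_derivative - (1 / (2 * p))) (at u)"
      unfolding p_def using u by (intro sqrt_deriv_minus) auto
    define c where "c = sqrt (1 - u\<^sup>2)"
    have u2: "u\<^sup>2 < 1" using u by (simp add: power_less_one_iff abs_square_less_1)
    then have c: "c > 0" "c * c = 1 - u\<^sup>2" by (auto simp: c_def)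
    have dc: "((\<lambda>u. sqrt (1 - u\<^sup>2)) has_real_derivative - (u / c)) (at u)"
      unfolding c_def using u2 by (auto intro!: derivative_eq_intros simp: inverse_eq_divide)
    have da: "(arcsin has_real_derivative 1 / c) (at u)"
      using DERIV_arcsin[of u] u by (simp add: c_def inverse_eq_divide)
    have "(\<Phi> has_real_derivative (1 * c + - (u / c) * u) + 1 / c
        + 4 / 3 * sqrt 2 * ((0 - 1) * p + - (1 / (2 * p)) * (1 - u))) (at u)"
      unfolding \<Phi>_def[abs_def] c_def p_def
      by (intro DERIV_add DERIV_mult DERIV_cmult DERIV_diff DERIV_ident DERIV_const dc[unfolded c_def]
          da[unfolded c_def] dp[unfolded p_def])
    moreover have "(1 * c + - (u / c) * u) + 1 / c
        + 4 / 3 * sqrt 2 * ((0 - 1) * p + - (1 / (2 * p)) * (1 - u)) = chord_gap u"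
    proof -
      have "1 / (2 * p) * (1 - u) = p / 2" using p(1) by (simp add: p(2)[symmetric])
      then have "4 / 3 * sqrt 2 * ((0 - 1) * p + - (1 / (2 * p)) * (1 - u))
          = 4 / 3 * sqrt 2 * (- p - p / 2)" by (simp only: mult_minus_left) simp
      also have "\<dots> = - 2 * sqrt 2 * p" by simp
      finally have 1: "4 / 3 * sqrt 2 * ((0 - 1) * p + - (1 / (2 * p)) * (1 - u)) = - 2 * sqrt 2 * p" .
      have "(1 * c + - (u / c) * u) + 1 / c = c + (1 - u\<^sup>2) / c"
        using c(1) by (simp add: diff_divide_distrib power2_eq_square)
      also have "\<dots> = 2 * c" using c(1) unfolding c(2)[symmetric] by simp
      finally show ?thesis unfolding 1 by (simp add: chord_gap_def c_def p_def)
    qed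
    ultimately have d\<Phi>: "(\<Phi> has_real_derivative chord_gap u) (at u)" by simp
    have d2: "((\<lambda>u. u\<^sup>2 / 2) has_real_derivative u) (at u)" by (auto intro!: derivative_eq_intros)
    have "(H has_real_derivative (u * chord_gap' u + chord_gap'' u * (u\<^sup>2 / 2))
        - (1 * chord_gap u + chord_gap' u * u) + chord_gap u) (at u)"
      unfolding H_def[abs_def]
      by (intro DERIV_add DERIV_diff DERIV_mult DERIV_ident d2 chord_gap_derivs[OF u] d\<Phi>)
    then have "(H has_real_derivative (u\<^sup>2 / 2) * chord_gap'' u) (at u)" by (simp add: algebra_simps)
    then show "(H has_vector_derivative (u\<^sup>2 / 2) * chord_gap'' u) (at u)"
      by (simp add: has_real_derivative_iff_has_vector_derivative)
  qed simp
  moreover have "H 1 - H 0 = pi / 2 - 4 / 3 * sqrt 2" by (simp add: H_def \<Phi>_def chord_gap_1)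
  ultimately show ?thesis by simp
qed

text \<open>Summed over z, the functions \<open>Y * max 0 (u - nsq z / Y)\<close> of the
  superposition become \<open>cone_sum (u * Y)\<close>. Its error, at most
  \<open>10 * (Y + 1)\<close>, is integrated against \<open>- chord_gap''\<close>, a nonnegative
  density of mass \<open>sqrt 2\<close>.\<close>

lemma chord_gap_sum_asymp:
  assumes Y: "Y > 0"
  shows "\<bar>(\<Sum>z\<in>disc Y. Y * chord_gap (nsq z / Y)) - pi * Y\<^sup>2 * (pi / 2 - 4 / 3 * sqrt 2)\<bar>
      \<le> 10 * sqrt 2 * (Y + 1)"
proof -
  define F where "F = (\<Sum>z\<in>disc Y. Y * chord_gap (nsq z / Y))"
  have "((\<lambda>u. \<Sum>z\<in>disc Y. Y * (max 0 (u - nsq z / Y) * chord_gap'' u)) has_integral F) {0..1}"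
    unfolding F_def using Y
    by (intro has_integral_sum finite_disc has_integral_mult_right has_integral_chord_gap)
        (auto simp: disc_def)
  then have 1: "((\<lambda>u. cone_sum (u * Y) * chord_gap'' u) has_integral F) {0..1}"
  proof (rule has_integral_eq[rotated])
    fix u :: real assume u: "u \<in> {0..1}"
    have uY: "u * Y \<le> Y" using u Y by (simp add: mult_left_le_one_le)
    have "cone_sum (u * Y) = (\<Sum>z\<in>disc Y. max 0 (u * Y - nsq z))"
      unfolding cone_sum_def
      by (rule sum.mono_neutral_cong_left[OF finite_disc]) (use uY in \<open>auto simp: disc_def\<close>)
    also have "\<dots> = (\<Sum>z\<in>disc Y. Y * max 0 (u - nsq z / Y))"
    proof (rule sum.cong[OF refl])
      fix z
      have "Y * max 0 (u - nsq z / Y) = max (Y * 0) (Y * (u - nsq z / Y))" using Y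
        by (intro max_mult_distrib_left[THEN trans]) auto
      also have "Y * (u - nsq z / Y) = u * Y - nsq z" using Y by (simp add: field_simps)
      finally show "max 0 (u * Y - nsq z) = Y * max 0 (u - nsq z / Y)" by simp
    qed
    finally show "(\<Sum>z\<in>disc Y. Y * (max 0 (u - nsq z / Y) * chord_gap'' u))
        = cone_sum (u * Y) * chord_gap'' u"
      by (simp add: sum_distrib_right mult.assoc)
  qed
  have 2: "((\<lambda>u. pi / 2 * (u * Y)\<^sup>2 * chord_gap'' u)
      has_integral pi * Y\<^sup>2 * (pi / 2 - 4 / 3 * sqrt 2)) {0..1}"
    using has_integral_mult_right[OF has_integral_chord_gap_square, of "pi * Y\<^sup>2"]
    by (simp add: power_mult_distrib mult_ac)
  have neg: "((\<lambda>u. f u * - chord_gap'' u) has_integral - J) {0..1}"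
      if "((\<lambda>u. f u * chord_gap'' u) has_integral J) {0..1}" for f J
    using has_integral_neg[OF that] by simp
  have "\<bar>- F - - (pi * Y\<^sup>2 * (pi / 2 - 4 / 3 * sqrt 2))\<bar> \<le> 10 * (Y + 1) * sqrt 2"
  proof (rule has_integral_le_abs[OF neg[OF 1] neg[OF 2]])
    show "((\<lambda>u. - chord_gap'' u) has_integral sqrt 2) {0..1}"
      using has_integral_neg[OF has_integral_chord_gap''] by simp
    fix u :: real assume u: "u \<in> {0..1}"
    then show "0 \<le> - chord_gap'' u" using chord_gap''_nonpos by simp
    have "\<bar>cone_sum (u * Y) - pi / 2 * (u * Y)\<^sup>2\<bar> \<le> 10 * (u * Y + 1)"
      by (rule cone_sum_asymp) (use u Y in auto)
    also have "\<dots> \<le> 10 * (Y + 1)" using u Y by (simp add: mult_left_le_one_le)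
    finally show "\<bar>cone_sum (u * Y) - pi / 2 * (u * Y)\<^sup>2\<bar> \<le> 10 * (Y + 1)" .
  qed
  moreover have "10 * (Y + 1) * sqrt 2 = 10 * sqrt 2 * (Y + 1)" by simp
  ultimately show ?thesis unfolding F_def[symmetric] by linarith
qed

section \<open>Fibre counts and comparison with the sum of chords\<close>

lemma card_int_square_less:
  assumes y: "y > 0"
  shows "\<bar>real (card {n::int. (real_of_int n)\<^sup>2 < y}) - 2 * sqrt y\<bar>
      \<le> 1" "finite {n::int. (real_of_int n)\<^sup>2 < y}"
proof -
  define k where "k = \<lceil>sqrt y\<rceil>"
  have k: "k \<ge> 1" using y by (simp add: k_def one_le_ceiling)
  have set: "{n::int. (real_of_int n)\<^sup>2 < y} = {-(k - 1)..k - 1}"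
  proof (intro set_eqI)
    fix n :: int
    have "(real_of_int n)\<^sup>2 < y \<longleftrightarrow> \<bar>real_of_int n\<bar> < sqrt y"
      using real_sqrt_less_iff[of "(real_of_int n)\<^sup>2" y] by simp
    also have "\<dots> \<longleftrightarrow> \<bar>n\<bar> < k" unfolding k_def less_ceiling_iff by simp
    finally show "n \<in> {n::int. (real_of_int n)\<^sup>2 < y} \<longleftrightarrow> n \<in> {-(k - 1)..k - 1}" by auto
  qed
  show "finite {n::int. (real_of_int n)\<^sup>2 < y}" unfolding set by simp
  have "real (card {n::int. (real_of_int n)\<^sup>2 < y}) = 2 * of_int k - 1"
    unfolding set using k by simp
  moreover have "of_int k - 1 < sqrt y" "sqrt y \<le> of_int k" unfolding k_def by linarith+
  ultimately show "\<bar>real (card {n::int. (real_of_int n)\<^sup>2 < y}) - 2 * sqrt y\<bar> \<le> 1"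
    by (simp add: abs_le_iff)
qed

text \<open>Grouping by the point \<open>z = (a, b)\<close> in place of its squared norm m absorbs
  \<open>r2 m\<close>.\<close>

lemma heis_count_eq:
  assumes Y: "Y > 0"
  shows "heis_count (Y\<^sup>2) = (\<Sum>z | nsq z < Y. card {n::int. (real_of_int n)\<^sup>2 < Y\<^sup>2 - (nsq z)\<^sup>2})"
proof -
  define D where "D = {z. nsq z < Y}"
  have finD: "finite D" by (rule finite_subset[OF _ finite_disc[of Y]]) (auto simp: D_def disc_def)
  define A where "A = (SIGMA p:S_index (Y\<^sup>2). {(a :: int, b :: int). a\<^sup>2 + b\<^sup>2 = int (fst p)})"
  define B where "B = (SIGMA z:D. {n::int. (real_of_int n)\<^sup>2 < Y\<^sup>2 - (nsq z)\<^sup>2})"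
  have "heis_count (Y\<^sup>2) = (\<Sum>p\<in>S_index (Y\<^sup>2). card {(a :: int, b :: int). a\<^sup>2 + b\<^sup>2 = int (fst p)})"
    unfolding heis_count_def by (intro sum.cong refl) (auto simp: r2_def)
  also have "\<dots> = card A" unfolding A_def using finite_S_index finite_r2_set by (subst card_SigmaI) auto
  also have "card A = card B"
  proof (rule bij_betw_same_card)
    have key: "real m = nsq (a, b)" if "a\<^sup>2 + b\<^sup>2 = int m" for m a b
    proof -
      have "real_of_int (a\<^sup>2 + b\<^sup>2) = real_of_int (int m)" using that by simp
      then show ?thesis by (simp add: nsq_def)
    qed
    have key2: "a\<^sup>2 + b\<^sup>2 = int (nat (a\<^sup>2 + b\<^sup>2))" for a b :: int by simp
    have lt: "x < Y" if "x\<^sup>2 + (real_of_int n)\<^sup>2 < Y\<^sup>2" for x n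
    proof -
      have "x\<^sup>2 < Y\<^sup>2" using that zero_le_power2[of "real_of_int n"] by linarith
      then show ?thesis using Y by (simp add: power2_less_imp_less)
    qed
    show "bij_betw (\<lambda>(p, z). (z, snd p)) A B"
    proof (rule bij_betwI[where g = "\<lambda>(z, n). ((nat ((fst z)\<^sup>2 + (snd z)\<^sup>2), n), z)"])
      show "(\<lambda>(p, z). (z, snd p)) \<in> A \<rightarrow> B"
        by (auto simp: A_def B_def D_def S_index_def key[symmetric] dest: lt)
      show "(\<lambda>(z, n). ((nat ((fst z)\<^sup>2 + (snd z)\<^sup>2), n), z)) \<in> B \<rightarrow> A"
        by (auto simp: A_def B_def D_def S_index_def nsq_def algebra_simps)
    qed (auto simp: A_def B_def)
  qed
  also have "card B = (\<Sum>z\<in>D. card {n::int. (real_of_int n)\<^sup>2 < Y\<^sup>2 - (nsq z)\<^sup>2})"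
  proof -
    have "finite {n::int. (real_of_int n)\<^sup>2 < Y\<^sup>2 - (nsq z)\<^sup>2}" if "z \<in> D" for z
    proof (rule card_int_square_less(2))
      have "(nsq z)\<^sup>2 < Y\<^sup>2" using that by (intro power_strict_mono) (auto simp: D_def)
      then show "0 < Y\<^sup>2 - (nsq z)\<^sup>2" by simp
    qed
    then show ?thesis unfolding B_def using finD by (intro card_SigmaI) auto
  qed
  finally show ?thesis by (simp add: D_def)
qed

text \<open>Replacing each fibre count by twice a square root costs at most 1 for each of at most
  \<open>9 * t^2\<close> points; passing from there to chords costs at most
  \<open>40 * t^2\<close>.\<close>

lemma heis_error_chord_error:
  assumes t: "t \<ge> 1"
  shows "\<bar>heis_error (t ^ 4) - sqrt 2 * t * chord_error t\<bar> \<le> 50 * t\<^sup>2"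
proof -
  define Y where "Y = t\<^sup>2"
  have Y: "Y \<ge> 1" using t by (simp add: Y_def)
  define D where "D = {z. nsq z < Y}"
  have DY: "D \<subseteq> disc Y" by (auto simp: D_def disc_def)
  then have finD: "finite D" using finite_disc finite_subset by blast
  define G where "G = (\<Sum>z\<in>disc Y. 2 * sqrt (Y\<^sup>2 - (nsq z)\<^sup>2))"
  \<comment> \<open>The count uses the open disc, \<open>chord_gap_sum_asymp\<close> the closed one;
    on the boundary circle the summand is 0.\<close>
  have GD: "G = (\<Sum>z\<in>D. 2 * sqrt (Y\<^sup>2 - (nsq z)\<^sup>2))"
    unfolding G_def
      by (rule sum.mono_neutral_right[OF finite_disc DY])
        (auto simp: D_def disc_def order.order_iff_strict)
  have "\<bar>real (heis_count (Y\<^sup>2)) - G\<bar>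
      \<le> (\<Sum>z\<in>D. \<bar>real (card {n::int. (real_of_int n)\<^sup>2 < Y\<^sup>2 - (nsq z)\<^sup>2}) - 2 * sqrt
      (Y\<^sup>2 - (nsq z)\<^sup>2)\<bar>)"
  proof -
    have "real (heis_count (Y\<^sup>2)) = (\<Sum>z\<in>D. real (card {n::int. (real_of_int n)\<^sup>2 < Y\<^sup>2 - (nsq z)\<^sup>2}))"
      using heis_count_eq[of Y] Y by (simp add: D_def)
    then show ?thesis unfolding GD by (simp only: sum_subtractf[symmetric] sum_abs)
  qed
  also have "\<dots> \<le> (\<Sum>z\<in>D. 1)"
  proof (rule sum_mono)
    fix z assume "z \<in> D"
    then have "(nsq z)\<^sup>2 < Y\<^sup>2" by (intro power_strict_mono) (auto simp: D_def)
    then show "\<bar>real (card {n::int. (real_of_int n)\<^sup>2 < Y\<^sup>2 - (nsq z)\<^sup>2}) - 2 * sqrt (Y\<^sup>2 - (nsq z)\<^sup>2)\<bar>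
        \<le> 1"
      by (intro card_int_square_less(1)) simp
  qed
  also have "\<dots> = real (card D)" by simp
  also have "\<dots> \<le> real (card (disc Y))" using DY by (intro of_nat_mono card_mono) auto
  also have "\<dots> \<le> (2 * sqrt Y + 1)\<^sup>2" using Y by (intro card_disc_le) auto
  also have "\<dots> \<le> (3 * t)\<^sup>2" using t by (intro power_mono) (auto simp: Y_def)
  also have "\<dots> = 9 * Y" by (simp add: Y_def power_mult_distrib)
  finally have 1: "\<bar>real (heis_count (Y\<^sup>2)) - G\<bar> \<le> 9 * Y" .
  have gap: "(\<Sum>z\<in>disc Y. Y * chord_gap (nsq z / Y)) = G - sqrt 2 * t * chord_sum t"
  proof -
    have "Y * chord_gap (nsq z / Y) = 2 * sqrt (Y\<^sup>2 - (nsq z)\<^sup>2) - sqrt 2 * t * chord z t"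
        if "z \<in> disc Y" for z
    proof -
      have "Y * sqrt (1 - (nsq z / Y)\<^sup>2) = sqrt (Y\<^sup>2 * (1 - (nsq z / Y)\<^sup>2))" using Y
        by (simp add: real_sqrt_mult)
      also have "Y\<^sup>2 * (1 - (nsq z / Y)\<^sup>2) = Y\<^sup>2 - (nsq z)\<^sup>2" using Y
        by (simp add: power_divide right_diff_distrib)
      finally have a: "Y * sqrt (1 - (nsq z / Y)\<^sup>2) = sqrt (Y\<^sup>2 - (nsq z)\<^sup>2)" .
      have "t * sqrt (1 - nsq z / Y) = sqrt (Y * (1 - nsq z / Y))" using t
        by (simp add: real_sqrt_mult Y_def)
      also have "Y * (1 - nsq z / Y) = max 0 (t\<^sup>2 - nsq z)" using Y that
        by (simp add: right_diff_distrib disc_def Y_def[symmetric])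
      finally have "t * sqrt (1 - nsq z / Y) = sqrt (max 0 (t\<^sup>2 - nsq z))" .
      then have b: "Y * sqrt (1 - nsq z / Y) = t * sqrt (max 0 (t\<^sup>2 - nsq z))"
        unfolding Y_def power2_eq_square by (simp add: mult.assoc)
      have "Y * chord_gap (nsq z / Y) = 2 * (Y * sqrt (1 - (nsq z / Y)\<^sup>2))
          - 2 * sqrt 2 * (Y * sqrt (1 - nsq z / Y))"
        by (simp add: chord_gap_def algebra_simps)
      then show ?thesis unfolding a b by (simp add: chord_def)
    qed
    then show ?thesis unfolding G_def chord_sum_def Y_def[symmetric] sum_distrib_left
      by (simp add: sum_subtractf)
  qed
  have "\<bar>G - sqrt 2 * t * chord_sum t - pi * Y\<^sup>2 * (pi / 2 - 4 / 3 * sqrt 2)\<bar> \<le> 10 * sqrt 2 * (Y + 1)"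
    using chord_gap_sum_asymp[of Y] Y unfolding gap by simp
  also have "\<dots> \<le> 10 * 2 * (Y + Y)"
  proof -
    have "sqrt 2 \<le> sqrt 4" by (rule real_sqrt_le_mono) simp
    then have "sqrt 2 \<le> 2" by simp
    then show ?thesis using Y by (intro mult_mono) auto
  qed
  finally have 2: "\<bar>G - sqrt 2 * t * chord_sum t - pi * Y\<^sup>2 * (pi / 2 - 4 / 3 * sqrt 2)\<bar> \<le> 40 * Y"
    by simp
  have t4: "t ^ 4 = Y\<^sup>2" by (simp add: Y_def flip: power_mult)
  \<comment> \<open>The main terms match because \<open>pi * (pi / 2 - 4/3 * sqrt 2) + sqrt 2 * (4/3
    * pi) = pi^2 / 2\<close>.\<close>
  have "heis_error (t ^ 4) - sqrt 2 * t * chord_error t =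
     (real (heis_count (Y\<^sup>2)) - G) + (G - sqrt 2 * t * chord_sum t - pi * Y\<^sup>2 *
         (pi / 2 - 4 / 3 * sqrt 2))"
  proof -
    have "t * t ^ 3 = Y\<^sup>2" unfolding t4[symmetric] by (simp add: eval_nat_numeral)
    then have "sqrt 2 * t * chord_error t = sqrt 2 * t * chord_sum t - 4 / 3 * sqrt 2 * pi * Y\<^sup>2"
      by (simp add: chord_error_def algebra_simps)
    then show ?thesis by (simp add: heis_error_def t4 algebra_simps power2_eq_square)
  qed
  then have "\<bar>heis_error (t ^ 4) - sqrt 2 * t * chord_error t\<bar> \<le> 9 * Y + 40 * Y" using 1 2 by linarith
  also have "\<dots> \<le> 50 * t\<^sup>2" using Y by (simp add: Y_def)
  finally show ?thesis .
qed

section \<open>Transfer of unboundedness to the lattice point count\<close>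

lemma heis_error_not_bounded:
  fixes \<kappa> C :: real
  assumes \<kappa>: "\<kappa> = 1 \<or> \<kappa> = -1" and ev: "\<forall>\<^sub>F x in at_top. \<kappa> * heis_error x \<le> C * x powr (1 / 2)"
  shows False
proof -
  obtain x0 where x0: "\<And>x. x \<ge> x0 \<Longrightarrow> \<kappa> * heis_error x \<le> C * x powr (1 / 2)"
    using ev by (auto simp: eventually_at_top_linorder)
  define t1 where "t1 = max 1 x0"
  have abs\<kappa>: "\<bar>\<kappa>\<bar> = 1" using \<kappa> by auto
  have large: "\<kappa> * chord_error t \<le> \<bar>C + 50\<bar> * (1 + t)" if t: "t \<ge> t1" for t
  proof -
    have t1: "t \<ge> 1" "t \<ge> x0" using t by (auto simp: t1_def)
    have "t \<le> t ^ 4" using t1(1) by (intro self_le_power) auto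
    then have "x0 \<le> t ^ 4" using t1(2) by simp
    then have "\<kappa> * heis_error (t ^ 4) \<le> C * (t ^ 4) powr (1 / 2)" by (rule x0)
    also have "(t ^ 4) powr (1 / 2) = t\<^sup>2"
    proof -
      have t4: "t ^ 4 = (t\<^sup>2)\<^sup>2" by (simp flip: power_mult)
      show ?thesis unfolding t4 powr_half_sqrt[OF zero_le_power2] real_sqrt_abs by simp
    qed
    finally have 1: "\<kappa> * heis_error (t ^ 4) \<le> C * t\<^sup>2" .
    have "\<bar>\<kappa> * (heis_error (t ^ 4) - sqrt 2 * t * chord_error t)\<bar> \<le> 50 * t\<^sup>2"
      unfolding abs_mult abs\<kappa> using heis_error_chord_error[OF t1(1)] by simp
    then have "\<kappa> * (sqrt 2 * t * chord_error t) \<le> \<kappa> * heis_error (t ^ 4) + 50 * t\<^sup>2"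
      by (simp add: abs_le_iff right_diff_distrib)
    also have "\<dots> \<le> (C + 50) * t\<^sup>2" using 1 by (simp add: distrib_right)
    finally have "t * (sqrt 2 * (\<kappa> * chord_error t)) \<le> t * ((C + 50) * t)"
      by (simp add: power2_eq_square mult_ac)
    then have 2: "sqrt 2 * (\<kappa> * chord_error t) \<le> (C + 50) * t" using t1(1) by simp
    also have "\<dots> \<le> \<bar>C + 50\<bar> * (1 + t)" using t1(1) by (intro mult_mono) auto
    finally have 3: "sqrt 2 * (\<kappa> * chord_error t) \<le> \<bar>C + 50\<bar> * (1 + t)" .
    show ?thesis
    proof (cases "\<kappa> * chord_error t \<ge> 0")
      case True
      then have "1 * (\<kappa> * chord_error t) \<le> sqrt 2 * (\<kappa> * chord_error t)" by (intro mult_right_mono) auto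
      then show ?thesis using 3 by simp
    next
      case False
      then show ?thesis using t1(1) by (smt (verit) mult_nonneg_nonneg abs_ge_zero)
    qed
  qed
  \<comment> \<open>\<open>chord_error_unbounded\<close> refutes a bound valid for all
    \<open>t \<ge> 0\<close>, so the range below t1 is covered by compactness.\<close>
  have "continuous_on UNIV chord_error"
    unfolding chord_error_def[abs_def] by (intro continuous_intros chord_sum_continuous)
  then have "compact (chord_error ` {0..t1})"
    by (intro compact_continuous_image) (auto intro: continuous_on_subset)
  then have "bounded (chord_error ` {0..t1})" by (rule compact_imp_bounded)
  then obtain B where "\<forall>x\<in>chord_error ` {0..t1}. norm x \<le> B"
    unfolding bounded_iff by blast
  then have B: "\<bar>chord_error t\<bar> \<le> B" if "t \<in> {0..t1}" for t using that by simp
  have "\<bar>chord_error 0\<bar> \<le> B" by (rule B) (simp add: t1_def)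
  then have B0: "B \<ge> 0" by linarith
  have "\<kappa> * chord_error t \<le> (B + \<bar>C + 50\<bar>) * (1 + t)" if t: "t \<ge> 0" for t
  proof (cases "t \<ge> t1")
    case True
    have "\<bar>C + 50\<bar> * (1 + t) \<le> (B + \<bar>C + 50\<bar>) * (1 + t)" using t B0 by (intro mult_right_mono) auto
    then show ?thesis using large[OF True] by linarith
  next
    case False
    have "\<kappa> * chord_error t \<le> \<bar>\<kappa> * chord_error t\<bar>" by (rule abs_ge_self)
    also have "\<dots> \<le> B" unfolding abs_mult abs\<kappa> using B[of t] t False by simp
    also have "\<dots> \<le> (B + \<bar>C + 50\<bar>) * 1" by simp
    also have "\<dots> \<le> (B + \<bar>C + 50\<bar>) * (1 + t)" using t B0 by (intro mult_left_mono) auto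
    finally show ?thesis .
  qed
  then show False using chord_error_unbounded[OF \<kappa>] by blast
qed

theorem theorem1:
  shows "Limsup at_top (\<lambda>x::real. ereal (heis_error x / x powr (1/2))) = \<infinity> \<and>
         Liminf at_top (\<lambda>x::real. ereal (heis_error x / x powr (1/2))) = -\<infinity>"
proof (intro conjI)
  have pos: "\<forall>\<^sub>F x in at_top. x > (0::real)" by (rule eventually_gt_at_top)
  show "Limsup at_top (\<lambda>x::real. ereal (heis_error x / x powr (1/2))) = \<infinity>"
  proof (rule ccontr)
    assume "Limsup at_top (\<lambda>x::real. ereal (heis_error x / x powr (1/2))) \<noteq> \<infinity>"
    then have "Limsup at_top (\<lambda>x::real. ereal (heis_error x / x powr (1/2))) < \<infinity>" by simp
    then obtain C where "Limsup at_top (\<lambda>x::real. ereal (heis_error x / x powr (1/2))) < ereal C"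
      using ereal_dense2 by blast
    then have "\<forall>\<^sub>F x in at_top. ereal (heis_error x / x powr (1/2)) < ereal C" by (rule Limsup_lessD)
    with pos have "\<forall>\<^sub>F x in at_top. 1 * heis_error x \<le> C * x powr (1 / 2)"
      by eventually_elim (simp add: field_simps)
    then show False by (rule heis_error_not_bounded[rotated]) simp
  qed
  show "Liminf at_top (\<lambda>x::real. ereal (heis_error x / x powr (1/2))) = -\<infinity>"
  proof (rule ccontr)
    assume "Liminf at_top (\<lambda>x::real. ereal (heis_error x / x powr (1/2))) \<noteq> -\<infinity>"
    then have "-\<infinity> < Liminf at_top (\<lambda>x::real. ereal (heis_error x / x powr (1/2)))" by simp
    then obtain C where "ereal C < Liminf at_top (\<lambda>x::real. ereal (heis_error x / x powr (1/2)))"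
      using ereal_dense2 by blast
    then have "\<forall>\<^sub>F x in at_top. ereal C < ereal (heis_error x / x powr (1/2))" by (rule less_LiminfD)
    with pos have "\<forall>\<^sub>F x in at_top. -1 * heis_error x \<le> (- C) * x powr (1 / 2)"
      by eventually_elim (simp add: field_simps)
    then show False by (rule heis_error_not_bounded[rotated]) simp
  qed
qed

end
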